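(* Let $n,m\geq1$, $A,C\in\mathbb{R}^{n\times n}$ and $B\in\mathbb{R}^{n\times m}$. If the backward-structured stochastic system $dX(t)=[AX(t)+Bu(t)+Cz(t)]\,dt+z(t)\,dW(t)$, $X(0)=x$, is exactly controllable, then it is stabilizable.
   Context: $W=\{W(t)\}_{t\geq0}$ is a standard one-dimensional Brownian motion on a complete probability space $(\Omega,\mathscr{F},\mathbb{P})$, and $\mathbb{F}=\{\mathscr{F}_t\}_{t\ge0}$ is its natural filtration augmented by all $\mathbb{P}$-null sets. $L^2_{\mathbb{F}}(0,T;\mathbb{R}^d)$ is the space of $\mathbb{F}$-progressively measurable $\mathbb{R}^d$-valued processes $\varphi$ on $[0,T]$ with $\mathbb{E}\int_0^T|\varphi(t)|^2dt<\infty$; $L^2_{\mathscr{F}_T}(\Omega;\mathbb{R}^n)$ is the space of $\mathscr{F}_T$-measurable square-integrable $\mathbb{R}^n$-valued random variables. In the system, the pair $(u,z)$ is the control, and $X(\cdot\,;x,u,z)$ denotes the solution. The system is exactly controllable on $[0,T]$ ($T>0$) if for every $(x,\xi)\in\mathbb{R}^n\times L^2_{\mathscr{F}_T}(\Omega;\mathbb{R}^n)$ there exists $(u,z)\in L^2_{\mathbb{F}}(0,T;\mathbb{R}^m)\times L^2_{\mathbb{F}}(0,T;\mathbb{R}^n)$ such that $X(T;x,u,z)=\xi$ almost surely. This property does not depend on the choice of $T>0$, so "exactly controllable" means exactly controllable on $[0,T]$ for an arbitrary $T>0$. The system is stabilizable if there exist matrices $F\in\mathbb{R}^{m\times n}$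 and $K\in\mathbb{R}^{n\times n}$ such that the closed-loop system $dX(t)=(A+BF+CK)X(t)\,dt+KX(t)\,dW(t)$, $X(0)=x$, is $L^2$-stable, i.e. its solution satisfies $\mathbb{E}\int_0^\infty|X(t;x)|^2dt<\infty$ for all $x\in\mathbb{R}^n$. (For such linear systems $L^2$-stability is equivalent to exponential mean-square stability and to asymptotic mean-square stability, $\lim_{t\to\infty}\mathbb{E}|X(t;x)|^2=0$ for all $x$.) *)

theory Defs
  imports "HOL-Probability.Probability"
begin

section \<open>Brownian motion and its augmented natural filtration\<close>

definition natural_filtration ::
    "'w measure \<Rightarrow> (real \<Rightarrow> 'w \<Rightarrow> real) \<Rightarrow> real \<Rightarrow> 'w measure" where
  "natural_filtration M W t =
     sigma (space M) {W s -` S \<inter> space M | s S. s \<in> {0..t} \<and> S \<in> sets borel}"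

text \<open>Only the \<open>\<sigma>\<close>-algebra of these measures is used; probabilities are always taken under \<open>M\<close>.\<close>

definition aug_filtration ::
    "'w measure \<Rightarrow> (real \<Rightarrow> 'w \<Rightarrow> real) \<Rightarrow> real \<Rightarrow> 'w measure" where
  "aug_filtration M W t =
     sigma (space M) (sets (natural_filtration M W t) \<union> null_sets M)"

locale standard_brownian_motion = prob_space M for M :: "'w measure" +
  fixes W :: "real \<Rightarrow> 'w \<Rightarrow> real"
  assumes W_measurable: "0 \<le> t \<Longrightarrow> W t \<in> borel_measurable M"
    and W_zero: "AE \<omega> in M. W 0 \<omega> = 0"
    and W_continuous: "AE \<omega> in M. continuous_on {0..} (\<lambda>t. W t \<omega>)"
    and W_increment: "0 \<le> s \<Longrightarrow> s < t \<Longrightarrow>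
      distributed M lborel (\<lambda>\<omega>. W t \<omega> - W s \<omega>) (normal_density 0 (sqrt (t - s)))"
    and W_independent: "0 \<le> s \<Longrightarrow> s < t \<Longrightarrow>
      indep_set (sets (natural_filtration M W s))
        {(\<lambda>\<omega>. W t \<omega> - W s \<omega>) -` S \<inter> space M | S. S \<in> sets borel}"

section \<open>Square-integrable progressively measurable processes\<close>

definition progressive ::
    "'w measure \<Rightarrow> (real \<Rightarrow> 'w \<Rightarrow> real) \<Rightarrow> real \<Rightarrow> (real \<Rightarrow> 'w \<Rightarrow> 'a::euclidean_space) \<Rightarrow> bool" where
  "progressive M W T \<phi> \<longleftrightarrow>
     (\<forall>t\<in>{0..T}. (\<lambda>(s, \<omega>). \<phi> s \<omega>) \<in>
        borel_measurable (restrict_space borel {0..t} \<Otimes>\<^sub>M aug_filtration M W t))"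

definition L2_prog ::
    "'w measure \<Rightarrow> (real \<Rightarrow> 'w \<Rightarrow> real) \<Rightarrow> real \<Rightarrow> (real \<Rightarrow> 'w \<Rightarrow> 'a::euclidean_space) \<Rightarrow> bool" where
  "L2_prog M W T \<phi> \<longleftrightarrow> progressive M W T \<phi> \<and>
     (\<integral>\<^sup>+\<omega>. (\<integral>\<^sup>+s\<in>{0..T}. ennreal ((norm (\<phi> s \<omega>))\<^sup>2) \<partial>lborel) \<partial>M) < \<infinity>"

definition L2_rv ::
    "'w measure \<Rightarrow> (real \<Rightarrow> 'w \<Rightarrow> real) \<Rightarrow> real \<Rightarrow> ('w \<Rightarrow> 'a::euclidean_space) \<Rightarrow> bool" where
  "L2_rv M W T \<xi> \<longleftrightarrow> \<xi> \<in> borel_measurable (aug_filtration M W T) \<and>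
     (\<integral>\<^sup>+\<omega>. ennreal ((norm (\<xi> \<omega>))\<^sup>2) \<partial>M) < \<infinity>"

section \<open>The It\^o integral\<close>

text \<open>
  A triple \<open>(k, \<tau>, \<eta>)\<close> encodes the simple process
  \<open>\<Sum>i<k. \<eta> i \<cdot> indicator {\<tau> i<..\<tau> (i+1)}\<close> with partition points \<open>\<tau> 0 \<le> \<dots> \<le> \<tau> k\<close> in \<open>[0, T]\<close>
  and bounded coefficients \<open>\<eta> i\<close> that are measurable at time \<open>\<tau> i\<close>.
\<close>

type_synonym ('w, 'a) simple_data = "nat \<times> (nat \<Rightarrow> real) \<times> (nat \<Rightarrow> 'w \<Rightarrow> 'a)"

definition is_simple ::
    "'w measure \<Rightarrow> (real \<Rightarrow> 'w \<Rightarrow> real) \<Rightarrow> real \<Rightarrow> ('w, 'a::euclidean_space) simple_data \<Rightarrow> bool" where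
  "is_simple M W T = (\<lambda>(k, \<tau>, \<eta>).
     0 \<le> \<tau> 0 \<and> \<tau> k \<le> T \<and> (\<forall>i<k. \<tau> i \<le> \<tau> (Suc i)) \<and>
     (\<forall>i<k. \<eta> i \<in> borel_measurable (aug_filtration M W (\<tau> i))) \<and>
     (\<exists>c. \<forall>i<k. \<forall>\<omega>\<in>space M. norm (\<eta> i \<omega>) \<le> c))"

definition simple_process ::
    "('w, 'a::euclidean_space) simple_data \<Rightarrow> real \<Rightarrow> 'w \<Rightarrow> 'a" where
  "simple_process = (\<lambda>(k, \<tau>, \<eta>) s \<omega>.
     \<Sum>i<k. indicator {\<tau> i<..\<tau> (Suc i)} s *\<^sub>R \<eta> i \<omega>)"

definition simple_integral ::
    "(real \<Rightarrow> 'w \<Rightarrow> real) \<Rightarrow> ('w, 'a::euclidean_space) simple_data \<Rightarrow> 'w \<Rightarrow> 'a" where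
  "simple_integral W = (\<lambda>(k, \<tau>, \<eta>) \<omega>.
     \<Sum>i<k. (W (\<tau> (Suc i)) \<omega> - W (\<tau> i) \<omega>) *\<^sub>R \<eta> i \<omega>)"

text \<open>
  \<open>Y\<close> is a version of the It\^o integral of \<open>\<phi>\<close> over \<open>[0, T]\<close>: the \<open>L\<^sup>2(\<Omega>)\<close>-limit of the
  integrals of simple processes that converge to \<open>\<phi>\<close> in \<open>L\<^sup>2([0, T] \<times> \<Omega>)\<close>.
\<close>

definition has_ito_integral ::
    "'w measure \<Rightarrow> (real \<Rightarrow> 'w \<Rightarrow> real) \<Rightarrow> real \<Rightarrow>
     (real \<Rightarrow> 'w \<Rightarrow> 'a::euclidean_space) \<Rightarrow> ('w \<Rightarrow> 'a) \<Rightarrow> bool" where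
  "has_ito_integral M W T \<phi> Y \<longleftrightarrow>
     L2_prog M W T \<phi> \<and> Y \<in> borel_measurable M \<and>
     (\<exists>S :: nat \<Rightarrow> ('w, 'a) simple_data.
        (\<forall>j. is_simple M W T (S j)) \<and>
        (\<lambda>j. \<integral>\<^sup>+\<omega>. (\<integral>\<^sup>+s\<in>{0..T}.
           ennreal ((norm (simple_process (S j) s \<omega> - \<phi> s \<omega>))\<^sup>2) \<partial>lborel) \<partial>M) \<longlonglongrightarrow> 0 \<and>
        (\<lambda>j. \<integral>\<^sup>+\<omega>. ennreal ((norm (simple_integral W (S j) \<omega> - Y \<omega>))\<^sup>2) \<partial>M) \<longlonglongrightarrow> 0)"

text \<open>
  \<open>X\<close> satisfies \<open>dX(t) = b(t) dt + \<sigma>(t) dW(t)\<close>, \<open>X(0) = x\<close> on \<open>[0, T]\<close>. The integral equation is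
  required almost surely at each time, the It\^o integral being determined only up to null sets at
  each time; by path continuity this is the same as equality of the two processes up to
  indistinguishability.
\<close>

definition is_ito_process ::
    "'w measure \<Rightarrow> (real \<Rightarrow> 'w \<Rightarrow> real) \<Rightarrow> real \<Rightarrow> 'a::euclidean_space \<Rightarrow>
     (real \<Rightarrow> 'w \<Rightarrow> 'a) \<Rightarrow> (real \<Rightarrow> 'w \<Rightarrow> 'a) \<Rightarrow> (real \<Rightarrow> 'w \<Rightarrow> 'a) \<Rightarrow> bool" where
  "is_ito_process M W T x b \<sigma> X \<longleftrightarrow>
     L2_prog M W T X \<and> L2_prog M W T b \<and> L2_prog M W T \<sigma> \<and>
     (AE \<omega> in M. continuous_on {0..T} (\<lambda>t. X t \<omega>)) \<and>
     (\<forall>t\<in>{0..T}. \<exists>Y. has_ito_integral M W t \<sigma> Y \<and>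
        (AE \<omega> in M. X t \<omega> = x + (LBINT s:{0..t}. b s \<omega>) + Y \<omega>))"

section \<open>Controllability and stabilizability\<close>

definition controlled_solution ::
    "'w measure \<Rightarrow> (real \<Rightarrow> 'w \<Rightarrow> real) \<Rightarrow> real \<Rightarrow>
     real^'n^'n \<Rightarrow> real^'m^'n \<Rightarrow> real^'n^'n \<Rightarrow> real^'n \<Rightarrow>
     (real \<Rightarrow> 'w \<Rightarrow> real^'m) \<Rightarrow> (real \<Rightarrow> 'w \<Rightarrow> real^'n) \<Rightarrow> (real \<Rightarrow> 'w \<Rightarrow> real^'n) \<Rightarrow> bool" where
  "controlled_solution M W T A B C x u z X \<longleftrightarrow>
     is_ito_process M W T x (\<lambda>t \<omega>. A *v X t \<omega> + B *v u t \<omega> + C *v z t \<omega>) z X"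

definition exactly_controllable_on ::
    "'w measure \<Rightarrow> (real \<Rightarrow> 'w \<Rightarrow> real) \<Rightarrow> real \<Rightarrow>
     real^'n^'n \<Rightarrow> real^'m^'n \<Rightarrow> real^'n^'n \<Rightarrow> bool" where
  "exactly_controllable_on M W T A B C \<longleftrightarrow>
     (\<forall>x :: real^'n. \<forall>\<xi> :: 'w \<Rightarrow> real^'n. L2_rv M W T \<xi> \<longrightarrow>
        (\<exists>u z X. L2_prog M W T u \<and> L2_prog M W T z \<and>
           controlled_solution M W T A B C x u z X \<and>
           (AE \<omega> in M. X T \<omega> = \<xi> \<omega>)))"

definition closed_loop_solution ::
    "'w measure \<Rightarrow> (real \<Rightarrow> 'w \<Rightarrow> real) \<Rightarrow>
     real^'n^'n \<Rightarrow> real^'m^'n \<Rightarrow> real^'n^'n \<Rightarrow> real^'n^'m \<Rightarrow> real^'n^'n \<Rightarrow> real^'n \<Rightarrow>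
     (real \<Rightarrow> 'w \<Rightarrow> real^'n) \<Rightarrow> bool" where
  "closed_loop_solution M W A B C F K x X \<longleftrightarrow>
     (\<forall>T\<ge>0. is_ito_process M W T x
        (\<lambda>t \<omega>. (A + B ** F + C ** K) *v X t \<omega>) (\<lambda>t \<omega>. K *v X t \<omega>) X)"

text \<open>
  A linear equation has, for each \<open>x\<close>, a solution that is unique up to indistinguishability, so the
  quantifier over \<open>X\<close> below ranges over the versions of the solution \<open>X(\<cdot>; x)\<close>.
\<close>

definition L2_stable_closed_loop ::
    "'w measure \<Rightarrow> (real \<Rightarrow> 'w \<Rightarrow> real) \<Rightarrow>
     real^'n^'n \<Rightarrow> real^'m^'n \<Rightarrow> real^'n^'n \<Rightarrow> real^'n^'m \<Rightarrow> real^'n^'n \<Rightarrow> bool" where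
  "L2_stable_closed_loop M W A B C F K \<longleftrightarrow>
     (\<forall>x X. closed_loop_solution M W A B C F K x X \<longrightarrow>
        (\<integral>\<^sup>+\<omega>. (\<integral>\<^sup>+t\<in>{0..}. ennreal ((norm (X t \<omega>))\<^sup>2) \<partial>lborel) \<partial>M) < \<infinity>)"

definition stabilizable ::
    "'w measure \<Rightarrow> (real \<Rightarrow> 'w \<Rightarrow> real) \<Rightarrow>
     real^'n^'n \<Rightarrow> real^'m^'n \<Rightarrow> real^'n^'n \<Rightarrow> bool" where
  "stabilizable M W A B C \<longleftrightarrow>
     (\<exists>(F :: real^'n^'m) (K :: real^'n^'n). L2_stable_closed_loop M W A B C F K)"

end

theory Submission
  imports Defs
begin

text \<open>
  The possibility of steering every \<open>x\<close> to \<open>0\<close> meets stabilizability in a theorem of alternatives for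
  symmetric matrices.

  Suppose that the feedback is to be certified by the Lyapunov function \<open>x \<bullet> P x\<close> with \<open>P = Q\<inverse>\<close>. For
  given \<open>P\<close>, its generator along the closed loop is smallest for \<open>K = - Q C\<^sup>T P\<close>, and
  \<open>F = - (\<rho> / 2) B\<^sup>T P\<close> with a large \<open>\<rho>\<close> damps every direction that the control \<open>u\<close> reaches. In the
  variable \<open>y = P x\<close> the resulting decay condition is linear in \<open>(Q, \<rho>)\<close>:
  \<open>C Q C\<^sup>T - A Q - Q A\<^sup>T + \<rho> B B\<^sup>T\<close> has to be positive definite for some positive definite \<open>Q\<close>
  (\<open>lyapunov_feedback\<close>). If no such pair exists, a hyperplane separates two convex cones of matrices,
  and its normal is a nonzero positive semidefinite \<open>S\<close> with \<open>S B = 0\<close> whose kernel is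
  invariant under \<open>A\<close> and \<open>C\<close> (\<open>stabilization_alternative\<close>).

  Such an \<open>S\<close> contradicts exact controllability. Along a controlled trajectory the pair \<open>(S X, S z)\<close>
  solves a linear backward equation of its own: \<open>u\<close> disappears, and \<open>S A v\<close>, \<open>S C v\<close> are bounded by
  multiples of \<open>S v\<close>. A solution of such an equation that vanishes at time \<open>T\<close> vanishes at time \<open>0\<close>
  (\<open>backward_uniqueness\<close>), so a trajectory from \<open>x\<close> to \<open>0\<close> has \<open>S x = 0\<close>; as \<open>x\<close> is arbitrary, \<open>S = 0\<close>.

  Hence a certificate exists. Over a short time window the expected value of \<open>X \<bullet> P X\<close> drops by at
  least a fixed multiple of the expected integral of the squared norm of \<open>X\<close> over the window, for every
  closed-loop solution (\<open>lyapunov_step\<close>). The window length does not depend on its position, so the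
  estimates add up to a bound for all times.

  Both stochastic estimates need from It\^o calculus just two properties of the difference \<open>I\<close> of
  the integrals at times \<open>s \<le> t\<close>: the isometry, and orthogonality of \<open>I\<close> to square-integrable
  \<open>\<F>\<^sub>s\<close>-measurable vectors (\<open>ito_increment\<close>). It\^o's formula is replaced by expanding
  the quadratic form on a window, where every correction is small compared with the energy there.
\<close>

section \<open>A theorem of alternatives for matrix inequalities\<close>

text \<open>
  The rank-one matrix \<open>v w\<^sup>T\<close>. The limits of the positive definite matrices \<open>v v\<^sup>T + e I\<close> test a
  separating hyperplane.
\<close>

definition outer :: "real^'n \<Rightarrow> real^'n \<Rightarrow> real^'n^'n" where
  "outer v w = (\<chi> i j. v $ i * w $ j)"

lemma inner_outer: "S \<bullet> outer v w = v \<bullet> (S *v w)" for S :: "real^'n^'n"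
  by (simp add: inner_vec_def outer_def matrix_vector_mult_def sum_distrib_left mult_ac)

lemma outer_apply: "outer v w *v x = (w \<bullet> x) *\<^sub>R v"
  by (simp add: vec_eq_iff inner_vec_def outer_def matrix_vector_mult_def sum_distrib_left mult_ac)

lemma matrix_mult_outer: "A ** outer v w = outer (A *v v) w"
  by (simp add: matrix_eq outer_apply matrix_vector_mul_assoc[symmetric] matrix_vector_mult_scaleR)

lemma transpose_outer: "transpose (outer v w) = outer w v"
  by (simp add: vec_eq_iff transpose_def outer_def)

lemma outer_mult_transpose: "outer v w ** transpose A = outer v (A *v w)"
  by (metis matrix_mult_outer matrix_transpose_mul transpose_outer transpose_transpose)

lemma inner_mult_transpose:
  fixes S :: "real^'n^'n" and B :: "real^'m^'n"
  shows "S \<bullet> (B ** transpose B) = (\<Sum>j\<in>UNIV. column j B \<bullet> (S *v column j B))"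
proof -
  have "B ** transpose B = (\<Sum>j\<in>UNIV. outer (column j B) (column j B))"
    by (simp add: vec_eq_iff matrix_matrix_mult_def transpose_def outer_def column_def)
  then show ?thesis by (simp add: inner_sum_right inner_outer)
qed

definition posdef :: "real^'n^'n \<Rightarrow> bool" where
  "posdef R \<longleftrightarrow> (\<forall>y. y \<noteq> 0 \<longrightarrow> 0 < y \<bullet> (R *v y))"

text \<open>
  In the variable \<open>y = P x\<close>, \<open>P = Q\<inverse>\<close>, this is minus the generator of \<open>x \<bullet> P x\<close> for \<open>F = 0\<close> and the
  minimizing \<open>K\<close>. It is also the covariance generator of the time-reversed equation
  \<open>dY = - A Y dt + C Y dW\<close>.
\<close>

definition backward_lyapunov :: "real^'n^'n \<Rightarrow> real^'n^'n \<Rightarrow> real^'n^'n \<Rightarrow> real^'n^'n" where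
  "backward_lyapunov A C Q = C ** Q ** transpose C - A ** Q - Q ** transpose A"

lemma backward_lyapunov_add:
  "backward_lyapunov A C (Q + R) = backward_lyapunov A C Q + backward_lyapunov A C R"
  by (simp add: backward_lyapunov_def matrix_eq matrix_vector_mult_add_rdistrib
      matrix_vector_mult_diff_rdistrib matrix_vector_right_distrib matrix_vector_mul_assoc[symmetric])

lemma backward_lyapunov_scaleR:
  "backward_lyapunov A C (c *\<^sub>R Q) = c *\<^sub>R backward_lyapunov A C Q"
  by (simp add: backward_lyapunov_def matrix_scalar_ac scalar_matrix_assoc scaleR_diff_right)

lemma posdef_add: "posdef R \<Longrightarrow> \<forall>y. 0 \<le> y \<bullet> (R' *v y) \<Longrightarrow> posdef (R + R')"
  by (auto simp: posdef_def matrix_vector_mult_add_rdistrib inner_add_right intro: add_pos_nonneg)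

lemma posdef_scaleR: "posdef R \<Longrightarrow> 0 < c \<Longrightarrow> posdef (c *\<^sub>R R)"
  by (auto simp: posdef_def scaleR_matrix_vector_assoc[symmetric])

lemma posdef_mat_1: "posdef (mat 1)"
  by (simp add: posdef_def)

lemma posdef_nonneg: "posdef R \<Longrightarrow> 0 \<le> y \<bullet> (R *v y)"
  by (cases "y = 0") (auto simp: posdef_def less_imp_le)

lemma posdef_convex_combination:
  assumes "posdef R" "posdef R'" "0 \<le> u" "0 \<le> v" "u + v = (1::real)"
  shows "posdef (u *\<^sub>R R + v *\<^sub>R R')"
proof (cases "u = 0")
  case True
  then show ?thesis using assms by simp
next
  case False
  then have "posdef (u *\<^sub>R R)" using assms by (intro posdef_scaleR) auto
  moreover have "\<forall>y. 0 \<le> y \<bullet> ((v *\<^sub>R R') *v y)"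
    using assms posdef_nonneg[of R'] by (simp add: scaleR_matrix_vector_assoc[symmetric])
  ultimately show ?thesis by (rule posdef_add)
qed

lemma symmetric_inner_swap:
  fixes S :: "real^'n^'n"
  assumes "transpose S = S"
  shows "(S *v v) \<bullet> w = v \<bullet> (S *v w)"
  by (metis assms dot_lmul_matrix vector_transpose_matrix inner_commute)

text \<open>
  A quadratic without constant term that is nonpositive everywhere has its maximum at \<open>0\<close>; hence its
  derivative there vanishes.
\<close>

lemma linear_coefficient_zero:
  fixes p q :: real
  assumes "\<And>t. t * p + t\<^sup>2 * q \<le> 0"
  shows "p = 0"
proof (rule ccontr)
  assume "p \<noteq> 0"
  define t where "t = p / (1 + \<bar>q\<bar>)"
  have "t * p + t\<^sup>2 * q = p\<^sup>2 * (1 + \<bar>q\<bar> + q) / (1 + \<bar>q\<bar>)\<^sup>2"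
  proof -
    have "1 + \<bar>q\<bar> \<noteq> 0" by linarith
    then show ?thesis by (simp add: t_def power2_eq_square divide_simps) (simp add: algebra_simps)
  qed
  moreover have "0 < p\<^sup>2 * (1 + \<bar>q\<bar> + q) / (1 + \<bar>q\<bar>)\<^sup>2"
    using \<open>p \<noteq> 0\<close> by (intro divide_pos_pos mult_pos_pos) auto
  ultimately show False using assms[of t] by simp
qed

lemma psd_form_zero_imp_kernel:
  fixes S :: "real^'n^'n"
  assumes sym: "transpose S = S" and psd: "\<And>v. 0 \<le> v \<bullet> (S *v v)" and "v \<bullet> (S *v v) = 0"
  shows "S *v v = 0"
proof -
  have "t * (- 2 * ((S *v v) \<bullet> (S *v v))) + t\<^sup>2 * (- ((S *v v) \<bullet> (S *v (S *v v)))) \<le> 0" for t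
  proof -
    define w where "w = S *v v"
    have "(v + t *\<^sub>R w) \<bullet> (S *v (v + t *\<^sub>R w)) = v \<bullet> (S *v v) + 2 * t * (w \<bullet> w) + t\<^sup>2 * (w \<bullet> (S *v w))"
      using symmetric_inner_swap[OF sym, of v w]
      by (simp add: w_def inner_simps matrix_vector_right_distrib matrix_vector_mult_scaleR
        power2_eq_square algebra_simps inner_commute)
    then show ?thesis using psd[of "v + t *\<^sub>R w"] assms(3) by (simp add: w_def algebra_simps)
  qed
  from linear_coefficient_zero[OF this] show ?thesis by simp
qed

text \<open>
  A linear functional that is bounded above on a cone is nonpositive there; this turns an affine
  separating hyperplane into one through the origin.
\<close>

lemma nonpos_of_bounded_multiples:
  fixes x b :: real
  assumes "\<And>t. 0 < t \<Longrightarrow> t * x \<le> b"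
  shows "x \<le> 0"
proof (rule ccontr)
  assume "\<not> x \<le> 0"
  then show False using assms[of "(\<bar>b\<bar> + 1) / x"] by (simp add: divide_simps split: if_splits) linarith
qed

lemma nonpos_of_small_perturbations:
  fixes p q :: real
  assumes "\<And>e. 0 < e \<Longrightarrow> p + e * q \<le> 0"
  shows "p \<le> 0"
proof (rule ccontr)
  assume "\<not> p \<le> 0"
  then have p: "0 < p" by simp
  define e where "e = p / (2 * (1 + \<bar>q\<bar>))"
  have e: "0 < e" using p by (simp add: e_def)
  have "e * \<bar>q\<bar> \<le> e * (1 + \<bar>q\<bar>)" using e by (simp add: mult_left_mono)
  also have "\<dots> = p / 2" by (simp add: e_def field_simps)
  finally have "- (e * q) \<le> p / 2" using abs_ge_minus_self[of "e * q"] e by (simp add: abs_mult)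
  then show False using assms[OF e] p by simp
qed

text \<open>
  The matrices of the form tested in the assumption and the positive definite matrices are convex cones,
  disjoint by assumption. A separating functional is represented by a matrix \<open>S\<close>. Nonnegativity on the
  positive definite cone, which is taken without a symmetry requirement, makes \<open>S\<close> symmetric and
  positive semidefinite. Nonpositivity on the other cone gives \<open>S B = 0\<close> and
  \<open>(C v) \<bullet> (S C v) - 2 (A v) \<bullet> (S v) \<le> 0\<close> for all \<open>v\<close>. On the kernel of \<open>S\<close> this form attains its
  maximum \<open>0\<close>, so both its value and its derivative vanish there, which is the invariance of the kernel
  under \<open>C\<close> and under \<open>A\<close>.
\<close>

lemma stabilization_alternative:
  fixes A C :: "real^'n^'n" and B :: "real^'m^'n"
  assumes no_cert: "\<And>Q \<rho>. \<lbrakk>transpose Q = Q; posdef Q; 0 \<le> \<rho>\<rbrakk>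
      \<Longrightarrow> \<not> posdef (backward_lyapunov A C Q + \<rho> *\<^sub>R (B ** transpose B))"
  obtains S :: "real^'n^'n" where "S \<noteq> 0" "\<And>u. S *v (B *v u) = 0"
    "\<And>v. S *v v = 0 \<Longrightarrow> S *v (A *v v) = 0" "\<And>v. S *v v = 0 \<Longrightarrow> S *v (C *v v) = 0"
proof -
  define L where "L = backward_lyapunov A C"
  define E where "E = {L Q + \<rho> *\<^sub>R (B ** transpose B) | Q \<rho>. transpose Q = Q \<and> posdef Q \<and> 0 \<le> \<rho>}"
  define G where "G = {R :: real^'n^'n. posdef R}"
  have transpose_lin: "transpose (a *\<^sub>R Q + b *\<^sub>R R) = a *\<^sub>R transpose Q + b *\<^sub>R transpose R"
    for a b and Q R :: "real^'n^'n"
    by (simp add: vec_eq_iff transpose_def)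
  have EI: "L Q + \<rho> *\<^sub>R (B ** transpose B) \<in> E" if "transpose Q = Q" "posdef Q" "0 \<le> \<rho>" for Q \<rho>
    using that unfolding E_def by blast
  have "convex E"
  proof (rule convexI)
    fix x y u v assume "x \<in> E" "y \<in> E" and uv: "0 \<le> u" "0 \<le> v" "u + v = (1::real)"
    then obtain Q \<rho> Q' \<rho>' where
      x: "x = L Q + \<rho> *\<^sub>R (B ** transpose B)" "transpose Q = Q" "posdef Q" "0 \<le> \<rho>" and
      y: "y = L Q' + \<rho>' *\<^sub>R (B ** transpose B)" "transpose Q' = Q'" "posdef Q'" "0 \<le> \<rho>'"
      unfolding E_def by blast
    have "u *\<^sub>R x + v *\<^sub>R y = L (u *\<^sub>R Q + v *\<^sub>R Q') + (u * \<rho> + v * \<rho>') *\<^sub>R (B ** transpose B)"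
      by (simp add: x(1) y(1) L_def backward_lyapunov_add backward_lyapunov_scaleR algebra_simps)
    also have "\<dots> \<in> E"
      using uv x y by (intro EI posdef_convex_combination) (simp_all add: transpose_lin)
    finally show "u *\<^sub>R x + v *\<^sub>R y \<in> E" .
  qed
  moreover have "convex G"
    by (auto simp: G_def intro!: convexI posdef_convex_combination)
  moreover have "E \<noteq> {}" using EI[of "mat 1" 0] posdef_mat_1 by (auto simp: transpose_mat)
  moreover have "G \<noteq> {}" using posdef_mat_1 by (auto simp: G_def)
  moreover have "E \<inter> G = {}" using no_cert by (auto simp: E_def G_def L_def)
  ultimately obtain S b where "S \<noteq> 0" and ub: "\<And>x. x \<in> E \<Longrightarrow> S \<bullet> x \<le> b" and lb: "\<And>x. x \<in> G \<Longrightarrow> b \<le> S \<bullet> x"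
    using separating_hyperplane_sets[of E G] by blast
  have E0: "S \<bullet> x \<le> 0" if "x \<in> E" for x
  proof (rule nonpos_of_bounded_multiples)
    fix t :: real assume "0 < t"
    from \<open>x \<in> E\<close> obtain Q \<rho> where
      x: "x = L Q + \<rho> *\<^sub>R (B ** transpose B)" "transpose Q = Q" "posdef Q" "0 \<le> \<rho>"
      unfolding E_def by blast
    have "t *\<^sub>R x = L (t *\<^sub>R Q) + (t * \<rho>) *\<^sub>R (B ** transpose B)"
      by (simp add: x(1) L_def backward_lyapunov_scaleR scaleR_add_right)
    also have "\<dots> \<in> E" using x \<open>0 < t\<close> transpose_lin[of t Q 0 Q] by (intro EI posdef_scaleR) auto
    finally show "t * (S \<bullet> x) \<le> b" using ub by fastforce
  qed
  have G0: "0 \<le> S \<bullet> x" if "posdef x" for x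
  proof -
    have "- (S \<bullet> x) \<le> 0"
    proof (rule nonpos_of_bounded_multiples)
      fix t :: real assume "0 < t"
      then have "t *\<^sub>R x \<in> G" using that by (simp add: G_def posdef_scaleR)
      from lb[OF this] show "t * - (S \<bullet> x) \<le> - b" by simp
    qed
    then show ?thesis by simp
  qed
  have psd: "0 \<le> v \<bullet> (S *v v)" for v
  proof -
    have "- (v \<bullet> (S *v v)) \<le> 0"
    proof (rule nonpos_of_small_perturbations)
      fix e :: real assume "0 < e"
      then have "posdef (e *\<^sub>R mat 1 + outer v v)"
        by (intro posdef_add posdef_scaleR posdef_mat_1) (auto simp: outer_apply inner_commute)
      from G0[OF this] show "- (v \<bullet> (S *v v)) + e * (- (S \<bullet> mat 1)) \<le> 0"
        by (simp add: inner_add_right inner_outer)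
    qed
    then show ?thesis by simp
  qed
  \<comment> \<open>The matrices \<open>I + t N\<close> with \<open>N\<close> antisymmetric are positive definite for every real \<open>t\<close>,
     so \<open>S\<close> is orthogonal to its own antisymmetric part.\<close>
  have sym: "transpose S = S"
  proof -
    define N where "N = S - transpose S"
    have "posdef (mat 1 + t *\<^sub>R N)" for t
    proof -
      have "y \<bullet> (N *v y) = 0" for y
        unfolding N_def matrix_vector_mult_diff_rdistrib inner_diff_right
        by (metis dot_lmul_matrix vector_transpose_matrix inner_commute diff_self transpose_transpose)
      then show ?thesis
        by (intro posdef_add posdef_mat_1) (simp add: scaleR_matrix_vector_assoc[symmetric])
    qed
    then have pos: "0 \<le> S \<bullet> mat 1 + t * (S \<bullet> N)" for t
      using G0[of "mat 1 + t *\<^sub>R N"] by (simp add: inner_add_right)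
    have tt: "t * (- (S \<bullet> N)) \<le> S \<bullet> mat 1" for t using pos[of t] by simp
    have tt': "t * (S \<bullet> N) \<le> S \<bullet> mat 1" for t using pos[of "- t"] by simp
    have "- (S \<bullet> N) \<le> 0" by (rule nonpos_of_bounded_multiples) (rule tt)
    moreover have "(S \<bullet> N) \<le> 0" by (rule nonpos_of_bounded_multiples) (rule tt')
    ultimately have 1: "S \<bullet> N = 0" by simp
    have trans_inner: "transpose X \<bullet> Y = X \<bullet> transpose Y" for X Y :: "real^'n^'n"
      unfolding inner_vec_def transpose_def by (subst sum.swap) simp
    have "transpose N = - N" by (simp add: N_def vec_eq_iff transpose_def)
    then have "transpose S \<bullet> N = - (S \<bullet> N)" using trans_inner[of S N] by simp
    with 1 have "N \<bullet> N = 0" by (simp add: N_def inner_diff_left)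
    then show ?thesis by (simp add: N_def)
  qed
  \<comment> \<open>\<open>h v\<close> is the value of the separating functional at \<open>backward_lyapunov A C (v v\<^sup>T)\<close>.\<close>
  define h where "h v = (C *v v) \<bullet> (S *v (C *v v)) - 2 * ((A *v v) \<bullet> (S *v v))" for v
  have h_le: "h v \<le> 0" for v
  proof (rule nonpos_of_small_perturbations)
    fix e :: real assume "0 < e"
    have "posdef (e *\<^sub>R mat 1 + outer v v)"
      using \<open>0 < e\<close> by (intro posdef_add posdef_scaleR posdef_mat_1) (auto simp: outer_apply inner_commute)
    then have "L (e *\<^sub>R mat 1 + outer v v) \<in> E"
      using EI[of "e *\<^sub>R mat 1 + outer v v" 0] transpose_lin[of e "mat 1" 1 "outer v v"]
      by (simp add: transpose_outer transpose_mat)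
    then have "S \<bullet> L (outer v v) + e * (S \<bullet> L (mat 1)) \<le> 0"
      using E0 by (fastforce simp: L_def backward_lyapunov_add backward_lyapunov_scaleR inner_add_right)
    moreover have "S \<bullet> L (outer v v) = h v"
      using symmetric_inner_swap[OF sym, of v "A *v v"]
      by (simp add: L_def backward_lyapunov_def h_def matrix_mult_outer outer_mult_transpose inner_diff_right
           inner_outer inner_commute)
    ultimately show "h v + e * (S \<bullet> L (mat 1)) \<le> 0" by simp
  qed
  have SB: "S *v column j B = 0" for j
  proof -
    have "S \<bullet> (B ** transpose B) \<le> 0"
    proof (rule nonpos_of_small_perturbations)
      fix e :: real assume "0 < e"
      then have "L (e *\<^sub>R mat 1) + 1 *\<^sub>R (B ** transpose B) \<in> E"
        using transpose_lin[of e "mat 1" 0 "mat 1"]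
        by (intro EI posdef_scaleR posdef_mat_1) (auto simp: transpose_mat)
      from E0[OF this] show "S \<bullet> (B ** transpose B) + e * (S \<bullet> L (mat 1)) \<le> 0"
        by (simp add: L_def backward_lyapunov_scaleR inner_add_right)
    qed
    then have "(\<Sum>j\<in>UNIV. column j B \<bullet> (S *v column j B)) = 0"
      using psd by (intro antisym sum_nonneg) (auto simp: inner_mult_transpose)
    then have "column j B \<bullet> (S *v column j B) = 0"
      using psd by (subst (asm) sum_nonneg_eq_0_iff) auto
    then show ?thesis by (rule psd_form_zero_imp_kernel[OF sym psd])
  qed
  show thesis
  proof
    show "S \<noteq> 0" by fact
    show "S *v (B *v u) = 0" for u
      by (simp add: matrix_mult_sum[of B] linear_sum[OF matrix_vector_mul_linear] SB
          vec.linear_scale[OF matrix_vector_mul_linear_gen] matrix_vector_mult_scaleR scalar_mult_eq_scaleR)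
    fix v assume v: "S *v v = 0"
    have "(C *v v) \<bullet> (S *v (C *v v)) = 0"
      using h_le[of v] psd[of "C *v v"] v by (simp add: h_def)
    then show SC: "S *v (C *v v) = 0" by (rule psd_form_zero_imp_kernel[OF sym psd])
    \<comment> \<open>Moving away from the kernel in the direction \<open>w\<close>, the left-hand side is the value of \<open>h\<close> at \<open>v + t w\<close>.\<close>
    have "t * (- 2 * ((S *v (A *v v)) \<bullet> w)) + t\<^sup>2 * h w \<le> 0" for t w
    proof -
      have "(C *v v) \<bullet> (S *v (C *v w)) = 0" using symmetric_inner_swap[OF sym, of "C *v v" "C *v w"] SC by simp
      then have "h (v + t *\<^sub>R w) = t * (- 2 * ((S *v (A *v v)) \<bullet> w)) + t\<^sup>2 * h w"
        using v SC symmetric_inner_swap[OF sym, of "A *v v" w]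
        by (simp add: h_def inner_simps matrix_vector_right_distrib matrix_vector_mult_scaleR
            power2_eq_square algebra_simps)
      then show ?thesis using h_le[of "v + t *\<^sub>R w"] by simp
    qed
    from linear_coefficient_zero[OF this] have "(S *v (A *v v)) \<bullet> w = 0" for w by simp
    then show "S *v (A *v v) = 0" by (metis inner_eq_zero_iff)
  qed
qed

section \<open>The feedback law of a quadratic certificate\<close>

lemma posdef_coercive:
  fixes R :: "real^'n^'n"
  assumes "posdef R"
  obtains c where "0 < c" "\<And>y. c * (norm y)\<^sup>2 \<le> y \<bullet> (R *v y)"
proof -
  have "continuous_on (sphere 0 1) (\<lambda>y. y \<bullet> (R *v y))"
    by (intro continuous_intros linear_continuous_on matrix_vector_mul_bounded_linear)
  moreover have "(axis undefined 1 :: real^'n) \<in> sphere 0 1" by (simp add: norm_axis_1)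
  ultimately obtain y0 where y0: "y0 \<in> sphere 0 1" "\<And>y. y \<in> sphere 0 1 \<Longrightarrow> y0 \<bullet> (R *v y0) \<le> y \<bullet> (R *v y)"
    using continuous_attains_inf[of "sphere (0::real^'n) 1" "\<lambda>y. y \<bullet> (R *v y)"] by auto
  show ?thesis
  proof
    show "0 < y0 \<bullet> (R *v y0)" proof -
      have "y0 \<noteq> 0" using y0(1) by auto
      then show ?thesis using assms by (simp add: posdef_def)
    qed
    fix y
    show "y0 \<bullet> (R *v y0) * (norm y)\<^sup>2 \<le> y \<bullet> (R *v y)"
    proof (cases "y = 0")
      case False
      then have "y0 \<bullet> (R *v y0) \<le> (y /\<^sub>R norm y) \<bullet> (R *v (y /\<^sub>R norm y))" by (intro y0(2)) simp
      also have "\<dots> = (y \<bullet> (R *v y)) / (norm y)\<^sup>2"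
        by (simp add: matrix_vector_mult_scaleR power2_eq_square divide_simps)
      finally show ?thesis using False by (simp add: field_simps)
    qed simp
  qed
qed

text \<open>
  \<open>R\<close> factors through \<open>S\<close>, and the linear factor is bounded.
\<close>

lemma kernel_inclusion_norm_bound:
  fixes S R :: "real^'n^'n"
  assumes "\<And>v. S *v v = 0 \<Longrightarrow> R *v v = 0"
  obtains c where "0 \<le> c" "\<And>v. norm (R *v v) \<le> c * norm (S *v v)"
proof -
  obtain g where g: "linear g" "\<forall>v\<in>range ((*v) S). S *v g v = v"
    using real_vector.linear_exists_right_inverse_on[of "(*v) S" UNIV]
      matrix_vector_mul_linear[of S] unfolding linear_def by auto
  obtain c where c: "\<And>w. norm (R *v g w) \<le> c * norm w" "0 < c"
    using bounded_linear.pos_bounded[OF linear_conv_bounded_linear[THEN iffD1, OF linear_compose[OF g(1) matrix_vector_mul_linear[of R]]]]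
    by (auto simp: mult.commute)
  show ?thesis
  proof
    show "0 \<le> c" using c(2) by simp
    fix v
    have "S *v (v - g (S *v v)) = 0" using g(2) by (simp add: matrix_vector_mult_diff_distrib)
    from assms[OF this] have "R *v v = R *v g (S *v v)" by (simp add: matrix_vector_mult_diff_distrib)
    then show "norm (R *v v) \<le> c * norm (S *v v)" using c(1) by simp
  qed
qed

text \<open>
  With \<open>P = Q\<inverse>\<close>, \<open>F = - (\<rho> / 2) B\<^sup>T P\<close> and \<open>K = - Q C\<^sup>T P\<close>, the generator of \<open>x \<bullet> P x\<close> at \<open>x = Q y\<close> is
  exactly minus the quadratic form of the certificate at \<open>y\<close>.
\<close>

lemma lyapunov_feedback:
  fixes A C Q :: "real^'n^'n" and B :: "real^'m^'n"
  assumes Q: "transpose Q = Q" "posdef Q"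
    and R: "posdef (backward_lyapunov A C Q + \<rho> *\<^sub>R (B ** transpose B))"
  obtains F :: "real^'n^'m" and K P :: "real^'n^'n" and \<delta> :: real where
    "transpose P = P" "\<And>x. 0 \<le> x \<bullet> (P *v x)" "0 < \<delta>"
    "\<And>x. 2 * ((P *v x) \<bullet> ((A + B ** F + C ** K) *v x)) + (K *v x) \<bullet> (P *v (K *v x)) \<le> - \<delta> * (norm x)\<^sup>2"
proof -
  have "Q *v x = 0 \<Longrightarrow> x = 0" for x using Q(2) by (auto simp: posdef_def)
  then have "invertible Q"
    by (metis invertible_def matrix_left_invertible_ker matrix_left_right_inverse)
  define P where "P = matrix_inv Q"
  have QP: "Q ** P = mat 1" "P ** Q = mat 1"
    unfolding P_def matrix_inv_def using someI_ex[OF \<open>invertible Q\<close>[unfolded invertible_def]] by auto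
  have QPx: "Q *v (P *v x) = x" for x by (simp add: matrix_vector_mul_assoc QP)
  have PQx: "P *v (Q *v x) = x" for x by (simp add: matrix_vector_mul_assoc QP)
  have symP: "transpose P = P"
  proof -
    have "transpose P ** Q = mat 1" using QP(1) Q(1) by (metis matrix_transpose_mul transpose_mat)
    then have "transpose P ** (Q ** P) = P" by (simp add: matrix_mul_assoc)
    then show ?thesis by (simp add: QP)
  qed
  define F where "F = (- \<rho> / 2) *\<^sub>R (transpose B ** P)"
  define K where "K = - (Q ** transpose C ** P)"
  obtain c where c: "0 < c" "\<And>y. c * (norm y)\<^sup>2 \<le> y \<bullet> ((backward_lyapunov A C Q + \<rho> *\<^sub>R (B ** transpose B)) *v y)"
    using posdef_coercive[OF R] by blast
  obtain q where q: "0 < q" "\<And>y. norm (Q *v y) \<le> q * norm y"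
    using bounded_linear.pos_bounded[OF matrix_vector_mul_bounded_linear[of Q]] by (auto simp: mult.commute)
  show thesis
  proof
    show "transpose P = P" by fact
    show "0 \<le> x \<bullet> (P *v x)" for x
      using posdef_nonneg[OF Q(2), of "P *v x"] by (simp add: QPx inner_commute)
    show "0 < c / q\<^sup>2" using c q by simp
    fix x
    define y where "y = P *v x"
    have adj: "u \<bullet> (D *v v) = (transpose D *v u) \<bullet> v" for u v and D :: "real^'k^'l"
      by (simp add: transpose_matrix_vector dot_lmul_matrix)
    have x: "x = Q *v y" by (simp add: y_def QPx)
    have Fx: "F *v x = (- \<rho> / 2) *\<^sub>R (transpose B *v y)"
      unfolding F_def y_def by (simp only: scaleR_matrix_vector_assoc[symmetric] matrix_vector_mul_assoc)
    have Kx: "K *v x = - (Q *v (transpose C *v y))"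
      using matrix_vector_mult_diff_rdistrib[of 0 "Q ** transpose C ** P" x]
      by (simp add: K_def y_def matrix_vector_mul_assoc matrix_mul_assoc)
    have e1: "2 * (y \<bullet> ((A + B ** F + C ** K) *v x)) = 2 * (y \<bullet> (A *v (Q *v y)))
        - \<rho> * ((transpose B *v y) \<bullet> (transpose B *v y)) - 2 * ((transpose C *v y) \<bullet> (Q *v (transpose C *v y)))"
      unfolding matrix_vector_mult_add_rdistrib matrix_vector_mul_assoc[symmetric] inner_add_right Fx Kx
      by (simp add: x[symmetric] adj[of y B] adj[of y C] matrix_vector_mult_scaleR
        linear_neg[OF matrix_vector_mul_linear])
    have e2: "(K *v x) \<bullet> (P *v (K *v x)) = (transpose C *v y) \<bullet> (Q *v (transpose C *v y))"
      by (simp add: Kx PQx inner_commute linear_neg[OF matrix_vector_mul_linear])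
    have e3: "y \<bullet> ((backward_lyapunov A C Q + \<rho> *\<^sub>R (B ** transpose B)) *v y) =
        (transpose C *v y) \<bullet> (Q *v (transpose C *v y)) - 2 * (y \<bullet> (A *v (Q *v y)))
        + \<rho> * ((transpose B *v y) \<bullet> (transpose B *v y))"
    proof -
      have "y \<bullet> (Q *v (transpose A *v y)) = y \<bullet> (A *v (Q *v y))"
        using adj[of y Q "transpose A *v y"] adj[of y A "Q *v y"] Q(1) by (simp add: inner_commute)
      then show ?thesis
        by (simp add: backward_lyapunov_def matrix_vector_mult_add_rdistrib matrix_vector_mult_diff_rdistrib
          matrix_vector_mul_assoc[symmetric] inner_add_right inner_diff_right adj[of y C] adj[of y B]
          scaleR_matrix_vector_assoc[symmetric])
    qed
    have "(norm x)\<^sup>2 \<le> (q * norm y)\<^sup>2" unfolding x by (intro power_mono q(2)) simp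
    then have "c / q\<^sup>2 * (norm x)\<^sup>2 \<le> c * (norm y)\<^sup>2"
      using c(1) q(1) by (simp add: field_simps power_mult_distrib)
    also have "\<dots> \<le> - (2 * (y \<bullet> ((A + B ** F + C ** K) *v x)) + (K *v x) \<bullet> (P *v (K *v x)))"
      using c(2)[of y] unfolding e1 e2 e3 by simp
    finally show "2 * ((P *v x) \<bullet> ((A + B ** F + C ** K) *v x)) + (K *v x) \<bullet> (P *v (K *v x)) \<le> - (c / q\<^sup>2) * (norm x)\<^sup>2"
      by (simp add: y_def)
  qed
qed

section \<open>Square-integrable functions\<close>

text \<open>
  Membership in the space \<open>L\<^sup>2(N)\<close> of functions. It is used both over the probability space and over
  time \<open>\<times>\<close> probability space.
\<close>

definition sq_integrable :: "'a measure \<Rightarrow> ('a \<Rightarrow> 'b::euclidean_space) \<Rightarrow> bool" where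
  "sq_integrable N f \<longleftrightarrow> f \<in> borel_measurable N \<and> integrable N (\<lambda>x. (norm (f x))\<^sup>2)"

lemma sq_integrable_measurable [measurable_dest]: "sq_integrable N f \<Longrightarrow> f \<in> borel_measurable N"
  by (simp add: sq_integrable_def)

lemma sq_integrable_iff_nn_integral:
  "sq_integrable N f \<longleftrightarrow> f \<in> borel_measurable N \<and> (\<integral>\<^sup>+x. ennreal ((norm (f x))\<^sup>2) \<partial>N) < \<infinity>"
  by (auto simp: sq_integrable_def integrable_iff_bounded)

lemma nn_integral_sq_eq:
  "sq_integrable N f \<Longrightarrow> (\<integral>\<^sup>+x. ennreal ((norm (f x))\<^sup>2) \<partial>N) = ennreal (\<integral>x. (norm (f x))\<^sup>2 \<partial>N)"
  by (intro nn_integral_eq_integral) (auto simp: sq_integrable_def)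

lemma sq_norm_add_le: "(norm (x + y))\<^sup>2 \<le> 2 * (norm x)\<^sup>2 + 2 * (norm (y::'a::real_inner))\<^sup>2"
proof -
  have "(norm (x + y))\<^sup>2 + (norm (x - y))\<^sup>2 = 2 * (norm x)\<^sup>2 + 2 * (norm y)\<^sup>2"
    by (simp add: power2_norm_eq_inner inner_simps inner_commute)
  then show ?thesis using zero_le_power2[of "norm (x - y)"] by linarith
qed

lemma inner_young:
  fixes x y :: "'a::real_inner"
  assumes "0 < e"
  shows "2 * (x \<bullet> y) \<le> (norm x)\<^sup>2 / e + e * (norm y)\<^sup>2"
proof -
  have "0 \<le> (x - e *\<^sub>R y) \<bullet> (x - e *\<^sub>R y) / e" using assms by simp
  also have "\<dots> = (norm x)\<^sup>2 / e + e * (norm y)\<^sup>2 - 2 * (x \<bullet> y)"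
    using assms by (simp add: inner_simps power2_norm_eq_inner inner_commute field_simps)
  finally show ?thesis by simp
qed

lemma sq_integrable_dominated:
  assumes "g \<in> borel_measurable N" "sq_integrable N f" "\<And>x. x \<in> space N \<Longrightarrow> norm (g x) \<le> c * norm (f x)"
  shows "sq_integrable N g"
  unfolding sq_integrable_def
proof
  show "integrable N (\<lambda>x. (norm (g x))\<^sup>2)"
  proof (rule Bochner_Integration.integrable_bound)
    show "integrable N (\<lambda>x. c\<^sup>2 * (norm (f x))\<^sup>2)" using assms(2) by (simp add: sq_integrable_def)
    show "AE x in N. norm ((norm (g x))\<^sup>2) \<le> norm (c\<^sup>2 * (norm (f x))\<^sup>2)"
      using power_mono[OF assms(3), of _ 2] by (intro AE_I2) (simp add: power_mult_distrib)
  qed (use assms(1) in measurable)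
qed (rule assms(1))

lemma sq_integrable_linear:
  fixes L :: "'a::euclidean_space \<Rightarrow> 'b::euclidean_space"
  assumes L: "bounded_linear L" and f: "sq_integrable N f"
  shows "sq_integrable N (\<lambda>x. L (f x))"
proof -
  obtain c where "\<And>x. norm (L x) \<le> norm x * c" using bounded_linear.bounded[OF L] by blast
  then have "norm (L (f x)) \<le> c * norm (f x)" for x by (simp add: mult.commute)
  then show ?thesis
    using borel_measurable_continuous_on[OF linear_continuous_on[OF L] sq_integrable_measurable[OF f]] f
    by (rule sq_integrable_dominated[rotated 2])
qed

lemma sq_integrable_add:
  assumes "sq_integrable N f" "sq_integrable N g"
  shows "sq_integrable N (\<lambda>x. f x + g x)"
  unfolding sq_integrable_def
proof
  show m: "(\<lambda>x. f x + g x) \<in> borel_measurable N" using assms by measurable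
  show "integrable N (\<lambda>x. (norm (f x + g x))\<^sup>2)"
  proof (rule Bochner_Integration.integrable_bound)
    show "integrable N (\<lambda>x. 2 * (norm (f x))\<^sup>2 + 2 * (norm (g x))\<^sup>2)"
      using assms by (simp add: sq_integrable_def)
    show "AE x in N. norm ((norm (f x + g x))\<^sup>2) \<le> norm (2 * (norm (f x))\<^sup>2 + 2 * (norm (g x))\<^sup>2)"
      using sq_norm_add_le by (intro AE_I2) fastforce
  qed (use m in measurable)
qed

lemma sq_integrable_minus: "sq_integrable N f \<Longrightarrow> sq_integrable N (\<lambda>x. - f x)"
  by (simp add: sq_integrable_def borel_measurable_uminus)

lemma sq_integrable_diff:
  "sq_integrable N f \<Longrightarrow> sq_integrable N g \<Longrightarrow> sq_integrable N (\<lambda>x. f x - g x)"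
  using sq_integrable_add[OF _ sq_integrable_minus, of N f g] by simp

lemma sq_integrable_cong_AE:
  assumes "sq_integrable N f" "g \<in> borel_measurable N" "AE x in N. f x = g x"
  shows "sq_integrable N g"
  unfolding sq_integrable_def
proof
  have "integrable N (\<lambda>x. (norm (f x))\<^sup>2)" using assms by (simp add: sq_integrable_def)
  then show "integrable N (\<lambda>x. (norm (g x))\<^sup>2)"
    by (rule integrable_cong_AE_imp) (use assms in auto)
qed fact

lemma integrable_inner:
  assumes "sq_integrable N f" "sq_integrable N g"
  shows "integrable N (\<lambda>x. f x \<bullet> g x)"
proof (rule Bochner_Integration.integrable_bound)
  show "integrable N (\<lambda>x. (norm (f x))\<^sup>2 + (norm (g x))\<^sup>2)"
    using assms by (simp add: sq_integrable_def)
  show "(\<lambda>x. f x \<bullet> g x) \<in> borel_measurable N" using assms by measurable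
  show "AE x in N. norm (f x \<bullet> g x) \<le> norm ((norm (f x))\<^sup>2 + (norm (g x))\<^sup>2)"
  proof (intro AE_I2)
    fix x
    have "norm (f x \<bullet> g x) \<le> norm (f x) * norm (g x)" using Cauchy_Schwarz_ineq2 by simp
    also have "\<dots> \<le> (norm (f x))\<^sup>2 + (norm (g x))\<^sup>2"
      using sum_squares_bound[of "norm (f x)" "norm (g x)"]
        mult_nonneg_nonneg[OF norm_ge_zero[of "f x"] norm_ge_zero[of "g x"]] by linarith
    finally show "norm (f x \<bullet> g x) \<le> norm ((norm (f x))\<^sup>2 + (norm (g x))\<^sup>2)" by simp
  qed
qed

lemma integral_young:
  assumes "sq_integrable N f" "sq_integrable N g" "0 < e"
  shows "2 * (\<integral>x. f x \<bullet> g x \<partial>N) \<le> (\<integral>x. (norm (f x))\<^sup>2 \<partial>N) / e + e * (\<integral>x. (norm (g x))\<^sup>2 \<partial>N)"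
proof -
  have "(\<integral>x. 2 * (f x \<bullet> g x) \<partial>N) \<le> (\<integral>x. (norm (f x))\<^sup>2 / e + e * (norm (g x))\<^sup>2 \<partial>N)"
    using assms integrable_inner[OF assms(1,2)] inner_young[OF assms(3)]
    by (intro integral_mono) (auto simp: sq_integrable_def)
  also have "\<dots> = (\<integral>x. (norm (f x))\<^sup>2 \<partial>N) / e + e * (\<integral>x. (norm (g x))\<^sup>2 \<partial>N)"
    using assms by (simp add: sq_integrable_def)
  finally show ?thesis by simp
qed

lemma integral_sq_add:
  assumes "sq_integrable N f" "sq_integrable N g"
  shows "(\<integral>x. (norm (f x + g x))\<^sup>2 \<partial>N) =
    (\<integral>x. (norm (f x))\<^sup>2 \<partial>N) + 2 * (\<integral>x. f x \<bullet> g x \<partial>N) + (\<integral>x. (norm (g x))\<^sup>2 \<partial>N)"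
proof -
  have "(norm (f x + g x))\<^sup>2 = (norm (f x))\<^sup>2 + 2 * (f x \<bullet> g x) + (norm (g x))\<^sup>2" for x
    by (simp add: power2_norm_eq_inner inner_simps inner_commute)
  then show ?thesis
    using assms integrable_inner[OF assms] by (simp add: sq_integrable_def)
qed

lemma integral_sq_diff:
  assumes "sq_integrable N f" "sq_integrable N g"
  shows "(\<integral>x. (norm (f x - g x))\<^sup>2 \<partial>N) =
    (\<integral>x. (norm (f x))\<^sup>2 \<partial>N) - 2 * (\<integral>x. f x \<bullet> g x \<partial>N) + (\<integral>x. (norm (g x))\<^sup>2 \<partial>N)"
  using integral_sq_add[OF assms(1) sq_integrable_minus[OF assms(2)]] by simp

lemma integral_sq_add_le:
  assumes "sq_integrable N f" "sq_integrable N g"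
  shows "(\<integral>x. (norm (f x + g x))\<^sup>2 \<partial>N) \<le> 2 * (\<integral>x. (norm (f x))\<^sup>2 \<partial>N) + 2 * (\<integral>x. (norm (g x))\<^sup>2 \<partial>N)"
  using integral_sq_add[OF assms] integral_young[OF assms, of 1] by simp

lemma integral_inner_tendsto_zero:
  assumes "\<And>j. sq_integrable N (f j)" "sq_integrable N g" "(\<lambda>j. \<integral>x. (norm (f j x))\<^sup>2 \<partial>N) \<longlonglongrightarrow> 0"
  shows "(\<lambda>j. \<integral>x. f j x \<bullet> g x \<partial>N) \<longlonglongrightarrow> 0"
proof (rule LIMSEQ_I)
  fix r :: real assume r: "0 < r"
  define G where "G = (\<integral>x. (norm (g x))\<^sup>2 \<partial>N)"
  have G: "0 \<le> G" by (simp add: G_def)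
  \<comment> \<open>Adding \<open>1\<close> covers \<open>g = 0\<close>.\<close>
  define e where "e = r / (1 + G)"
  have e: "0 < e" "e * G < r" using r G by (auto simp: e_def field_simps)
  from LIMSEQ_D[OF assms(3), of "e * (r)"] r e
  obtain n0 where n0: "\<And>n. n0 \<le> n \<Longrightarrow> (\<integral>x. (norm (f n x))\<^sup>2 \<partial>N) < e * r" by auto
  show "\<exists>no. \<forall>n\<ge>no. norm ((\<integral>x. f n x \<bullet> g x \<partial>N) - 0) < r"
  proof (intro exI allI impI)
    fix n assume "n0 \<le> n"
    from n0[OF this] e have lt: "(\<integral>x. (norm (f n x))\<^sup>2 \<partial>N) / e < r" by (simp add: field_simps)
    have "2 * (\<integral>x. f n x \<bullet> g x \<partial>N) \<le> (\<integral>x. (norm (f n x))\<^sup>2 \<partial>N) / e + e * G"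
      unfolding G_def by (rule integral_young[OF assms(1,2) e(1)])
    moreover have "2 * (\<integral>x. - f n x \<bullet> g x \<partial>N) \<le> (\<integral>x. (norm (- f n x))\<^sup>2 \<partial>N) / e + e * G"
      unfolding G_def by (rule integral_young[OF sq_integrable_minus[OF assms(1)] assms(2) e(1)])
    ultimately show "norm ((\<integral>x. f n x \<bullet> g x \<partial>N) - 0) < r" using lt e(2) by simp
  qed
qed

lemma integral_sq_tendsto:
  assumes "\<And>j. sq_integrable N (f j)" "sq_integrable N g" "(\<lambda>j. \<integral>x. (norm (f j x - g x))\<^sup>2 \<partial>N) \<longlonglongrightarrow> 0"
  shows "(\<lambda>j. \<integral>x. (norm (f j x))\<^sup>2 \<partial>N) \<longlonglongrightarrow> (\<integral>x. (norm (g x))\<^sup>2 \<partial>N)"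
proof -
  have d: "sq_integrable N (\<lambda>x. f j x - g x)" for j using assms by (intro sq_integrable_diff)
  have "(\<integral>x. (norm (f j x))\<^sup>2 \<partial>N) = (\<integral>x. (norm (f j x - g x))\<^sup>2 \<partial>N)
      + 2 * (\<integral>x. (f j x - g x) \<bullet> g x \<partial>N) + (\<integral>x. (norm (g x))\<^sup>2 \<partial>N)" for j
    using integral_sq_add[OF d assms(2), of j] by simp
  moreover have "(\<lambda>j. (\<integral>x. (norm (f j x - g x))\<^sup>2 \<partial>N) + 2 * (\<integral>x. (f j x - g x) \<bullet> g x \<partial>N)
      + (\<integral>x. (norm (g x))\<^sup>2 \<partial>N)) \<longlonglongrightarrow> 0 + 2 * 0 + (\<integral>x. (norm (g x))\<^sup>2 \<partial>N)"
    by (intro tendsto_intros assms(3) integral_inner_tendsto_zero[OF d assms(2) assms(3)])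
  ultimately show ?thesis by simp
qed

lemma sq_integrable_limit:
  assumes "\<And>j. sq_integrable N (f j)" "g \<in> borel_measurable N"
    and lim: "(\<lambda>j. \<integral>\<^sup>+x. ennreal ((norm (f j x - g x))\<^sup>2) \<partial>N) \<longlonglongrightarrow> 0"
  shows "sq_integrable N g"
proof -
  have "eventually (\<lambda>j. (\<integral>\<^sup>+x. ennreal ((norm (f j x - g x))\<^sup>2) \<partial>N) < \<infinity>) sequentially"
    using order_tendstoD(2)[OF lim, of \<infinity>] by simp
  then obtain j where "(\<integral>\<^sup>+x. ennreal ((norm (f j x - g x))\<^sup>2) \<partial>N) < \<infinity>"
    unfolding eventually_sequentially by blast
  then have "sq_integrable N (\<lambda>x. f j x - g x)"
    using assms(2) sq_integrable_measurable[OF assms(1)[of j]]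
    by (simp add: sq_integrable_iff_nn_integral borel_measurable_diff)
  from sq_integrable_diff[OF assms(1)[of j] this] show ?thesis by simp
qed

lemma tendsto_integral_sq_of_nn:
  assumes "\<And>j. sq_integrable N (f j)"
    and lim: "(\<lambda>j. \<integral>\<^sup>+x. ennreal ((norm (f j x))\<^sup>2) \<partial>N) \<longlonglongrightarrow> 0"
  shows "(\<lambda>j. \<integral>x. (norm (f j x))\<^sup>2 \<partial>N) \<longlonglongrightarrow> 0"
proof -
  have "(\<lambda>j. ennreal (\<integral>x. (norm (f j x))\<^sup>2 \<partial>N)) \<longlonglongrightarrow> ennreal 0"
    using lim by (simp add: nn_integral_sq_eq[OF assms(1)])
  then show ?thesis by (subst (asm) tendsto_ennreal_iff) auto
qed

lemma sq_integrable_sum: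
  assumes "\<And>i. i \<in> I \<Longrightarrow> sq_integrable N (f i)"
  shows "sq_integrable N (\<lambda>x. \<Sum>i\<in>I. f i x)"
proof (cases "finite I")
  case True
  then show ?thesis using assms
  proof (induction I rule: finite_induct)
    case empty
    show ?case by (simp add: sq_integrable_def)
  next
    case (insert i I)
    then show ?case by (simp add: sq_integrable_add)
  qed
qed (simp add: sq_integrable_def)

lemma integral_inner_sum:
  assumes "finite I" "finite J" "\<And>i. i \<in> I \<Longrightarrow> sq_integrable N (f i)" "\<And>j. j \<in> J \<Longrightarrow> sq_integrable N (g j)"
  shows "(\<integral>x. (\<Sum>i\<in>I. f i x) \<bullet> (\<Sum>j\<in>J. g j x) \<partial>N) = (\<Sum>i\<in>I. \<Sum>j\<in>J. \<integral>x. f i x \<bullet> g j x \<partial>N)"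
  by (simp add: inner_sum_left inner_sum_right integrable_inner assms) (rule sum.swap)

text \<open>
  Used to pass from approximations of two It\^o integrals to an approximation of their difference.
\<close>

lemma integral_sq_diff_tendsto_zero:
  assumes "\<And>j. sq_integrable N (f j)" "\<And>j. sq_integrable N (g j)"
    and "(\<lambda>j. \<integral>x. (norm (f j x))\<^sup>2 \<partial>N) \<longlonglongrightarrow> 0" "(\<lambda>j. \<integral>x. (norm (g j x))\<^sup>2 \<partial>N) \<longlonglongrightarrow> 0"
  shows "(\<lambda>j. \<integral>x. (norm (f j x - g j x))\<^sup>2 \<partial>N) \<longlonglongrightarrow> 0"
proof (rule tendsto_sandwich[OF _ _ tendsto_const])
  have "(\<integral>x. (norm (f j x - g j x))\<^sup>2 \<partial>N) \<le> 2 * (\<integral>x. (norm (f j x))\<^sup>2 \<partial>N) + 2 * (\<integral>x. (norm (g j x))\<^sup>2 \<partial>N)" for j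
    using integral_sq_add_le[OF assms(1)[of j] sq_integrable_minus[OF assms(2)[of j]]] by simp
  then show "\<forall>\<^sub>F j in sequentially. (\<integral>x. (norm (f j x - g j x))\<^sup>2 \<partial>N)
      \<le> 2 * (\<integral>x. (norm (f j x))\<^sup>2 \<partial>N) + 2 * (\<integral>x. (norm (g j x))\<^sup>2 \<partial>N)" by simp
  have "(\<lambda>j. 2 * (\<integral>x. (norm (f j x))\<^sup>2 \<partial>N) + 2 * (\<integral>x. (norm (g j x))\<^sup>2 \<partial>N)) \<longlonglongrightarrow> 2 * 0 + 2 * 0"
    by (intro tendsto_intros assms(3,4))
  then show "(\<lambda>j. 2 * (\<integral>x. (norm (f j x))\<^sup>2 \<partial>N) + 2 * (\<integral>x. (norm (g j x))\<^sup>2 \<partial>N)) \<longlonglongrightarrow> 0" by simp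
qed simp

lemma integral_sq_linear_le:
  fixes L :: "'a::euclidean_space \<Rightarrow> 'b::euclidean_space"
  assumes L: "bounded_linear L" and c: "\<And>x. norm (L x) \<le> c * norm x" and f: "sq_integrable N f"
  shows "(\<integral>x. (norm (L (f x)))\<^sup>2 \<partial>N) \<le> c\<^sup>2 * (\<integral>x. (norm (f x))\<^sup>2 \<partial>N)"
proof -
  have "(\<integral>x. (norm (L (f x)))\<^sup>2 \<partial>N) \<le> (\<integral>x. c\<^sup>2 * (norm (f x))\<^sup>2 \<partial>N)"
    using f sq_integrable_linear[OF L f] power_mono[OF c norm_ge_zero, of _ 2]
    by (intro integral_mono) (auto simp: sq_integrable_def power_mult_distrib)
  then show ?thesis by simp
qed

lemma integral_sq_linear_tendsto:
  fixes L :: "'a::euclidean_space \<Rightarrow> 'b::euclidean_space"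
  assumes L: "bounded_linear L" and f: "\<And>j. sq_integrable N (f j)" and g: "sq_integrable N g"
    and lim: "(\<lambda>j. \<integral>x. (norm (f j x - g x))\<^sup>2 \<partial>N) \<longlonglongrightarrow> 0"
  shows "(\<lambda>j. \<integral>x. (norm (L (f j x)))\<^sup>2 \<partial>N) \<longlonglongrightarrow> (\<integral>x. (norm (L (g x)))\<^sup>2 \<partial>N)"
proof (rule integral_sq_tendsto[OF sq_integrable_linear[OF L f] sq_integrable_linear[OF L g]])
  obtain c where c: "\<And>x. norm (L x) \<le> c * norm x"
    using bounded_linear.bounded[OF L] by (auto simp: mult.commute)
  have le: "(\<integral>x. (norm (L (f j x) - L (g x)))\<^sup>2 \<partial>N) \<le> c\<^sup>2 * (\<integral>x. (norm (f j x - g x))\<^sup>2 \<partial>N)" for j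
    using integral_sq_linear_le[OF L c sq_integrable_diff[OF f g], of j]
    by (simp add: linear_diff bounded_linear.linear[OF L])
  have lim': "(\<lambda>j. c\<^sup>2 * (\<integral>x. (norm (f j x - g x))\<^sup>2 \<partial>N)) \<longlonglongrightarrow> 0"
    using tendsto_mult[OF tendsto_const lim, of "c\<^sup>2"] by simp
  show "(\<lambda>j. \<integral>x. (norm (L (f j x) - L (g x)))\<^sup>2 \<partial>N) \<longlonglongrightarrow> 0"
    by (rule tendsto_sandwich[OF _ _ tendsto_const lim']) (simp_all add: le)
qed

text \<open>
  Recovers the expectation of a quadratic form from norms of linear images, for which the isometry is
  available.
\<close>

lemma integral_quadratic_polarization:
  fixes P :: "'a::euclidean_space \<Rightarrow> 'a"
  assumes P: "bounded_linear P" and f: "sq_integrable N f"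
  shows "4 * (\<integral>x. f x \<bullet> P (f x) \<partial>N) = (\<integral>x. (norm (f x + P (f x)))\<^sup>2 \<partial>N) - (\<integral>x. (norm (f x - P (f x)))\<^sup>2 \<partial>N)"
  using integral_sq_add[OF f sq_integrable_linear[OF P f]] integral_sq_diff[OF f sq_integrable_linear[OF P f]]
  by simp

lemma bounded_linear_bound_nonneg:
  assumes "bounded_linear L"
  obtains c where "0 \<le> c" "\<And>x. norm (L x) \<le> c * norm x"
  using bounded_linear.nonneg_bounded[OF assms] by (auto simp: mult.commute)

text \<open>
  The process \<open>\<phi>\<close> on the time window \<open>(s, t]\<close>, extended by zero, as a function on the product space.
  Half-open windows split without overlap and fit the steps of simple processes.
\<close>

definition window :: "real \<Rightarrow> real \<Rightarrow> (real \<Rightarrow> 'w \<Rightarrow> 'a::real_vector) \<Rightarrow> real \<times> 'w \<Rightarrow> 'a" where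
  "window s t \<phi> z = indicator {s<..t} (fst z) *\<^sub>R \<phi> (fst z) (snd z)"

definition map_simple :: "('a \<Rightarrow> 'b) \<Rightarrow> ('w, 'a) simple_data \<Rightarrow> ('w, 'b) simple_data" where
  "map_simple L = (\<lambda>(k, \<tau>, \<eta>). (k, \<tau>, \<lambda>i \<omega>. L (\<eta> i \<omega>)))"

lemma simple_integral_map:
  assumes "bounded_linear L"
  shows "simple_integral W (map_simple L S) \<omega> = L (simple_integral W S \<omega>)"
  using assms
  by (cases S) (simp add: simple_integral_def map_simple_def linear_sum linear_scale bounded_linear.linear)

lemma simple_process_map:
  assumes "bounded_linear L"
  shows "simple_process (map_simple L S) r \<omega> = L (simple_process S r \<omega>)"
  using assms
  by (cases S) (simp add: simple_process_def map_simple_def linear_sum linear_scale bounded_linear.linear)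

lemma is_simple_map:
  fixes L :: "'a::euclidean_space \<Rightarrow> 'b::euclidean_space"
  assumes L: "bounded_linear L" and S: "is_simple M W T S"
  shows "is_simple M W T (map_simple L S)"
proof -
  obtain k \<tau> \<eta> where k: "S = (k, \<tau>, \<eta>)" by (cases S)
  obtain B where B: "0 < B" "\<And>x. norm (L x) \<le> norm x * B" using bounded_linear.pos_bounded[OF L] by blast
  obtain c where c: "\<forall>i<k. \<forall>\<omega>\<in>space M. norm (\<eta> i \<omega>) \<le> c"
    using S unfolding k is_simple_def prod.case by blast
  have "norm (L (\<eta> i \<omega>)) \<le> c * B" if "i < k" "\<omega> \<in> space M" for i \<omega>
    using order_trans[OF B(2) mult_right_mono[of "norm (\<eta> i \<omega>)" c B]] c that B(1) by simp
  then have "\<exists>c. \<forall>i<k. \<forall>\<omega>\<in>space M. norm (L (\<eta> i \<omega>)) \<le> c" by blast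
  moreover have "(\<lambda>\<omega>. L (\<eta> i \<omega>)) \<in> borel_measurable (aug_filtration M W (\<tau> i))" if "i < k" for i
  proof -
    have "\<eta> i \<in> borel_measurable (aug_filtration M W (\<tau> i))" using S that by (simp add: k is_simple_def)
    then show ?thesis by (rule borel_measurable_continuous_on[OF linear_continuous_on[OF L]])
  qed
  ultimately show ?thesis using S by (simp add: k is_simple_def map_simple_def)
qed

lemma emeasure_lborel_Ioc_finite: "emeasure lborel {a<..b::real} < \<infinity>"
  by (cases "a \<le> b") simp_all

section \<open>Brownian increments\<close>

context standard_brownian_motion
begin

abbreviation "\<F> \<equiv> aug_filtration M W"

lemma natural_generator_subset:
  "0 \<le> t \<Longrightarrow> {W s -` S \<inter> space M | s S. s \<in> {0..t} \<and> S \<in> sets borel} \<subseteq> sets M"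
  by (auto intro!: measurable_sets[OF W_measurable])

lemma sets_natural_filtration_eq:
  assumes "0 \<le> t"
  shows "sets (natural_filtration M W t) =
    sigma_sets (space M) {W s -` S \<inter> space M | s S. s \<in> {0..t} \<and> S \<in> sets borel}"
  unfolding natural_filtration_def
  by (rule sets_measure_of) auto

lemma sets_natural_filtration:
  "0 \<le> t \<Longrightarrow> sets (natural_filtration M W t) \<subseteq> sets M"
  unfolding sets_natural_filtration_eq by (rule sets.sigma_sets_subset[OF natural_generator_subset])

lemma space_aug_filtration [simp]: "space (\<F> t) = space M"
  by (simp add: aug_filtration_def space_measure_of_conv)

lemma sets_aug_filtration_eq:
  "0 \<le> t \<Longrightarrow> sets (\<F> t) = sigma_sets (space M) (sets (natural_filtration M W t) \<union> null_sets M)"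
  unfolding aug_filtration_def
  by (rule sets_measure_of) (use sets_natural_filtration[of t] sets.sets_into_space in \<open>auto dest!: null_setsD2\<close>)

lemma sets_aug_filtration: "0 \<le> t \<Longrightarrow> sets (\<F> t) \<subseteq> sets M"
  unfolding sets_aug_filtration_eq
  by (rule sets.sigma_sets_subset) (use sets_natural_filtration[of t] in auto)

lemma measurable_aug_filtration_imp: "0 \<le> t \<Longrightarrow> f \<in> borel_measurable (\<F> t) \<Longrightarrow> f \<in> borel_measurable M"
  using sets_aug_filtration[of t] by (auto simp: measurable_def)

lemma natural_filtration_mono:
  assumes "0 \<le> s" "s \<le> t"
  shows "sets (natural_filtration M W s) \<subseteq> sets (natural_filtration M W t)"
  unfolding sets_natural_filtration_eq[OF assms(1)] sets_natural_filtration_eq[OF order_trans[OF assms]]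
  by (rule sigma_sets_subseteq) (use assms(2) in \<open>fastforce intro: order_trans\<close>)

lemma aug_filtration_mono:
  assumes "0 \<le> s" "s \<le> t"
  shows "sets (\<F> s) \<subseteq> sets (\<F> t)"
  unfolding sets_aug_filtration_eq[OF assms(1)] sets_aug_filtration_eq[OF order_trans[OF assms]]
  by (rule sigma_sets_subseteq) (use natural_filtration_mono[OF assms] in blast)

lemma measurable_aug_filtration_mono:
  "0 \<le> s \<Longrightarrow> s \<le> t \<Longrightarrow> f \<in> borel_measurable (\<F> s) \<Longrightarrow> f \<in> borel_measurable (\<F> t)"
  using aug_filtration_mono[of s t] by (auto simp: measurable_def)

lemma W_adapted:
  assumes "0 \<le> s" "s \<le> t"
  shows "W s \<in> borel_measurable (\<F> t)"
proof (rule borel_measurableI)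
  fix S :: "real set" assume "open S"
  then have "W s -` S \<inter> space M \<in> sets (natural_filtration M W t)"
    unfolding sets_natural_filtration_eq[OF order_trans[OF assms]]
    using assms by (intro sigma_sets.Basic CollectI exI[of _ s] exI[of _ S]) auto
  then have "W s -` S \<inter> space M \<in> sets (\<F> t)"
    unfolding sets_aug_filtration_eq[OF order_trans[OF assms]] by (intro sigma_sets.Basic UnI1)
  then show "W s -` S \<inter> space (\<F> t) \<in> sets (\<F> t)" by simp
qed

text \<open>
  The events that agree up to a null set with an event of the unaugmented filtration form a
  \<open>\<sigma>\<close>-algebra containing the generators of the augmented one. This is what transfers independence of
  Brownian increments to the augmented filtration.
\<close>

lemma aug_event_eq_natural_event:
  assumes "0 \<le> t" "E \<in> sets (\<F> t)"
  shows "\<exists>E'\<in>sets (natural_filtration M W t). AE \<omega> in M. \<omega> \<in> E \<longleftrightarrow> \<omega> \<in> E'"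
  using assms(2) unfolding sets_aug_filtration_eq[OF assms(1)]
proof (induction rule: sigma_sets.induct)
  case (Basic a)
  then show ?case
  proof
    assume "a \<in> null_sets M"
    then show ?thesis using AE_not_in[of a M] by (intro bexI[of _ "{}"]) auto
  qed auto
next
  case Empty
  then show ?case by (intro bexI[of _ "{}"]) auto
next
  case (Compl a)
  then obtain E' where E': "E' \<in> sets (natural_filtration M W t)" "AE \<omega> in M. \<omega> \<in> a \<longleftrightarrow> \<omega> \<in> E'" by blast
  have "space M - E' \<in> sets (natural_filtration M W t)"
    using sets.compl_sets[OF E'(1)] by (simp add: natural_filtration_def space_measure_of_conv)
  then show ?case using E'(2) by (intro bexI[of _ "space M - E'"]) auto
next
  case (Union a)
  then obtain E' where "\<forall>i::nat. E' i \<in> sets (natural_filtration M W t) \<and> (AE \<omega> in M. \<omega> \<in> a i \<longleftrightarrow> \<omega> \<in> E' i)"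
    by metis
  then have "(\<Union>i. E' i) \<in> sets (natural_filtration M W t)" "AE \<omega> in M. \<forall>i. \<omega> \<in> a i \<longleftrightarrow> \<omega> \<in> E' i"
    by (auto simp: AE_all_countable)
  then show ?case by (intro bexI[of _ "\<Union>i. E' i"]) auto
qed

lemma increment_measurable: "0 \<le> s \<Longrightarrow> 0 \<le> t \<Longrightarrow> (\<lambda>\<omega>. W t \<omega> - W s \<omega>) \<in> borel_measurable M"
  using W_measurable by measurable

lemma increment_indep_aug_filtration:
  assumes "0 \<le> s" "s < t" and H: "H \<in> borel_measurable (\<F> s)"
  shows "indep_var borel H borel (\<lambda>\<omega>. W t \<omega> - W s \<omega>)"
proof -
  let ?D = "{(\<lambda>\<omega>. W t \<omega> - W s \<omega>) -` S \<inter> space M | S. S \<in> sets borel}"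
  let ?H = "{H -` S \<inter> space M | S. S \<in> sets borel}"
  note indep = W_independent[OF assms(1,2)]
  have HF: "?H \<subseteq> sets (\<F> s)"
  proof safe
    fix S :: "real set" assume "S \<in> sets borel"
    from measurable_sets[OF H this] show "H -` S \<inter> space M \<in> sets (\<F> s)" by simp
  qed
  have "indep_set ?H ?D"
    unfolding indep_sets2_eq
  proof (intro conjI ballI)
    show "?H \<subseteq> events" using HF sets_aug_filtration[OF assms(1)] by blast
    show "?D \<subseteq> events" by (rule indep_setD_ev2[OF indep])
    fix a b assume a: "a \<in> ?H" and b: "b \<in> ?D"
    obtain a' where a': "a' \<in> sets (natural_filtration M W s)" "AE \<omega> in M. \<omega> \<in> a \<longleftrightarrow> \<omega> \<in> a'"
      using aug_event_eq_natural_event[OF assms(1)] a HF by blast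
    have ev: "a \<in> events" "a' \<in> events" "b \<in> events"
      by (fact subsetD[OF sets_aug_filtration[OF assms(1)] subsetD[OF HF a]]
        subsetD[OF sets_natural_filtration[OF assms(1)] a'(1)] subsetD[OF indep_setD_ev2[OF indep] b])+
    have "prob (a \<inter> b) = prob (a' \<inter> b)" using ev a'(2) by (intro measure_eq_AE) auto
    moreover have "prob a = prob a'" using ev a'(2) by (intro measure_eq_AE) auto
    moreover have "prob (a' \<inter> b) = prob a' * prob b" by (rule indep_setD[OF indep a'(1) b])
    ultimately show "prob (a \<inter> b) = prob a * prob b" by simp
  qed
  moreover have "Int_stable {X -` S \<inter> space M | S. S \<in> sets borel}" for X :: "'w \<Rightarrow> real"
  proof (rule Int_stableI)
    fix a b assume "a \<in> {X -` S \<inter> space M | S. S \<in> sets borel}" "b \<in> {X -` S \<inter> space M | S. S \<in> sets borel}"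
    then obtain S S' where "S \<in> sets borel" "S' \<in> sets borel" "a = X -` S \<inter> space M" "b = X -` S' \<inter> space M"
      by blast
    then show "a \<inter> b \<in> {X -` S \<inter> space M | S. S \<in> sets borel}"
      by (intro CollectI exI[of _ "S \<inter> S'"]) auto
  qed
  ultimately have "indep_set (sigma_sets (space M) ?H) (sigma_sets (space M) ?D)"
    by (intro indep_set_sigma_sets)
  then show ?thesis
    unfolding indep_var_eq
    using measurable_aug_filtration_imp[OF assms(1) H] increment_measurable[of s t] assms by simp
qed

lemma
  assumes "0 \<le> s" "s < t"
  shows increment_mean: "integrable M (\<lambda>\<omega>. W t \<omega> - W s \<omega>)" "expectation (\<lambda>\<omega>. W t \<omega> - W s \<omega>) = 0"
    and increment_variance: "integrable M (\<lambda>\<omega>. (W t \<omega> - W s \<omega>)\<^sup>2)" "expectation (\<lambda>\<omega>. (W t \<omega> - W s \<omega>)\<^sup>2) = t - s"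
proof -
  note D = W_increment[OF assms]
  have \<sigma>: "0 < sqrt (t - s)" using assms by simp
  show "integrable M (\<lambda>\<omega>. W t \<omega> - W s \<omega>)"
    using distributed_integrable[OF D, of "\<lambda>x. x"] integrable_normal_moment_nz_1[OF \<sigma>, of 0] by simp
  show "expectation (\<lambda>\<omega>. W t \<omega> - W s \<omega>) = 0"
    using distributed_integral[OF D, of "\<lambda>x. x"] integral_normal_moment_nz_1[OF \<sigma>, of 0] by simp
  show "integrable M (\<lambda>\<omega>. (W t \<omega> - W s \<omega>)\<^sup>2)"
    using distributed_integrable[OF D, of "\<lambda>x. x\<^sup>2"] integrable_normal_moment[OF \<sigma>, of 0 2] by simp
  show "expectation (\<lambda>\<omega>. (W t \<omega> - W s \<omega>)\<^sup>2) = t - s"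
    using distributed_integral[OF D, of "\<lambda>x. x\<^sup>2"] integral_normal_moment_even[OF \<sigma>, of 0 1] assms
    by simp
qed

lemma
  assumes "0 \<le> s" "s \<le> t" "H \<in> borel_measurable (\<F> s)" "integrable M H"
  shows increment_orthogonal: "integrable M (\<lambda>\<omega>. H \<omega> * (W t \<omega> - W s \<omega>))"
      "expectation (\<lambda>\<omega>. H \<omega> * (W t \<omega> - W s \<omega>)) = 0"
    and increment_sq: "integrable M (\<lambda>\<omega>. H \<omega> * (W t \<omega> - W s \<omega>)\<^sup>2)"
      "expectation (\<lambda>\<omega>. H \<omega> * (W t \<omega> - W s \<omega>)\<^sup>2) = (t - s) * expectation H"
proof (atomize (full), cases "s = t")
  case False
  with assms have st: "0 \<le> s" "s < t" by auto
  note I = increment_indep_aug_filtration[OF st assms(3)]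
  have I2: "indep_var borel H borel (\<lambda>\<omega>. (W t \<omega> - W s \<omega>)\<^sup>2)"
    using indep_var_compose[OF I, of id borel "\<lambda>x. x\<^sup>2" borel] by (simp add: comp_def id_def)
  show "(integrable M (\<lambda>\<omega>. H \<omega> * (W t \<omega> - W s \<omega>)) \<and> expectation (\<lambda>\<omega>. H \<omega> * (W t \<omega> - W s \<omega>)) = 0) \<and>
    (integrable M (\<lambda>\<omega>. H \<omega> * (W t \<omega> - W s \<omega>)\<^sup>2) \<and>
     expectation (\<lambda>\<omega>. H \<omega> * (W t \<omega> - W s \<omega>)\<^sup>2) = (t - s) * expectation H)"
    using indep_var_integrable[OF I assms(4) increment_mean(1)[OF st]]
      indep_var_lebesgue_integral[OF I assms(4) increment_mean(1)[OF st]] increment_mean(2)[OF st]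
      indep_var_integrable[OF I2 assms(4) increment_variance(1)[OF st]]
      indep_var_lebesgue_integral[OF I2 assms(4) increment_variance(1)[OF st]] increment_variance(2)[OF st]
    by simp
qed simp

lemma sq_integrable_increment: "0 \<le> s \<Longrightarrow> 0 \<le> t \<Longrightarrow> sq_integrable M (\<lambda>\<omega>. W t \<omega> - W s \<omega>)"
proof (induction s t rule: linorder_wlog)
  case (le s t)
  have "integrable M (\<lambda>\<omega>. 1 * (W t \<omega> - W s \<omega>)\<^sup>2)"
    using le by (intro increment_sq(1)) auto
  then show ?case
    using increment_measurable[OF le(2,3)] by (simp add: sq_integrable_def)
next
  case (sym s t)
  from sq_integrable_minus[OF sym(1)[OF sym(3,2)]] show ?case by (simp only: minus_diff_eq)
qed

section \<open>The isometry for single steps\<close>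

sublocale time_space: pair_sigma_finite lborel M ..

abbreviation \<P> :: "(real \<times> 'w) measure" where "\<P> \<equiv> lborel \<Otimes>\<^sub>M M"

lemma
  fixes f :: "real \<Rightarrow> real" and g :: "'w \<Rightarrow> real"
  assumes f: "integrable lborel f" and g: "integrable M g"
  shows integrable_product: "integrable \<P> (\<lambda>z. f (fst z) * g (snd z))"
    and integral_product: "(\<integral>z. f (fst z) * g (snd z) \<partial>\<P>) = (\<integral>r. f r \<partial>lborel) * expectation g"
proof -
  have [measurable]: "f \<in> borel_measurable borel" "g \<in> borel_measurable M" using f g by auto
  show i: "integrable \<P> (\<lambda>z. f (fst z) * g (snd z))"
  proof (rule time_space.Fubini_integrable)
    show "integrable lborel (\<lambda>x. \<integral>y. norm (f (fst (x, y)) * g (snd (x, y))) \<partial>M)"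
      using integrable_abs[OF f] by (simp add: abs_mult)
    show "AE x in lborel. integrable M (\<lambda>y. f (fst (x, y)) * g (snd (x, y)))"
      using g by simp
  qed measurable
  show "(\<integral>z. f (fst z) * g (snd z) \<partial>\<P>) = (\<integral>r. f r \<partial>lborel) * expectation g"
    using time_space.integral_fst'[OF i] by simp
qed

lemma sq_integrable_imp_integrable:
  assumes "sq_integrable M (f :: 'w \<Rightarrow> real)"
  shows "integrable M f"
  using assms unfolding sq_integrable_def real_norm_def power2_abs
  by (elim conjE) (rule square_integrable_imp_integrable)

lemma sq_integrable_bounded_increment:
  fixes \<eta> :: "'w \<Rightarrow> 'a::euclidean_space"
  assumes "0 \<le> a" "0 \<le> b" "\<eta> \<in> borel_measurable M" "\<And>\<omega>. \<omega> \<in> space M \<Longrightarrow> norm (\<eta> \<omega>) \<le> c"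
  shows "sq_integrable M (\<lambda>\<omega>. (W b \<omega> - W a \<omega>) *\<^sub>R \<eta> \<omega>)"
proof (rule sq_integrable_dominated)
  show "sq_integrable M (\<lambda>\<omega>. W b \<omega> - W a \<omega>)" using assms by (intro sq_integrable_increment)
  show "(\<lambda>\<omega>. (W b \<omega> - W a \<omega>) *\<^sub>R \<eta> \<omega>) \<in> borel_measurable M"
    using assms(3) increment_measurable[OF assms(1,2)] by measurable
  fix \<omega> assume "\<omega> \<in> space M"
  then show "norm ((W b \<omega> - W a \<omega>) *\<^sub>R \<eta> \<omega>) \<le> c * norm (W b \<omega> - W a \<omega>)"
    using mult_left_mono[OF assms(4), of \<omega> "\<bar>W b \<omega> - W a \<omega>\<bar>"] by (simp add: mult.commute)
qed

lemma sq_integrable_step: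
  fixes \<eta> :: "'w \<Rightarrow> 'a::euclidean_space"
  assumes "\<eta> \<in> borel_measurable M" "\<And>\<omega>. \<omega> \<in> space M \<Longrightarrow> norm (\<eta> \<omega>) \<le> c"
  shows "sq_integrable \<P> (\<lambda>z. indicator {a<..b} (fst z) *\<^sub>R \<eta> (snd z))"
proof (rule sq_integrable_dominated)
  have "integrable \<P> (\<lambda>z. indicator {a<..b} (fst z) :: real)"
    using integrable_product[of "indicator {a<..b}" "\<lambda>_. 1"]
      emeasure_lborel_Ioc_finite[of a b]
    by (simp add: integrable_indicator_iff)
  moreover have "(norm (indicator {a<..b} r :: real))\<^sup>2 = indicator {a<..b} r" for r :: real
    by (simp add: indicator_def)
  ultimately show "sq_integrable \<P> (\<lambda>z. indicator {a<..b} (fst z) :: real)"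
    unfolding sq_integrable_def by (simp del: real_norm_def)
  show "(\<lambda>z. indicator {a<..b} (fst z) *\<^sub>R \<eta> (snd z)) \<in> borel_measurable \<P>"
    using assms(1) by measurable
  fix z assume "z \<in> space \<P>"
  then show "norm (indicator {a<..b} (fst z) *\<^sub>R \<eta> (snd z)) \<le> c * norm (indicator {a<..b} (fst z) :: real)"
    using assms(2)[of "snd z"] by (auto simp: space_pair_measure indicator_def)
qed

text \<open>
  When \<open>(a, b]\<close> ends before \<open>(c, d]\<close> starts, the second increment is independent of the other factors
  and has mean zero. Otherwise, cutting at \<open>c\<close> and at \<open>min b d\<close> leaves the square of the
  increment over the overlap plus products in which one factor lies entirely later than the others.
\<close>

lemma increment_product_expectation_ordered:
  fixes H :: "'w \<Rightarrow> real"
  assumes ab: "0 \<le> a" "a \<le> b" and cd: "c \<le> d" and ac: "a \<le> c"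
    and H: "H \<in> borel_measurable (\<F> c)" and bnd: "\<And>\<omega>. \<omega> \<in> space M \<Longrightarrow> norm (H \<omega>) \<le> K"
  shows "expectation (\<lambda>\<omega>. H \<omega> * (W b \<omega> - W a \<omega>) * (W d \<omega> - W c \<omega>))
    = measure lborel ({a<..b} \<inter> {c<..d}) * expectation H"
proof -
  have c0: "0 \<le> c" using ab ac by linarith
  have HM: "H \<in> borel_measurable M" by (rule measurable_aug_filtration_imp[OF c0 H])
  have iH: "integrable M H" using HM bnd by (intro integrable_const_bound[of _ K]) (auto intro!: AE_I2)
  have G: "(\<lambda>\<omega>. H \<omega> * (W y \<omega> - W x \<omega>)) \<in> borel_measurable (\<F> t)"
      "integrable M (\<lambda>\<omega>. H \<omega> * (W y \<omega> - W x \<omega>))" if "0 \<le> x" "x \<le> y" "y \<le> t" "c \<le> t" for x y t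
  proof -
    have "W x \<in> borel_measurable (\<F> t)" "W y \<in> borel_measurable (\<F> t)" "H \<in> borel_measurable (\<F> t)"
      using that W_adapted measurable_aug_filtration_mono[OF c0 _ H] by auto
    then show "(\<lambda>\<omega>. H \<omega> * (W y \<omega> - W x \<omega>)) \<in> borel_measurable (\<F> t)" by measurable
    have "sq_integrable M (\<lambda>\<omega>. (W y \<omega> - W x \<omega>) *\<^sub>R H \<omega>)"
      using that by (intro sq_integrable_bounded_increment[OF _ _ HM bnd]) auto
    then have "integrable M (\<lambda>\<omega>. (W y \<omega> - W x \<omega>) * H \<omega>)"
      using sq_integrable_imp_integrable by (simp only: real_scaleR_def)
    then show "integrable M (\<lambda>\<omega>. H \<omega> * (W y \<omega> - W x \<omega>))"
      by (simp only: mult.commute)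
  qed
  show ?thesis
  proof (cases "b \<le> c")
    case True
    then have empty: "{a<..b} \<inter> {c<..d} = {}" by auto
    show ?thesis
      unfolding empty using increment_orthogonal(2)[OF c0 cd G[OF ab True order_refl]] by simp
  next
    case False
    define m n where "m = min b d" and "n = max b d"
    have m: "c \<le> m" "m \<le> n" using False cd by (auto simp: m_def n_def)
    then have m0: "0 \<le> m" using c0 by linarith
    have split: "H \<omega> * (W b \<omega> - W a \<omega>) * (W d \<omega> - W c \<omega>) =
        H \<omega> * (W c \<omega> - W a \<omega>) * (W d \<omega> - W c \<omega>) +
        (H \<omega> * (W m \<omega> - W c \<omega>)\<^sup>2 + H \<omega> * (W m \<omega> - W c \<omega>) * (W n \<omega> - W m \<omega>))" for \<omega>
      by (cases "b \<le> d") (simp_all add: m_def n_def power2_eq_square algebra_simps)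
    note i1 = increment_orthogonal[OF c0 cd G[OF ab(1) ac order_refl order_refl]]
    note i2 = increment_sq[OF c0 m(1) H iH]
    note i3 = increment_orthogonal[OF m0 m(2) G[OF c0 m(1) order_refl m(1)]]
    have "expectation (\<lambda>\<omega>. H \<omega> * (W b \<omega> - W a \<omega>) * (W d \<omega> - W c \<omega>)) = (m - c) * expectation H"
      unfolding split using i1 i2 i3 by simp
    moreover have "{a<..b} \<inter> {c<..d} = {c<..m}" using ac by (auto simp: m_def)
    ultimately show ?thesis using m(1) by simp
  qed
qed

text \<open>
  The It\^o isometry in bilinear form for two steps over arbitrary intervals. Because the intervals may
  overlap in any way, simple processes over different partitions can be compared without a common
  refinement.
\<close>

lemma step_isometry:
  fixes \<eta> \<theta> :: "'w \<Rightarrow> 'a::euclidean_space"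
  assumes ab: "0 \<le> a" "a \<le> b" and cd: "0 \<le> c" "c \<le> d"
    and \<eta>: "\<eta> \<in> borel_measurable (\<F> a)" "\<And>\<omega>. \<omega> \<in> space M \<Longrightarrow> norm (\<eta> \<omega>) \<le> K"
    and \<theta>: "\<theta> \<in> borel_measurable (\<F> c)" "\<And>\<omega>. \<omega> \<in> space M \<Longrightarrow> norm (\<theta> \<omega>) \<le> L"
  shows "expectation (\<lambda>\<omega>. ((W b \<omega> - W a \<omega>) *\<^sub>R \<eta> \<omega>) \<bullet> ((W d \<omega> - W c \<omega>) *\<^sub>R \<theta> \<omega>)) =
    (\<integral>z. (indicator {a<..b} (fst z) *\<^sub>R \<eta> (snd z)) \<bullet> (indicator {c<..d} (fst z) *\<^sub>R \<theta> (snd z)) \<partial>\<P>)"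
proof -
  define H where "H \<omega> = \<eta> \<omega> \<bullet> \<theta> \<omega>" for \<omega>
  have bnd: "norm (H \<omega>) \<le> K * L" if "\<omega> \<in> space M" for \<omega>
    using Cauchy_Schwarz_ineq2[of "\<eta> \<omega>" "\<theta> \<omega>"] mult_mono[OF \<eta>(2)[OF that] \<theta>(2)[OF that]]
      order_trans[OF norm_ge_zero \<eta>(2)[OF that]]
    by (simp add: H_def)
  have meas: "H \<in> borel_measurable (\<F> t)" if "a \<le> t" "c \<le> t" for t
    unfolding H_def using measurable_aug_filtration_mono[OF ab(1) that(1) \<eta>(1)]
      measurable_aug_filtration_mono[OF cd(1) that(2) \<theta>(1)] by measurable
  have HM: "H \<in> borel_measurable M"
    by (rule measurable_aug_filtration_imp[OF _ meas[of "max a c"]]) (use ab in auto)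
  have iH: "integrable M H" using HM bnd by (intro integrable_const_bound[of _ "K * L"]) (auto intro!: AE_I2)
  have mean: "expectation (\<lambda>\<omega>. ((W b \<omega> - W a \<omega>) *\<^sub>R \<eta> \<omega>) \<bullet> ((W d \<omega> - W c \<omega>) *\<^sub>R \<theta> \<omega>))
      = measure lborel ({a<..b} \<inter> {c<..d}) * expectation H"
  proof (cases "a \<le> c")
    case True
    have eq: "((W b \<omega> - W a \<omega>) *\<^sub>R \<eta> \<omega>) \<bullet> ((W d \<omega> - W c \<omega>) *\<^sub>R \<theta> \<omega>)
        = H \<omega> * (W b \<omega> - W a \<omega>) * (W d \<omega> - W c \<omega>)" for \<omega> by (simp add: H_def)
    show ?thesis
      unfolding eq using increment_product_expectation_ordered[OF ab cd(2) True meas bnd] True by simp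
  next
    case False
    have eq: "((W b \<omega> - W a \<omega>) *\<^sub>R \<eta> \<omega>) \<bullet> ((W d \<omega> - W c \<omega>) *\<^sub>R \<theta> \<omega>)
        = H \<omega> * (W d \<omega> - W c \<omega>) * (W b \<omega> - W a \<omega>)" for \<omega> by (simp add: H_def)
    show ?thesis
      unfolding eq using increment_product_expectation_ordered[OF cd ab(2) _ meas bnd] False by (simp add: Int_commute)
  qed
  have "(\<integral>z. (indicator {a<..b} (fst z) *\<^sub>R \<eta> (snd z)) \<bullet> (indicator {c<..d} (fst z) *\<^sub>R \<theta> (snd z)) \<partial>\<P>)
      = (\<integral>z. indicator ({a<..b} \<inter> {c<..d}) (fst z) * H (snd z) \<partial>\<P>)"
    by (intro Bochner_Integration.integral_cong) (auto simp: H_def indicator_def)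
  also have "\<dots> = measure lborel ({a<..b} \<inter> {c<..d}) * expectation H"
  proof -
    have "{a<..b} \<inter> {c<..d} = {max a c<..min b d}" by auto
    then have "emeasure lborel ({a<..b} \<inter> {c<..d}) < \<infinity>" by (simp only: emeasure_lborel_Ioc_finite)
    then have "integrable lborel (indicator ({a<..b} \<inter> {c<..d}) :: real \<Rightarrow> real)"
      by (simp only: integrable_indicator_iff) simp
    from integral_product[OF this iH] show ?thesis by (simp only: integral_indicator) simp
  qed
  finally show ?thesis unfolding mean by (rule sym)
qed

section \<open>Simple processes\<close>

lemma is_simpleD:
  assumes "is_simple M W T (k, \<tau>, \<eta>)" "i < k"
  shows "0 \<le> \<tau> i" "\<tau> i \<le> \<tau> (Suc i)" "\<tau> (Suc i) \<le> T" "\<eta> i \<in> borel_measurable (\<F> (\<tau> i))"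
    "\<eta> i \<in> borel_measurable M"
proof -
  have step: "\<tau> j \<le> \<tau> (Suc j)" if "j < k" for j using assms that by (simp add: is_simple_def)
  have up: "\<tau> 0 \<le> \<tau> j" if "j \<le> k" for j using that
  proof (induction j)
    case (Suc j) then show ?case using step[of j] by simp
  qed simp
  have down: "\<tau> j \<le> \<tau> k" if "j \<le> k" for j using that
  proof (induction j rule: inc_induct)
    case (step n) then show ?case using \<open>\<And>j. j < k \<Longrightarrow> \<tau> j \<le> \<tau> (Suc j)\<close>[of n] by simp
  qed simp
  show 1: "0 \<le> \<tau> i" using up[of i] assms by (simp add: is_simple_def)
  show "\<tau> i \<le> \<tau> (Suc i)" using step assms by simp
  show "\<tau> (Suc i) \<le> T" using down[of "Suc i"] assms by (simp add: is_simple_def)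
  show 2: "\<eta> i \<in> borel_measurable (\<F> (\<tau> i))" using assms by (simp add: is_simple_def)
  show "\<eta> i \<in> borel_measurable M" by (rule measurable_aug_filtration_imp[OF 1 2])
qed

lemma is_simple_bound:
  assumes "is_simple M W T (k, \<tau>, \<eta>)"
  obtains c where "\<And>i \<omega>. i < k \<Longrightarrow> \<omega> \<in> space M \<Longrightarrow> norm (\<eta> i \<omega>) \<le> c"
  using assms unfolding is_simple_def prod.case by blast

lemma sq_integrable_simple_integral:
  assumes "is_simple M W T S"
  shows "sq_integrable M (simple_integral W S)"
proof -
  obtain k \<tau> \<eta> where S: "S = (k, \<tau>, \<eta>)" by (cases S)
  obtain c where c: "\<And>i \<omega>. i < k \<Longrightarrow> \<omega> \<in> space M \<Longrightarrow> norm (\<eta> i \<omega>) \<le> c"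
    using is_simple_bound assms S by blast
  have "sq_integrable M (\<lambda>\<omega>. \<Sum>i<k. (W (\<tau> (Suc i)) \<omega> - W (\<tau> i) \<omega>) *\<^sub>R \<eta> i \<omega>)"
  proof (rule sq_integrable_sum)
    fix i assume "i \<in> {..<k}"
    then have i: "i < k" by simp
    note D = is_simpleD[OF assms[unfolded S] i]
    show "sq_integrable M (\<lambda>\<omega>. (W (\<tau> (Suc i)) \<omega> - W (\<tau> i) \<omega>) *\<^sub>R \<eta> i \<omega>)"
      by (rule sq_integrable_bounded_increment[OF D(1) order_trans[OF D(1,2)] D(5) c[OF i]])
  qed
  then show ?thesis by (simp add: S simple_integral_def)
qed

lemma sq_integrable_simple_process:
  assumes "is_simple M W T S"
  shows "sq_integrable \<P> (\<lambda>z. simple_process S (fst z) (snd z))"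
proof -
  obtain k \<tau> \<eta> where S: "S = (k, \<tau>, \<eta>)" by (cases S)
  obtain c where c: "\<And>i \<omega>. i < k \<Longrightarrow> \<omega> \<in> space M \<Longrightarrow> norm (\<eta> i \<omega>) \<le> c"
    using is_simple_bound assms S by blast
  have "sq_integrable \<P> (\<lambda>z. \<Sum>i<k. indicator {\<tau> i<..\<tau> (Suc i)} (fst z) *\<^sub>R \<eta> i (snd z))"
    using is_simpleD(5)[OF assms[unfolded S]] c by (intro sq_integrable_sum sq_integrable_step) auto
  then show ?thesis by (simp add: S simple_process_def)
qed

lemma simple_isometry_inner:
  assumes "is_simple M W T S" "is_simple M W T' S'"
  shows "expectation (\<lambda>\<omega>. simple_integral W S \<omega> \<bullet> simple_integral W S' \<omega>) =
    (\<integral>z. simple_process S (fst z) (snd z) \<bullet> simple_process S' (fst z) (snd z) \<partial>\<P>)"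
proof -
  obtain k \<tau> \<eta> where S: "S = (k, \<tau>, \<eta>)" by (cases S)
  obtain c where c: "\<And>i \<omega>. i < k \<Longrightarrow> \<omega> \<in> space M \<Longrightarrow> norm (\<eta> i \<omega>) \<le> c"
    using is_simple_bound assms(1) S by blast
  obtain k' \<tau>' \<eta>' where S': "S' = (k', \<tau>', \<eta>')" by (cases S')
  obtain c' where c': "\<And>i \<omega>. i < k' \<Longrightarrow> \<omega> \<in> space M \<Longrightarrow> norm (\<eta>' i \<omega>) \<le> c'"
    using is_simple_bound assms(2) S' by blast
  note D = is_simpleD[OF assms(1)[unfolded S]] and D' = is_simpleD[OF assms(2)[unfolded S']]
  let ?I = "\<lambda>i \<omega>. (W (\<tau> (Suc i)) \<omega> - W (\<tau> i) \<omega>) *\<^sub>R \<eta> i \<omega>"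
  let ?I' = "\<lambda>i \<omega>. (W (\<tau>' (Suc i)) \<omega> - W (\<tau>' i) \<omega>) *\<^sub>R \<eta>' i \<omega>"
  let ?P = "\<lambda>i z. indicator {\<tau> i<..\<tau> (Suc i)} (fst z) *\<^sub>R \<eta> i (snd z)"
  let ?P' = "\<lambda>i z. indicator {\<tau>' i<..\<tau>' (Suc i)} (fst z) *\<^sub>R \<eta>' i (snd z)"
  have "expectation (\<lambda>\<omega>. simple_integral W S \<omega> \<bullet> simple_integral W S' \<omega>)
      = (\<Sum>i<k. \<Sum>j<k'. expectation (\<lambda>\<omega>. ?I i \<omega> \<bullet> ?I' j \<omega>))"
    unfolding S S' simple_integral_def prod.case
  proof (rule integral_inner_sum)
    fix i assume "i \<in> {..<k}" then have i: "i < k" by simp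
    show "sq_integrable M (?I i)"
      by (rule sq_integrable_bounded_increment[OF D(1)[OF i] order_trans[OF D(1,2)[OF i]] D(5)[OF i] c[OF i]])
  next
    fix i assume "i \<in> {..<k'}" then have i: "i < k'" by simp
    show "sq_integrable M (?I' i)"
      by (rule sq_integrable_bounded_increment[OF D'(1)[OF i] order_trans[OF D'(1,2)[OF i]] D'(5)[OF i] c'[OF i]])
  qed auto
  also have "\<dots> = (\<Sum>i<k. \<Sum>j<k'. \<integral>z. ?P i z \<bullet> ?P' j z \<partial>\<P>)"
  proof (intro sum.cong refl)
    fix i j assume "i \<in> {..<k}" "j \<in> {..<k'}"
    then have i: "i < k" and j: "j < k'" by auto
    show "expectation (\<lambda>\<omega>. ?I i \<omega> \<bullet> ?I' j \<omega>) = (\<integral>z. ?P i z \<bullet> ?P' j z \<partial>\<P>)"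
      by (rule step_isometry[OF D(1,2)[OF i] D'(1,2)[OF j] D(4)[OF i] c[OF i] D'(4)[OF j] c'[OF j]])
  qed
  also have "\<dots> = (\<integral>z. simple_process S (fst z) (snd z) \<bullet> simple_process S' (fst z) (snd z) \<partial>\<P>)"
    unfolding S S' simple_process_def prod.case
    using D(5) D'(5) c c' by (intro integral_inner_sum[symmetric] sq_integrable_step) auto
  finally show ?thesis .
qed

lemma simple_isometry_diff:
  assumes "is_simple M W T S" "is_simple M W T' S'"
  shows "expectation (\<lambda>\<omega>. (norm (simple_integral W S \<omega> - simple_integral W S' \<omega>))\<^sup>2) =
    (\<integral>z. (norm (simple_process S (fst z) (snd z) - simple_process S' (fst z) (snd z)))\<^sup>2 \<partial>\<P>)"
proof -
  note I = assms[THEN sq_integrable_simple_integral] and P = assms[THEN sq_integrable_simple_process]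
  show ?thesis
    unfolding integral_sq_diff[OF I] integral_sq_diff[OF P]
    unfolding power2_norm_eq_inner
    using simple_isometry_inner[OF assms] simple_isometry_inner[OF assms(1,1)] simple_isometry_inner[OF assms(2,2)]
    by (simp only:)
qed

text \<open>
  Cutting the partition points at \<open>s\<close> would move the later coefficients to times at which they are not
  measurable; these steps have become empty, so their coefficients are replaced by zero.
\<close>

definition stopped_simple :: "real \<Rightarrow> ('w, 'a::euclidean_space) simple_data \<Rightarrow> ('w, 'a) simple_data" where
  "stopped_simple s = (\<lambda>(k, \<tau>, \<eta>). (k, \<lambda>i. min (\<tau> i) s, \<lambda>i. if \<tau> i < s then \<eta> i else (\<lambda>_. 0)))"

lemma is_simple_stopped:
  assumes "is_simple M W T S" "0 \<le> s"
  shows "is_simple M W s (stopped_simple s S)"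
proof -
  obtain k \<tau> \<eta> where S: "S = (k, \<tau>, \<eta>)" by (cases S)
  obtain c where c: "\<And>i \<omega>. i < k \<Longrightarrow> \<omega> \<in> space M \<Longrightarrow> norm (\<eta> i \<omega>) \<le> c"
    using is_simple_bound assms(1) S by blast
  note D = is_simpleD[OF assms(1)[unfolded S]]
  have bnd: "norm ((if \<tau> i < s then \<eta> i else (\<lambda>_. 0)) \<omega>) \<le> max c 0" if "i < k" "\<omega> \<in> space M" for i \<omega>
    using c[OF that] by auto
  show ?thesis
    unfolding S stopped_simple_def is_simple_def prod.case
  proof (intro conjI allI impI)
    show "0 \<le> min (\<tau> 0) s" using assms by (simp add: S is_simple_def)
    show "min (\<tau> k) s \<le> s" by simp
    show "\<exists>c. \<forall>i<k. \<forall>\<omega>\<in>space M. norm ((if \<tau> i < s then \<eta> i else (\<lambda>_. 0)) \<omega>) \<le> c"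
      using bnd by blast
    fix i assume i: "i < k"
    show "min (\<tau> i) s \<le> min (\<tau> (Suc i)) s" using D(2)[OF i] by auto
    show "(if \<tau> i < s then \<eta> i else (\<lambda>_. 0)) \<in> borel_measurable (\<F> (min (\<tau> i) s))"
      using D(4)[OF i] by (simp add: min_def)
  qed
qed

lemma simple_process_stopped:
  "simple_process (stopped_simple s S) r \<omega> = indicator {..s} r *\<^sub>R simple_process S r \<omega>"
proof -
  obtain k \<tau> \<eta> where S: "S = (k, \<tau>, \<eta>)" by (cases S)
  have "indicator {min (\<tau> i) s<..min (\<tau> (Suc i)) s} r *\<^sub>R (if \<tau> i < s then \<eta> i else (\<lambda>_. 0)) \<omega>
      = indicator {..s} r *\<^sub>R (indicator {\<tau> i<..\<tau> (Suc i)} r *\<^sub>R \<eta> i \<omega>)" for i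
    by (simp add: indicator_def min_def)
  then show ?thesis
    unfolding S simple_process_def stopped_simple_def prod.case scaleR_sum_right by (intro sum.cong refl)
qed

text \<open>
  After cutting the step that contains \<open>s\<close>, each later increment is independent of the \<open>\<sigma>\<close>-algebra at
  the start of its step, for which both its coefficient and \<open>G\<close> are measurable.
\<close>

lemma simple_integral_stopped_inner:
  assumes S: "is_simple M W T S" and s: "0 \<le> s"
    and G: "G \<in> borel_measurable (\<F> s)" "sq_integrable M G"
  shows "expectation (\<lambda>\<omega>. simple_integral W S \<omega> \<bullet> G \<omega>) = expectation (\<lambda>\<omega>. simple_integral W (stopped_simple s S) \<omega> \<bullet> G \<omega>)"
proof -
  obtain k \<tau> \<eta> where S': "S = (k, \<tau>, \<eta>)" by (cases S)
  obtain c where c: "\<And>i \<omega>. i < k \<Longrightarrow> \<omega> \<in> space M \<Longrightarrow> norm (\<eta> i \<omega>) \<le> c"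
    using is_simple_bound S S' by blast
  let ?J = "\<lambda>i \<omega>. (W (min (\<tau> (Suc i)) s) \<omega> - W (min (\<tau> i) s) \<omega>) *\<^sub>R (if \<tau> i < s then \<eta> i else (\<lambda>_. 0)) \<omega>"
  let ?I = "\<lambda>i \<omega>. (W (\<tau> (Suc i)) \<omega> - W (\<tau> i) \<omega>) *\<^sub>R \<eta> i \<omega>"
  have main: "sq_integrable M (?I i) \<and> sq_integrable M (?J i) \<and> expectation (\<lambda>\<omega>. ?I i \<omega> \<bullet> G \<omega>) = expectation (\<lambda>\<omega>. ?J i \<omega> \<bullet> G \<omega>)"
    if i: "i < k" for i
  proof -
    note D = is_simpleD[OF S[unfolded S'] i]
    define a b where "a = \<tau> i" and "b = \<tau> (Suc i)"
    have ab: "0 \<le> a" "a \<le> b" "0 \<le> b" using D by (auto simp: a_def b_def)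
    have sqI: "sq_integrable M (\<lambda>\<omega>. (W y \<omega> - W x \<omega>) *\<^sub>R \<eta> i \<omega>)" if "0 \<le> x" "0 \<le> y" for x y
      by (rule sq_integrable_bounded_increment[OF that D(5) c[OF i]])
    have sqeta: "sq_integrable M (\<eta> i)"
      by (rule sq_integrable_dominated[of _ _ "\<lambda>_. 1 :: real" c]) (use D(5) c[OF i] in \<open>simp_all add: sq_integrable_def\<close>)
    have late: "expectation (\<lambda>\<omega>. ((W y \<omega> - W x \<omega>) *\<^sub>R \<eta> i \<omega>) \<bullet> G \<omega>) = 0"
      if "a \<le> x" "s \<le> x" "x \<le> y" for x y
    proof -
      have "(\<lambda>\<omega>. \<eta> i \<omega> \<bullet> G \<omega>) \<in> borel_measurable (\<F> x)"
        using measurable_aug_filtration_mono[OF ab(1) that(1) D(4)[folded a_def]]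
          measurable_aug_filtration_mono[OF s that(2) G(1)] by measurable
      from increment_orthogonal(2)[OF _ that(3) this integrable_inner[OF sqeta G(2)]] that s
      show ?thesis by (simp add: mult.commute)
    qed
    show ?thesis
    proof (cases "a < s")
      case False
      then show ?thesis
        using sqI[OF ab(1,3)] late[of a b] ab by (simp add: a_def[symmetric] b_def[symmetric] sq_integrable_def)
    next
      case True
      show ?thesis
      proof (cases "b \<le> s")
        case True
        then show ?thesis using \<open>a < s\<close> sqI[OF ab(1,3)] by (simp add: a_def[symmetric] b_def[symmetric])
      next
        case False
        have "(\<lambda>\<omega>. ((W b \<omega> - W a \<omega>) *\<^sub>R \<eta> i \<omega>) \<bullet> G \<omega>) =
          (\<lambda>\<omega>. ((W s \<omega> - W a \<omega>) *\<^sub>R \<eta> i \<omega>) \<bullet> G \<omega> + ((W b \<omega> - W s \<omega>) *\<^sub>R \<eta> i \<omega>) \<bullet> G \<omega>)"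
          by (simp add: algebra_simps)
        then have "expectation (\<lambda>\<omega>. ((W b \<omega> - W a \<omega>) *\<^sub>R \<eta> i \<omega>) \<bullet> G \<omega>) =
          expectation (\<lambda>\<omega>. ((W s \<omega> - W a \<omega>) *\<^sub>R \<eta> i \<omega>) \<bullet> G \<omega>)"
          using late[of s b] False True integrable_inner[OF sqI[OF ab(1) s] G(2)] integrable_inner[OF sqI[OF s ab(3)] G(2)]
          by simp
        then show ?thesis using \<open>a < s\<close> False sqI[OF ab(1,3)] sqI[OF ab(1) s]
          by (simp add: a_def[symmetric] b_def[symmetric])
      qed
    qed
  qed
  have eq: "expectation (\<lambda>\<omega>. (\<Sum>i<k. f i \<omega>) \<bullet> G \<omega>) = (\<Sum>i<k. expectation (\<lambda>\<omega>. f i \<omega> \<bullet> G \<omega>))"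
    if "\<And>i. i < k \<Longrightarrow> sq_integrable M (f i)" for f
    using that by (simp add: inner_sum_left integrable_inner[OF _ G(2)])
  show ?thesis
    unfolding S' stopped_simple_def simple_integral_def prod.case
    using main by (simp add: eq cong: sum.cong_simp)
qed

section \<open>Increments of It\^o integrals\<close>

text \<open>
  Progressive measurability at the final time gives joint measurability on \<open>[0, T] \<times> \<Omega>\<close>, because the
  augmented filtration consists of events of \<open>M\<close>.
\<close>

lemma window_measurable:
  assumes \<phi>: "progressive M W T \<phi>" and "0 \<le> s" "t \<le> T" "0 \<le> T"
  shows "window s t \<phi> \<in> borel_measurable \<P>"
proof -
  let ?R = "restrict_space \<P> ({0..T} \<times> space M)"
  have sub: "{0..T} \<times> space M \<inter> space \<P> \<in> sets \<P>"
    by (rule sets.Int[OF pair_measureI sets.top]) simp_all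
  have pair: "(\<lambda>z. (fst z, snd z)) \<in> ?R \<rightarrow>\<^sub>M restrict_space borel {0..T} \<Otimes>\<^sub>M \<F> T"
  proof (rule measurable_Pair)
    have "fst \<in> ?R \<rightarrow>\<^sub>M borel"
      by (rule measurable_restrict_space1) (simp add: measurable_fst')
    then show "fst \<in> ?R \<rightarrow>\<^sub>M restrict_space borel {0..T}"
      by (rule measurable_restrict_space2[rotated]) (auto simp: space_restrict_space)
    have "(\<lambda>x. x) \<in> M \<rightarrow>\<^sub>M \<F> T"
    proof (rule measurableI)
      fix E assume "E \<in> sets (\<F> T)"
      then have "E \<in> sets M" using sets_aug_filtration[OF assms(4)] by blast
      then show "(\<lambda>x. x) -` E \<inter> space M \<in> sets M" by simp
    qed simp
    then show "snd \<in> ?R \<rightarrow>\<^sub>M \<F> T"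
      by (intro measurable_restrict_space1 measurable_compose[OF measurable_snd, of "\<lambda>x. x", simplified])
  qed
  have "(\<lambda>(s, \<omega>). \<phi> s \<omega>) \<in> borel_measurable (restrict_space borel {0..T} \<Otimes>\<^sub>M \<F> T)"
    using \<phi> assms(4) by (simp add: progressive_def)
  from measurable_compose[OF pair this]
  have "(\<lambda>z. \<phi> (fst z) (snd z)) \<in> borel_measurable ?R" by (simp only: prod.case)
  then have "(\<lambda>z. indicator ({0..T} \<times> space M) z *\<^sub>R \<phi> (fst z) (snd z)) \<in> borel_measurable \<P>"
    by (simp only: borel_measurable_restrict_space_iff[OF sub])
  then have "(\<lambda>z. indicator {s<..t} (fst z) *\<^sub>R (indicator ({0..T} \<times> space M) z *\<^sub>R \<phi> (fst z) (snd z)))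
    \<in> borel_measurable \<P>" by measurable
  then show ?thesis
    by (rule measurable_cong[THEN iffD1, rotated])
      (use assms in \<open>auto simp: window_def space_pair_measure indicator_def\<close>)
qed

text \<open>
  The windows leave out the time \<open>0\<close>, which is negligible for Lebesgue measure.
\<close>

lemma nn_integral_window:
  assumes "window 0 T \<phi> \<in> borel_measurable \<P>"
  shows "(\<integral>\<^sup>+\<omega>. (\<integral>\<^sup>+r\<in>{0..T}. ennreal ((norm (\<phi> r \<omega>))\<^sup>2) \<partial>lborel) \<partial>M)
    = (\<integral>\<^sup>+z. ennreal ((norm (window 0 T \<phi> z))\<^sup>2) \<partial>\<P>)"
proof -
  have "(\<integral>\<^sup>+r\<in>{0..T}. ennreal ((norm (\<phi> r \<omega>))\<^sup>2) \<partial>lborel)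
      = (\<integral>\<^sup>+r. ennreal ((norm (window 0 T \<phi> (r, \<omega>)))\<^sup>2) \<partial>lborel)" for \<omega>
    using AE_lborel_singleton[of 0]
    by (intro nn_integral_cong_AE) (auto simp: window_def indicator_def elim!: eventually_mono)
  then show ?thesis
    using time_space.nn_integral_snd[of "\<lambda>z. ennreal ((norm (window 0 T \<phi> z))\<^sup>2)"] assms by simp
qed

lemma sq_integrable_subwindow:
  assumes "sq_integrable \<P> (window s t \<phi>)" "s \<le> s'" "t' \<le> t"
  shows "sq_integrable \<P> (window s' t' \<phi>)"
proof (rule sq_integrable_dominated[OF _ assms(1), of _ 1])
  have eq: "window s' t' \<phi> = (\<lambda>z. indicator {s'<..t'} (fst z) *\<^sub>R window s t \<phi> z)"
    using assms(2,3) by (auto simp: window_def indicator_def fun_eq_iff)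
  have "window s t \<phi> \<in> borel_measurable \<P>" using assms(1) by (rule sq_integrable_measurable)
  then show "window s' t' \<phi> \<in> borel_measurable \<P>" unfolding eq by measurable
  show "norm (window s' t' \<phi> z) \<le> 1 * norm (window s t \<phi> z)" for z
    unfolding eq by (simp add: indicator_def)
qed

lemma L2_prog_window:
  assumes \<phi>: "L2_prog M W T \<phi>" and "0 \<le> s" "t \<le> T" "0 \<le> T"
  shows "sq_integrable \<P> (window s t \<phi>)"
proof (rule sq_integrable_subwindow)
  have "window 0 T \<phi> \<in> borel_measurable \<P>"
    using \<phi> assms(4) by (intro window_measurable) (auto simp: L2_prog_def)
  then show "sq_integrable \<P> (window 0 T \<phi>)"
    using \<phi> nn_integral_window[of T \<phi>] by (simp add: L2_prog_def sq_integrable_iff_nn_integral)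
qed (use assms in auto)

lemma simple_process_support:
  assumes "is_simple M W T S" "r \<notin> {0<..T}"
  shows "simple_process S r \<omega> = 0"
proof -
  obtain k \<tau> \<eta> where S: "S = (k, \<tau>, \<eta>)" by (cases S)
  have "indicator {\<tau> i<..\<tau> (Suc i)} r *\<^sub>R \<eta> i \<omega> = 0" if "i < k" for i
    using is_simpleD(1-3)[OF assms(1)[unfolded S] that] assms(2) by (auto simp: indicator_def)
  then show ?thesis unfolding S simple_process_def prod.case by (intro sum.neutral) simp
qed

text \<open>
  The approximation in the definition of the integral, restated as convergence of real integrals over
  the product space.
\<close>

lemma has_ito_integral_approx:
  assumes "has_ito_integral M W t \<phi> Y" "0 \<le> t"
  obtains S where "\<And>j. is_simple M W t (S j)" "sq_integrable M Y"
    "(\<lambda>j. \<integral>z. (norm (simple_process (S j) (fst z) (snd z) - window 0 t \<phi> z))\<^sup>2 \<partial>\<P>) \<longlonglongrightarrow> 0"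
    "(\<lambda>j. expectation (\<lambda>\<omega>. (norm (simple_integral W (S j) \<omega> - Y \<omega>))\<^sup>2)) \<longlonglongrightarrow> 0"
proof -
  obtain S where S: "\<And>j. is_simple M W t (S j)"
    and l1: "(\<lambda>j. \<integral>\<^sup>+\<omega>. (\<integral>\<^sup>+s\<in>{0..t}. ennreal ((norm (simple_process (S j) s \<omega> - \<phi> s \<omega>))\<^sup>2) \<partial>lborel) \<partial>M) \<longlonglongrightarrow> 0"
    and l2: "(\<lambda>j. \<integral>\<^sup>+\<omega>. ennreal ((norm (simple_integral W (S j) \<omega> - Y \<omega>))\<^sup>2) \<partial>M) \<longlonglongrightarrow> 0"
    and \<phi>: "L2_prog M W t \<phi>" and Y: "Y \<in> borel_measurable M"
    using assms(1) unfolding has_ito_integral_def by blast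
  note I = sq_integrable_simple_integral[OF S] and P = sq_integrable_simple_process[OF S]
  have sY: "sq_integrable M Y" by (rule sq_integrable_limit[OF I Y l2])
  have w: "sq_integrable \<P> (window 0 t \<phi>)" using \<phi> assms(2) by (intro L2_prog_window) auto
  have eq: "window 0 t (\<lambda>r \<omega>. simple_process (S j) r \<omega> - \<phi> r \<omega>)
      = (\<lambda>z. simple_process (S j) (fst z) (snd z) - window 0 t \<phi> z)" for j
    using simple_process_support[OF S] by (auto simp: window_def indicator_def fun_eq_iff)
  have "(\<lambda>j. \<integral>\<^sup>+z. ennreal ((norm (simple_process (S j) (fst z) (snd z) - window 0 t \<phi> z))\<^sup>2) \<partial>\<P>) \<longlonglongrightarrow> 0"
    using l1 by (subst (asm) nn_integral_window)
      (simp_all only: eq sq_integrable_measurable[OF sq_integrable_diff[OF P w]])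
  then have "(\<lambda>j. \<integral>z. (norm (simple_process (S j) (fst z) (snd z) - window 0 t \<phi> z))\<^sup>2 \<partial>\<P>) \<longlonglongrightarrow> 0"
    by (rule tendsto_integral_sq_of_nn[OF sq_integrable_diff[OF P w]])
  moreover have "(\<lambda>j. expectation (\<lambda>\<omega>. (norm (simple_integral W (S j) \<omega> - Y \<omega>))\<^sup>2)) \<longlonglongrightarrow> 0"
    using l2 by (rule tendsto_integral_sq_of_nn[OF sq_integrable_diff[OF I sY]])
  ultimately show thesis using that S sY by blast
qed

text \<open>
  The integrals up to \<open>s\<close> and up to \<open>t\<close> come with unrelated approximating sequences. The bilinear
  isometry nevertheless applies to their difference, which approximates \<open>\<phi>\<close> on \<open>(s, t]\<close>. For the
  orthogonality to \<open>G\<close>, the sequence for \<open>t\<close> may be stopped at \<open>s\<close>; the stopped integrals approximate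
  the integral up to \<open>s\<close>, so nothing is left in the limit. The isometry is stated for linear
  images because the norms are later taken after applying a matrix.
\<close>

proposition ito_increment:
  fixes \<phi> :: "real \<Rightarrow> 'w \<Rightarrow> 'a::euclidean_space"
  assumes st: "0 \<le> s" "s \<le> t"
    and Y: "has_ito_integral M W s \<phi> Y" and Z: "has_ito_integral M W t \<phi> Z"
  shows "sq_integrable M (\<lambda>\<omega>. Z \<omega> - Y \<omega>)"
    and "\<And>L :: 'a \<Rightarrow> 'b::euclidean_space. bounded_linear L \<Longrightarrow>
      expectation (\<lambda>\<omega>. (norm (L (Z \<omega> - Y \<omega>)))\<^sup>2) = (\<integral>z. (norm (L (window s t \<phi> z)))\<^sup>2 \<partial>\<P>)"
    and "\<And>G. G \<in> borel_measurable (\<F> s) \<Longrightarrow> sq_integrable M G \<Longrightarrow> expectation (\<lambda>\<omega>. (Z \<omega> - Y \<omega>) \<bullet> G \<omega>) = 0"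
proof -
  have t: "0 \<le> t" using st by simp
  obtain S where S: "\<And>j. is_simple M W s (S j)" and sY: "sq_integrable M Y"
    and SP: "(\<lambda>j. \<integral>z. (norm (simple_process (S j) (fst z) (snd z) - window 0 s \<phi> z))\<^sup>2 \<partial>\<P>) \<longlonglongrightarrow> 0"
    and SI: "(\<lambda>j. expectation (\<lambda>\<omega>. (norm (simple_integral W (S j) \<omega> - Y \<omega>))\<^sup>2)) \<longlonglongrightarrow> 0"
    using has_ito_integral_approx[OF Y st(1)] by blast
  obtain R where R: "\<And>j. is_simple M W t (R j)" and sZ: "sq_integrable M Z"
    and RP: "(\<lambda>j. \<integral>z. (norm (simple_process (R j) (fst z) (snd z) - window 0 t \<phi> z))\<^sup>2 \<partial>\<P>) \<longlonglongrightarrow> 0"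
    and RI: "(\<lambda>j. expectation (\<lambda>\<omega>. (norm (simple_integral W (R j) \<omega> - Z \<omega>))\<^sup>2)) \<longlonglongrightarrow> 0"
    using has_ito_integral_approx[OF Z t] by blast
  note I = sq_integrable_simple_integral and P = sq_integrable_simple_process
  have wt: "sq_integrable \<P> (window 0 t \<phi>)" and ws: "sq_integrable \<P> (window 0 s \<phi>)"
    using L2_prog_window[of t \<phi> 0 t] L2_prog_window[of s \<phi> 0 s] Y Z st t
    by (simp_all add: has_ito_integral_def)
  define d where "d j \<omega> = simple_integral W (R j) \<omega> - simple_integral W (S j) \<omega>" for j \<omega>
  define p where "p j z = simple_process (R j) (fst z) (snd z) - simple_process (S j) (fst z) (snd z)" for j z
  have d: "sq_integrable M (d j)" for j unfolding d_def by (intro sq_integrable_diff I[OF R] I[OF S])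
  have p: "sq_integrable \<P> (p j)" for j unfolding p_def by (intro sq_integrable_diff P[OF R] P[OF S])
  show ZY: "sq_integrable M (\<lambda>\<omega>. Z \<omega> - Y \<omega>)" by (intro sq_integrable_diff sY sZ)
  have "(\<lambda>j. expectation (\<lambda>\<omega>. (norm ((simple_integral W (R j) \<omega> - Z \<omega>) - (simple_integral W (S j) \<omega> - Y \<omega>)))\<^sup>2)) \<longlonglongrightarrow> 0"
    by (intro integral_sq_diff_tendsto_zero sq_integrable_diff I[OF R] I[OF S] sZ sY RI SI)
  then have dlim: "(\<lambda>j. expectation (\<lambda>\<omega>. (norm (d j \<omega> - (Z \<omega> - Y \<omega>)))\<^sup>2)) \<longlonglongrightarrow> 0"
    by (simp add: d_def algebra_simps)
  have w: "window s t \<phi> z = window 0 t \<phi> z - window 0 s \<phi> z" for z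
    using st by (auto simp: window_def indicator_def)
  have "(\<lambda>j. \<integral>z. (norm ((simple_process (R j) (fst z) (snd z) - window 0 t \<phi> z)
      - (simple_process (S j) (fst z) (snd z) - window 0 s \<phi> z)))\<^sup>2 \<partial>\<P>) \<longlonglongrightarrow> 0"
    by (intro integral_sq_diff_tendsto_zero sq_integrable_diff P[OF R] P[OF S] wt ws RP SP)
  then have plim: "(\<lambda>j. \<integral>z. (norm (p j z - window s t \<phi> z))\<^sup>2 \<partial>\<P>) \<longlonglongrightarrow> 0"
    by (simp add: p_def w algebra_simps)
  have wst: "sq_integrable \<P> (window s t \<phi>)" by (rule sq_integrable_subwindow[OF wt]) (use st in auto)
  show "expectation (\<lambda>\<omega>. (norm (L (Z \<omega> - Y \<omega>)))\<^sup>2) = (\<integral>z. (norm (L (window s t \<phi> z)))\<^sup>2 \<partial>\<P>)"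
    if L: "bounded_linear L" for L :: "'a \<Rightarrow> 'b"
  proof -
    have "expectation (\<lambda>\<omega>. (norm (L (d j \<omega>)))\<^sup>2) = (\<integral>z. (norm (L (p j z)))\<^sup>2 \<partial>\<P>)" for j
      using simple_isometry_diff[OF is_simple_map[OF L R] is_simple_map[OF L S], of j j]
      unfolding simple_integral_map[OF L] simple_process_map[OF L] d_def p_def linear_diff[OF bounded_linear.linear[OF L]] .
    with integral_sq_linear_tendsto[OF L d ZY dlim] integral_sq_linear_tendsto[OF L p wst plim]
    show ?thesis by (simp add: LIMSEQ_unique)
  qed
  show "expectation (\<lambda>\<omega>. (Z \<omega> - Y \<omega>) \<bullet> G \<omega>) = 0"
    if G: "G \<in> borel_measurable (\<F> s)" "sq_integrable M G" for G
  proof -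
    define q where "q j \<omega> = simple_integral W (stopped_simple s (R j)) \<omega> - simple_integral W (S j) \<omega>" for j \<omega>
    note R' = is_simple_stopped[OF R st(1)]
    have q: "sq_integrable M (q j)" for j unfolding q_def by (intro sq_integrable_diff I[OF R'] I[OF S])
    define e where "e j z = indicator {..s} (fst z) *\<^sub>R (simple_process (R j) (fst z) (snd z) - window 0 t \<phi> z)" for j z
    have e: "sq_integrable \<P> (e j)" for j
    proof (rule sq_integrable_dominated[OF _ sq_integrable_diff[OF P[OF R, of j] wt], of _ 1])
      show "e j \<in> borel_measurable \<P>"
        unfolding e_def using sq_integrable_measurable[OF sq_integrable_diff[OF P[OF R, of j] wt]] by measurable
    qed (simp add: e_def indicator_def)
    have "(\<lambda>j. \<integral>z. (norm (e j z))\<^sup>2 \<partial>\<P>) \<longlonglongrightarrow> 0"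
    proof (rule tendsto_sandwich[OF _ _ tendsto_const RP])
      have "(\<integral>z. (norm (e j z))\<^sup>2 \<partial>\<P>) \<le> (\<integral>z. (norm (simple_process (R j) (fst z) (snd z) - window 0 t \<phi> z))\<^sup>2 \<partial>\<P>)" for j
        using e[of j] sq_integrable_diff[OF P[OF R, of j] wt]
        by (intro integral_mono) (auto simp: sq_integrable_def e_def indicator_def)
      then show "\<forall>\<^sub>F j in sequentially. (\<integral>z. (norm (e j z))\<^sup>2 \<partial>\<P>) \<le>
          (\<integral>z. (norm (simple_process (R j) (fst z) (snd z) - window 0 t \<phi> z))\<^sup>2 \<partial>\<P>)" by simp
    qed simp
    then have "(\<lambda>j. \<integral>z. (norm (e j z - (simple_process (S j) (fst z) (snd z) - window 0 s \<phi> z)))\<^sup>2 \<partial>\<P>) \<longlonglongrightarrow> 0"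
      by (intro integral_sq_diff_tendsto_zero e sq_integrable_diff P[OF S] ws SP)
    moreover have "e j z - (simple_process (S j) (fst z) (snd z) - window 0 s \<phi> z) =
       simple_process (stopped_simple s (R j)) (fst z) (snd z) - simple_process (S j) (fst z) (snd z)" for j z
      using st by (auto simp: e_def simple_process_stopped window_def indicator_def)
    ultimately have "(\<lambda>j. expectation (\<lambda>\<omega>. (norm (q j \<omega>))\<^sup>2)) \<longlonglongrightarrow> 0"
      by (simp only: simple_isometry_diff[OF R' S] q_def)
    from integral_inner_tendsto_zero[OF q G(2) this]
    have qG: "(\<lambda>j. expectation (\<lambda>\<omega>. q j \<omega> \<bullet> G \<omega>)) \<longlonglongrightarrow> 0" .
    have dG: "expectation (\<lambda>\<omega>. d j \<omega> \<bullet> G \<omega>) = expectation (\<lambda>\<omega>. q j \<omega> \<bullet> G \<omega>)" for j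
      using simple_integral_stopped_inner[OF R st(1) G, of j]
      by (simp add: d_def q_def inner_diff_left integrable_inner[OF I[OF R] G(2)] integrable_inner[OF I[OF R'] G(2)]
        integrable_inner[OF I[OF S] G(2)])
    have "expectation (\<lambda>\<omega>. (Z \<omega> - Y \<omega>) \<bullet> G \<omega>) =
      expectation (\<lambda>\<omega>. q j \<omega> \<bullet> G \<omega>) - expectation (\<lambda>\<omega>. (d j \<omega> - (Z \<omega> - Y \<omega>)) \<bullet> G \<omega>)" for j
      using integrable_inner[OF d G(2), of j] integrable_inner[OF ZY G(2)]
      by (simp add: dG[symmetric] inner_diff_left[of "d j _"])
    moreover have "(\<lambda>j. expectation (\<lambda>\<omega>. q j \<omega> \<bullet> G \<omega>) - expectation (\<lambda>\<omega>. (d j \<omega> - (Z \<omega> - Y \<omega>)) \<bullet> G \<omega>)) \<longlonglongrightarrow> 0 - 0"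
      by (intro tendsto_diff qG integral_inner_tendsto_zero[OF sq_integrable_diff[OF d ZY] G(2) dlim])
    ultimately have "(\<lambda>j::nat. expectation (\<lambda>\<omega>. (Z \<omega> - Y \<omega>) \<bullet> G \<omega>)) \<longlonglongrightarrow> 0"
      by simp
    then show ?thesis by (simp add: LIMSEQ_const_iff)
  qed
qed

section \<open>Energy and drift over a time window\<close>

definition energy :: "real \<Rightarrow> real \<Rightarrow> (real \<Rightarrow> 'w \<Rightarrow> 'a::euclidean_space) \<Rightarrow> real" where
  "energy s t \<phi> = (\<integral>z. (norm (window s t \<phi> z))\<^sup>2 \<partial>\<P>)"

lemma energy_nonneg: "0 \<le> energy s t \<phi>"
  by (simp add: energy_def)

lemma energy_split:
  assumes "sq_integrable \<P> (window s u \<phi>)" "s \<le> t" "t \<le> u"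
  shows "energy s u \<phi> = energy s t \<phi> + energy t u \<phi>"
proof -
  have "(norm (window s u \<phi> z))\<^sup>2 = (norm (window s t \<phi> z))\<^sup>2 + (norm (window t u \<phi> z))\<^sup>2" for z
    using assms(2,3) by (auto simp: window_def indicator_def)
  moreover have "sq_integrable \<P> (window s t \<phi>)" "sq_integrable \<P> (window t u \<phi>)"
    using assms by (auto intro: sq_integrable_subwindow[OF assms(1)])
  ultimately show ?thesis by (simp add: energy_def sq_integrable_def)
qed

lemma energy_mono:
  assumes "sq_integrable \<P> (window s t \<phi>)" "s \<le> s'" "s' \<le> t'" "t' \<le> t"
  shows "energy s' t' \<phi> \<le> energy s t \<phi>"
  using energy_split[OF assms(1,2)] energy_split[OF sq_integrable_subwindow[OF assms(1,2) order_refl] assms(3,4)]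
    energy_nonneg[of s s' \<phi>] energy_nonneg[of t' t \<phi>] assms(3,4) by simp

lemma window_linear: "linear L \<Longrightarrow> window s t (\<lambda>r \<omega>. L (\<phi> r \<omega>)) z = L (window s t \<phi> z)"
  by (simp add: window_def linear_scale)

lemma sq_integrable_window_linear:
  fixes L :: "'a::euclidean_space \<Rightarrow> 'b::euclidean_space"
  assumes "bounded_linear L" "sq_integrable \<P> (window s t \<phi>)"
  shows "sq_integrable \<P> (window s t (\<lambda>r \<omega>. L (\<phi> r \<omega>)))"
  using sq_integrable_linear[OF assms] by (simp add: window_linear[OF bounded_linear.linear[OF assms(1)], abs_def])

lemma energy_linear_le:
  fixes L :: "'a::euclidean_space \<Rightarrow> 'b::euclidean_space"
  assumes "bounded_linear L" "\<And>x. norm (L x) \<le> c * norm x" "sq_integrable \<P> (window s t \<phi>)"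
  shows "energy s t (\<lambda>r \<omega>. L (\<phi> r \<omega>)) \<le> c\<^sup>2 * energy s t \<phi>"
  unfolding energy_def window_linear[OF bounded_linear.linear[OF assms(1)]]
  by (rule integral_sq_linear_le[OF assms])

text \<open>
  Fubini: a bound on the second moment at each time bounds the energy by the length of the window.
\<close>

lemma energy_le_of_bound:
  assumes "sq_integrable \<P> (window s t \<phi>)" "s \<le> t" "0 \<le> c"
    and bnd: "\<And>r. s < r \<Longrightarrow> r \<le> t \<Longrightarrow> expectation (\<lambda>\<omega>. (norm (\<phi> r \<omega>))\<^sup>2) \<le> c"
  shows "energy s t \<phi> \<le> c * (t - s)"
proof -
  have i: "integrable \<P> (\<lambda>z. (norm (window s t \<phi> z))\<^sup>2)" using assms(1) by (simp add: sq_integrable_def)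
  have "energy s t \<phi> = (\<integral>r. expectation (\<lambda>\<omega>. (norm (window s t \<phi> (r, \<omega>)))\<^sup>2) \<partial>lborel)"
    unfolding energy_def by (rule time_space.integral_fst'[OF i, symmetric])
  also have "\<dots> \<le> (\<integral>r. c * indicator {s<..t} r \<partial>lborel)"
  proof (rule integral_mono[OF time_space.integrable_fst'[OF i]])
    show "integrable lborel (\<lambda>r. c * indicator {s<..t} r)"
      using emeasure_lborel_Ioc_finite[of s t] by (simp add: integrable_indicator_iff)
    show "expectation (\<lambda>\<omega>. (norm (window s t \<phi> (r, \<omega>)))\<^sup>2) \<le> c * indicator {s<..t} r" for r
      using bnd[of r] by (simp add: window_def indicator_def)
  qed
  also have "\<dots> = c * (t - s)" using assms(2) by simp
  finally show ?thesis .
qed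

lemma sq_integrable_window_const:
  fixes G :: "'w \<Rightarrow> 'a::euclidean_space"
  assumes "sq_integrable M G"
  shows "sq_integrable \<P> (window s t (\<lambda>_. G))"
  unfolding sq_integrable_def
proof
  have [measurable]: "G \<in> borel_measurable M" using assms by (rule sq_integrable_measurable)
  show "window s t (\<lambda>_. G) \<in> borel_measurable \<P>" unfolding window_def[abs_def] by measurable
  have "integrable \<P> (\<lambda>z. indicator {s<..t} (fst z) * (norm (G (snd z)))\<^sup>2)"
    by (rule integrable_product[of "indicator {s<..t}" "\<lambda>\<omega>. (norm (G \<omega>))\<^sup>2"])
      (use assms emeasure_lborel_Ioc_finite[of s t] in \<open>simp_all add: sq_integrable_def integrable_indicator_iff\<close>)
  moreover have "(norm (window s t (\<lambda>_. G) z))\<^sup>2 = indicator {s<..t} (fst z) * (norm (G (snd z)))\<^sup>2" for z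
    by (simp add: window_def indicator_def)
  ultimately show "integrable \<P> (\<lambda>z. (norm (window s t (\<lambda>_. G) z))\<^sup>2)" by simp
qed

definition drift :: "real \<Rightarrow> real \<Rightarrow> (real \<Rightarrow> 'w \<Rightarrow> 'a::euclidean_space) \<Rightarrow> 'w \<Rightarrow> 'a" where
  "drift s t \<phi> \<omega> = (\<integral>r. window s t \<phi> (r, \<omega>) \<partial>lborel)"

lemma drift_measurable:
  assumes "window s t \<phi> \<in> borel_measurable \<P>"
  shows "drift s t \<phi> \<in> borel_measurable M"
proof -
  have "(\<lambda>(\<omega>, r). window s t \<phi> (r, \<omega>)) \<in> borel_measurable (M \<Otimes>\<^sub>M lborel)"
    by (rule measurable_pair_swap[OF assms])
  from lborel.borel_measurable_lebesgue_integral[OF this] show ?thesis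
    by (simp only: drift_def[abs_def])
qed

lemma AE_window_section:
  fixes \<phi> :: "real \<Rightarrow> 'w \<Rightarrow> 'a::euclidean_space"
  assumes "sq_integrable \<P> (window s t \<phi>)"
  shows "AE \<omega> in M. sq_integrable lborel (\<lambda>r. window s t \<phi> (r, \<omega>)) \<and> integrable lborel (\<lambda>r. window s t \<phi> (r, \<omega>))"
proof -
  have i: "integrable \<P> (\<lambda>(r, \<omega>). (norm (window s t \<phi> (r, \<omega>)))\<^sup>2)"
    using assms by (simp add: sq_integrable_def case_prod_unfold)
  have m: "window s t \<phi> \<in> borel_measurable \<P>" using assms by (rule sq_integrable_measurable)
  from time_space.AE_integrable_snd[OF i] AE_space show ?thesis
  proof eventually_elim
    case (elim \<omega>)
    have m': "(\<lambda>r. window s t \<phi> (r, \<omega>)) \<in> borel_measurable lborel"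
      using measurable_Pair1[OF m elim(2)] by simp
    have "integrable lborel (\<lambda>r. indicator {s<..t} r + (norm (window s t \<phi> (r, \<omega>)))\<^sup>2)"
      using elim(1) emeasure_lborel_Ioc_finite[of s t] by (simp add: integrable_indicator_iff)
    then have "integrable lborel (\<lambda>r. window s t \<phi> (r, \<omega>))"
    proof (rule Bochner_Integration.integrable_bound[OF _ m'], intro AE_I2)
      fix r
      have "a \<le> 1 + a\<^sup>2" for a :: real 
        using sum_squares_bound[of a 1] zero_le_power2[of a] unfolding power_one mult_1_right by linarith
      from this[of "norm (window s t \<phi> (r, \<omega>))"]
      show "norm (window s t \<phi> (r, \<omega>)) \<le> norm (indicator {s<..t} r + (norm (window s t \<phi> (r, \<omega>)))\<^sup>2)"
        by (cases "r \<in> {s<..t}") (simp_all add: window_def)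
    qed
    then show ?case using elim(1) m' by (simp add: sq_integrable_def)
  qed
qed

text \<open>
  The Cauchy-Schwarz inequality in time, obtained by testing against the constant vector \<open>drift s t \<phi> \<omega>\<close>
  itself.
\<close>

lemma drift_norm_sq_le:
  assumes "sq_integrable lborel (\<lambda>r. window s t \<phi> (r, \<omega>))" "integrable lborel (\<lambda>r. window s t \<phi> (r, \<omega>))" "s \<le> t"
  shows "(norm (drift s t \<phi> \<omega>))\<^sup>2 \<le> (t - s) * (\<integral>r. (norm (window s t \<phi> (r, \<omega>)))\<^sup>2 \<partial>lborel)"
proof (cases "s = t")
  case True
  then show ?thesis by (simp add: drift_def window_def)
next
  case False
  then have h: "0 < t - s" using assms(3) by simp
  define v where "v = drift s t \<phi> \<omega>"
  have sq: "sq_integrable lborel (\<lambda>r. indicator {s<..t} r *\<^sub>R v)"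
  proof -
    have "(norm (indicator {s<..t} r *\<^sub>R v))\<^sup>2 = (norm v)\<^sup>2 * indicator {s<..t} r" for r
      by (simp add: indicator_def)
    then show ?thesis
      using emeasure_lborel_Ioc_finite[of s t] by (simp add: sq_integrable_def integrable_indicator_iff)
  qed
  have e: "(\<integral>r. (norm (indicator {s<..t} r *\<^sub>R v))\<^sup>2 \<partial>lborel) = (norm v)\<^sup>2 * (t - s)"
  proof -
    have "(norm (indicator {s<..t} r *\<^sub>R v))\<^sup>2 = (norm v)\<^sup>2 * indicator {s<..t} r" for r
      by (simp add: indicator_def)
    then show ?thesis using assms(3) by simp
  qed
  have "(\<integral>r. window s t \<phi> (r, \<omega>) \<bullet> (indicator {s<..t} r *\<^sub>R v) \<partial>lborel) = (\<integral>r. window s t \<phi> (r, \<omega>) \<bullet> v \<partial>lborel)"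
    by (intro Bochner_Integration.integral_cong) (auto simp: window_def indicator_def)
  also have "\<dots> = (norm v)\<^sup>2"
    using assms(2) by (simp add: v_def drift_def power2_norm_eq_inner)
  finally have "2 * (norm v)\<^sup>2 \<le> (\<integral>r. (norm (window s t \<phi> (r, \<omega>)))\<^sup>2 \<partial>lborel) / (1 / (t - s)) + (1 / (t - s)) * ((norm v)\<^sup>2 * (t - s))"
    using integral_young[OF assms(1) sq, of "1 / (t - s)"] h unfolding e by simp
  then show ?thesis using h by (simp add: v_def mult.commute)
qed

lemma
  fixes \<phi> :: "real \<Rightarrow> 'w \<Rightarrow> 'a::euclidean_space"
  assumes w: "sq_integrable \<P> (window s t \<phi>)" and st: "s \<le> t"
  shows sq_integrable_drift: "sq_integrable M (drift s t \<phi>)"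
    and drift_energy: "expectation (\<lambda>\<omega>. (norm (drift s t \<phi> \<omega>))\<^sup>2) \<le> (t - s) * energy s t \<phi>"
proof -
  have i: "integrable \<P> (\<lambda>(r, \<omega>). (norm (window s t \<phi> (r, \<omega>)))\<^sup>2)"
    using w by (simp add: sq_integrable_def case_prod_unfold)
  let ?q = "\<lambda>\<omega>. (t - s) * (\<integral>r. (norm (window s t \<phi> (r, \<omega>)))\<^sup>2 \<partial>lborel)"
  have q: "integrable M ?q" using time_space.integrable_snd[OF i] by simp
  have m: "drift s t \<phi> \<in> borel_measurable M" using w by (intro drift_measurable sq_integrable_measurable)
  have ae: "AE \<omega> in M. (norm (drift s t \<phi> \<omega>))\<^sup>2 \<le> ?q \<omega>"
    using AE_window_section[OF w] by eventually_elim (simp add: drift_norm_sq_le st)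
  then have "AE \<omega> in M. norm ((norm (drift s t \<phi> \<omega>))\<^sup>2) \<le> norm (?q \<omega>)"
    by eventually_elim simp
  from Bochner_Integration.integrable_bound[OF q _ this] m
  show sq: "sq_integrable M (drift s t \<phi>)" by (simp add: sq_integrable_def)
  have "expectation (\<lambda>\<omega>. (norm (drift s t \<phi> \<omega>))\<^sup>2) \<le> expectation ?q"
    using sq q ae by (intro integral_mono_AE) (auto simp: sq_integrable_def)
  also have "\<dots> = (t - s) * energy s t \<phi>"
    using time_space.integral_snd[OF i] by (simp add: energy_def case_prod_unfold)
  finally show "expectation (\<lambda>\<omega>. (norm (drift s t \<phi> \<omega>))\<^sup>2) \<le> (t - s) * energy s t \<phi>" .
qed

lemma drift_inner:
  fixes G :: "'w \<Rightarrow> 'a::euclidean_space"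
  assumes w: "sq_integrable \<P> (window s t \<phi>)" and G: "sq_integrable M G"
  shows "expectation (\<lambda>\<omega>. G \<omega> \<bullet> drift s t \<phi> \<omega>) = (\<integral>z. window s t (\<lambda>_. G) z \<bullet> window s t \<phi> z \<partial>\<P>)"
proof -
  have m: "window s t \<phi> \<in> borel_measurable \<P>" using w by (rule sq_integrable_measurable)
  have Gm: "G \<in> borel_measurable M" using G by (rule sq_integrable_measurable)
  have i: "integrable \<P> (\<lambda>(r, \<omega>). window s t (\<lambda>_. G) (r, \<omega>) \<bullet> window s t \<phi> (r, \<omega>))"
    using integrable_inner[OF sq_integrable_window_const[OF G, of s t] w] by (simp add: case_prod_unfold)
  have "(\<integral>z. window s t (\<lambda>_. G) z \<bullet> window s t \<phi> z \<partial>\<P>)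
      = expectation (\<lambda>\<omega>. \<integral>r. window s t (\<lambda>_. G) (r, \<omega>) \<bullet> window s t \<phi> (r, \<omega>) \<partial>lborel)"
    using time_space.integral_snd[OF i] by (simp add: case_prod_unfold)
  also have "\<dots> = expectation (\<lambda>\<omega>. G \<omega> \<bullet> drift s t \<phi> \<omega>)"
  proof (rule integral_cong_AE)
    show "(\<lambda>\<omega>. \<integral>r. window s t (\<lambda>_. G) (r, \<omega>) \<bullet> window s t \<phi> (r, \<omega>) \<partial>lborel) \<in> borel_measurable M"
      using time_space.integrable_snd[OF i] by (rule borel_measurable_integrable)
    show "(\<lambda>\<omega>. G \<omega> \<bullet> drift s t \<phi> \<omega>) \<in> borel_measurable M" using Gm drift_measurable[OF m] by measurable
    show "AE \<omega> in M. (\<integral>r. window s t (\<lambda>_. G) (r, \<omega>) \<bullet> window s t \<phi> (r, \<omega>) \<partial>lborel) = G \<omega> \<bullet> drift s t \<phi> \<omega>"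
      using AE_window_section[OF w]
    proof eventually_elim
      case (elim \<omega>)
      have "(\<integral>r. window s t (\<lambda>_. G) (r, \<omega>) \<bullet> window s t \<phi> (r, \<omega>) \<partial>lborel) = (\<integral>r. G \<omega> \<bullet> window s t \<phi> (r, \<omega>) \<partial>lborel)"
        by (intro Bochner_Integration.integral_cong) (auto simp: window_def indicator_def)
      then show ?case using elim by (simp add: drift_def)
    qed
  qed
  finally show ?thesis by simp
qed

lemma drift_linear_AE:
  fixes L :: "'a::euclidean_space \<Rightarrow> 'b::euclidean_space"
  assumes L: "bounded_linear L" and w: "sq_integrable \<P> (window s t \<phi>)"
  shows "AE \<omega> in M. drift s t (\<lambda>r \<omega>. L (\<phi> r \<omega>)) \<omega> = L (drift s t \<phi> \<omega>)"
  using AE_window_section[OF w]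
  by eventually_elim
    (simp add: drift_def window_linear[OF bounded_linear.linear[OF L]] integral_bounded_linear[OF L])

lemma drift_split_AE:
  assumes w: "sq_integrable \<P> (window s u \<phi>)" and "s \<le> t" "t \<le> u"
  shows "AE \<omega> in M. drift s u \<phi> \<omega> = drift s t \<phi> \<omega> + drift t u \<phi> \<omega>"
proof -
  have "sq_integrable \<P> (window s t \<phi>)" "sq_integrable \<P> (window t u \<phi>)"
    using assms by (auto intro: sq_integrable_subwindow[OF w])
  from this[THEN AE_window_section] show ?thesis
  proof eventually_elim
    case (elim \<omega>)
    have "window s u \<phi> (r, \<omega>) = window s t \<phi> (r, \<omega>) + window t u \<phi> (r, \<omega>)" for r
      using assms(2,3) by (auto simp: window_def indicator_def)
    then show ?case using elim by (simp add: drift_def)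
  qed
qed

lemma LBINT_eq_drift:
  assumes w: "window 0 t \<phi> \<in> borel_measurable \<P>" and \<omega>: "\<omega> \<in> space M"
  shows "(LBINT r:{0..t}. \<phi> r \<omega>) = drift 0 t \<phi> \<omega>"
  unfolding set_lebesgue_integral_def drift_def
proof (rule integral_cong_AE)
  have m: "(\<lambda>r. window 0 t \<phi> (r, \<omega>)) \<in> borel_measurable lborel"
    using measurable_Pair1[OF w \<omega>] by simp
  then show "(\<lambda>r. window 0 t \<phi> (r, \<omega>)) \<in> borel_measurable lborel" .
  have "(\<lambda>r. if r = 0 then indicator {0..t} 0 *\<^sub>R \<phi> 0 \<omega> else window 0 t \<phi> (r, \<omega>)) \<in> borel_measurable lborel"
    using m by measurable
  moreover have "(\<lambda>r. if r = 0 then indicator {0..t} 0 *\<^sub>R \<phi> 0 \<omega> else window 0 t \<phi> (r, \<omega>)) = (\<lambda>r. indicator {0..t} r *\<^sub>R \<phi> r \<omega>)"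
    by (auto simp: fun_eq_iff window_def indicator_def)
  ultimately show "(\<lambda>r. indicator {0..t} r *\<^sub>R \<phi> r \<omega>) \<in> borel_measurable lborel" by simp
  show "AE r in lborel. indicator {0..t} r *\<^sub>R \<phi> r \<omega> = window 0 t \<phi> (r, \<omega>)"
    using AE_lborel_singleton[of 0] by eventually_elim (auto simp: window_def indicator_def)
qed

section \<open>It\^o processes\<close>

lemma ito_process_sq_integrable:
  assumes X: "is_ito_process M W T x b \<sigma> X" and t: "t \<in> {0..T}"
  shows "X t \<in> borel_measurable (\<F> t)" "sq_integrable M (X t)"
proof -
  have "(\<lambda>(s, \<omega>). X s \<omega>) \<in> borel_measurable (restrict_space borel {0..t} \<Otimes>\<^sub>M \<F> t)"
    using X t by (simp add: is_ito_process_def L2_prog_def progressive_def)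
  from measurable_Pair2[OF this, of t] t
  show m: "X t \<in> borel_measurable (\<F> t)" by (simp add: space_restrict_space)
  obtain Y where Y: "has_ito_integral M W t \<sigma> Y" "AE \<omega> in M. X t \<omega> = x + (LBINT s:{0..t}. b s \<omega>) + Y \<omega>"
    using X t unfolding is_ito_process_def by blast
  have sY: "sq_integrable M Y" using has_ito_integral_approx[OF Y(1)] t by auto
  have b: "L2_prog M W T b" using X by (simp add: is_ito_process_def)
  have w: "sq_integrable \<P> (window 0 t b)" using t by (intro L2_prog_window[OF b]) auto
  show "sq_integrable M (X t)"
  proof (rule sq_integrable_cong_AE)
    show "sq_integrable M (\<lambda>\<omega>. x + drift 0 t b \<omega> + Y \<omega>)"
      using t by (intro sq_integrable_add sY sq_integrable_drift[OF w]) (auto simp: sq_integrable_def)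
    show "X t \<in> borel_measurable M" using measurable_aug_filtration_imp[OF _ m] t by simp
    show "AE \<omega> in M. x + drift 0 t b \<omega> + Y \<omega> = X t \<omega>"
      using Y(2) AE_space
      by eventually_elim (simp add: LBINT_eq_drift[OF sq_integrable_measurable[OF w]])
  qed
qed

text \<open>
  The only interface to the stochastic integral in what follows: over a window, an It\^o process moves by
  its drift and by a term that satisfies the isometry and is orthogonal to the past.
\<close>

lemma ito_process_increment:
  fixes X :: "real \<Rightarrow> 'w \<Rightarrow> 'a::euclidean_space"
  assumes X: "is_ito_process M W T x b \<sigma> X" and st: "0 \<le> s" "s \<le> t" "t \<le> T"
  obtains I where "AE \<omega> in M. X t \<omega> = X s \<omega> + drift s t b \<omega> + I \<omega>" "sq_integrable M I"
    "\<And>L :: 'a \<Rightarrow> 'a. bounded_linear L \<Longrightarrow> expectation (\<lambda>\<omega>. (norm (L (I \<omega>)))\<^sup>2) = energy s t (\<lambda>r \<omega>. L (\<sigma> r \<omega>))"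
    "\<And>G. G \<in> borel_measurable (\<F> s) \<Longrightarrow> sq_integrable M G \<Longrightarrow> expectation (\<lambda>\<omega>. I \<omega> \<bullet> G \<omega>) = 0"
proof -
  have ex: "\<exists>Y. has_ito_integral M W r \<sigma> Y \<and> (AE \<omega> in M. X r \<omega> = x + (LBINT s:{0..r}. b s \<omega>) + Y \<omega>)"
    if "r \<in> {0..T}" for r
    using X that unfolding is_ito_process_def by blast
  obtain Y where Y: "has_ito_integral M W s \<sigma> Y" "AE \<omega> in M. X s \<omega> = x + (LBINT r:{0..s}. b r \<omega>) + Y \<omega>"
    using ex[of s] st by auto
  obtain Z where Z: "has_ito_integral M W t \<sigma> Z" "AE \<omega> in M. X t \<omega> = x + (LBINT r:{0..t}. b r \<omega>) + Z \<omega>"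
    using ex[of t] st by auto
  have b: "L2_prog M W T b" using X by (simp add: is_ito_process_def)
  have w: "sq_integrable \<P> (window 0 t b)" "sq_integrable \<P> (window 0 s b)"
    using st by (auto intro: L2_prog_window[OF b])
  note inc = ito_increment[OF st(1,2) Y(1) Z(1)]
  show thesis
  proof
    show "AE \<omega> in M. X t \<omega> = X s \<omega> + drift s t b \<omega> + (Z \<omega> - Y \<omega>)"
      using Y(2) Z(2) AE_space drift_split_AE[OF w(1) st(1,2)]
      by eventually_elim
        (simp add: LBINT_eq_drift[OF sq_integrable_measurable[OF w(1)]] LBINT_eq_drift[OF sq_integrable_measurable[OF w(2)]])
    show "expectation (\<lambda>\<omega>. (norm (L (Z \<omega> - Y \<omega>)))\<^sup>2) = energy s t (\<lambda>r \<omega>. L (\<sigma> r \<omega>))"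
      if "bounded_linear L" for L :: "'a \<Rightarrow> 'a"
      using inc(2)[OF that] by (simp add: energy_def window_linear[OF bounded_linear.linear[OF that]])
  qed (use inc(1,3) in auto)
qed

lemma ito_process_modulus:
  fixes X :: "real \<Rightarrow> 'w \<Rightarrow> 'a::euclidean_space"
  assumes X: "is_ito_process M W T x b \<sigma> X" and st: "0 \<le> s" "s \<le> t" "t \<le> T"
  shows "expectation (\<lambda>\<omega>. (norm (X s \<omega> - X t \<omega>))\<^sup>2) \<le> 2 * (t - s) * energy s t b + 2 * energy s t \<sigma>"
proof -
  obtain I where I: "AE \<omega> in M. X t \<omega> = X s \<omega> + drift s t b \<omega> + I \<omega>" "sq_integrable M I"
    and iso: "\<And>L :: 'a \<Rightarrow> 'a. bounded_linear L \<Longrightarrow>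
      expectation (\<lambda>\<omega>. (norm (L (I \<omega>)))\<^sup>2) = energy s t (\<lambda>r \<omega>. L (\<sigma> r \<omega>))"
    and "\<And>G. G \<in> borel_measurable (\<F> s) \<Longrightarrow> sq_integrable M G \<Longrightarrow> expectation (\<lambda>\<omega>. I \<omega> \<bullet> G \<omega>) = 0"
    by (rule ito_process_increment[OF X st]) (rule that)
  have w: "sq_integrable \<P> (window s t b)"
    using X st by (intro L2_prog_window[of T]) (auto simp: is_ito_process_def)
  have Xm: "X t \<in> borel_measurable M" "X s \<in> borel_measurable M"
    using ito_process_sq_integrable(2)[OF X] st by (auto intro!: sq_integrable_measurable)
  have Dm: "drift s t b \<in> borel_measurable M" "I \<in> borel_measurable M"
    using sq_integrable_drift[OF w st(2)] I(2) by (auto dest: sq_integrable_measurable)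
  have "expectation (\<lambda>\<omega>. (norm (X s \<omega> - X t \<omega>))\<^sup>2) = expectation (\<lambda>\<omega>. (norm (drift s t b \<omega> + I \<omega>))\<^sup>2)"
  proof (rule integral_cong_AE)
    show "AE \<omega> in M. (norm (X s \<omega> - X t \<omega>))\<^sup>2 = (norm (drift s t b \<omega> + I \<omega>))\<^sup>2"
      using I(1)
    proof eventually_elim
      case (elim \<omega>)
      then have "X s \<omega> - X t \<omega> = - (drift s t b \<omega> + I \<omega>)" by simp
      then show ?case by (simp only: norm_minus_cancel)
    qed
  qed (use Xm Dm in measurable)
  also have "\<dots> \<le> 2 * expectation (\<lambda>\<omega>. (norm (drift s t b \<omega>))\<^sup>2) + 2 * expectation (\<lambda>\<omega>. (norm (I \<omega>))\<^sup>2)"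
    by (rule integral_sq_add_le[OF sq_integrable_drift[OF w st(2)] I(2)])
  also have "\<dots> \<le> 2 * (t - s) * energy s t b + 2 * energy s t \<sigma>"
    using drift_energy[OF w st(2)] iso[OF bounded_linear_ident] by (simp only: mult.assoc)
  finally show ?thesis .
qed

text \<open>
  All simple processes on \<open>[0, 0]\<close> vanish, and so does the integral by the isometry.
\<close>

lemma ito_process_initial:
  fixes X :: "real \<Rightarrow> 'w \<Rightarrow> 'a::euclidean_space"
  assumes X: "is_ito_process M W T x b \<sigma> X" and T: "0 \<le> T"
  shows "AE \<omega> in M. X 0 \<omega> = x"
proof -
  obtain Y where Y: "has_ito_integral M W 0 \<sigma> Y" "AE \<omega> in M. X 0 \<omega> = x + (LBINT r:{0..0}. b r \<omega>) + Y \<omega>"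
    using X T unfolding is_ito_process_def by force
  obtain S where S: "\<And>j. is_simple M W 0 (S j)" and sY: "sq_integrable M Y"
    and lim: "(\<lambda>j. expectation (\<lambda>\<omega>. (norm (simple_integral W (S j) \<omega> - Y \<omega>))\<^sup>2)) \<longlonglongrightarrow> 0"
    using has_ito_integral_approx[OF Y(1)] by auto
  have "expectation (\<lambda>\<omega>. (norm (simple_integral W (S j) \<omega>))\<^sup>2) = 0" for j
    using simple_isometry_inner[OF S[of j] S[of j]]
    by (simp add: simple_process_support[OF S] power2_norm_eq_inner)
  with integral_sq_tendsto[OF sq_integrable_simple_integral[OF S] sY lim]
  have "expectation (\<lambda>\<omega>. (norm (Y \<omega>))\<^sup>2) = 0" by (simp add: LIMSEQ_const_iff)
  then have Y0: "AE \<omega> in M. (norm (Y \<omega>))\<^sup>2 = 0"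
    using sY by (subst (asm) integral_nonneg_eq_0_iff_AE) (auto simp: sq_integrable_def)
  have w: "sq_integrable \<P> (window 0 0 b)"
    using X T by (intro L2_prog_window[of T]) (auto simp: is_ito_process_def)
  have zero: "(LBINT r:{0..0}. b r \<omega>) = 0" if "\<omega> \<in> space M" for \<omega>
    using LBINT_eq_drift[OF sq_integrable_measurable[OF w] that] by (simp add: drift_def window_def)
  from Y(2) Y0 AE_space show ?thesis by eventually_elim (simp only: zero, simp)
qed

section \<open>Uniqueness backward in time\<close>

text \<open>
  Let \<open>U = S X\<close>. Since \<open>U t = 0\<close>, the sum of \<open>U r\<close> and the martingale part over \<open>(r, t]\<close> is minus the
  drift part. The two summands are orthogonal, so the second moment of \<open>U r\<close> plus the energy of \<open>S \<sigma>\<close>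
  is at most \<open>t - r\<close> times the energy of the drift, by the Cauchy-Schwarz inequality in time. On a short
  window the energy of \<open>S \<sigma>\<close> on the right is absorbed on the left, and integrating what remains over \<open>r\<close>
  bounds the energy of \<open>U\<close> by half of itself.
\<close>

lemma backward_uniqueness_step:
  fixes X :: "real \<Rightarrow> 'w \<Rightarrow> 'a::euclidean_space" and S :: "'a \<Rightarrow> 'a"
  assumes X: "is_ito_process M W T x b \<sigma> X" and S: "bounded_linear S" and c: "0 \<le> c"
    and bnd: "\<And>r \<omega>. norm (S (b r \<omega>)) \<le> c * (norm (S (X r \<omega>)) + norm (S (\<sigma> r \<omega>)))"
    and st: "0 \<le> s" "s \<le> t" "t \<le> T" and short: "t - s \<le> 1" "4 * c\<^sup>2 * (t - s) \<le> 1"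
    and terminal: "AE \<omega> in M. S (X t \<omega>) = 0"
  shows "AE \<omega> in M. S (X s \<omega>) = 0"
proof -
  define U where "U r \<omega> = S (X r \<omega>)" for r \<omega>
  note lin = bounded_linear.linear[OF S]
  have T: "0 \<le> T" using st by simp
  have wX: "sq_integrable \<P> (window r t X)" and wb: "sq_integrable \<P> (window r t b)"
    and w\<sigma>: "sq_integrable \<P> (window r t \<sigma>)" if "s \<le> r" for r
    using X st that by (auto simp: is_ito_process_def intro!: L2_prog_window[of T])
  have wU: "sq_integrable \<P> (window r t U)" if "s \<le> r" for r
    unfolding U_def[abs_def] by (rule sq_integrable_window_linear[OF S wX[OF that]])
  \<comment> \<open>The right-hand side does not depend on \<open>r\<close>, so this estimate can be integrated over the window.\<close>
  have key: "expectation (\<lambda>\<omega>. (norm (U r \<omega>))\<^sup>2) \<le> energy s t U / 2" if r: "s \<le> r" "r \<le> t" for r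
  proof -
    have rt: "0 \<le> r" "r \<le> t" "t \<le> T" using r st by auto
    obtain I where I: "AE \<omega> in M. X t \<omega> = X r \<omega> + drift r t b \<omega> + I \<omega>" "sq_integrable M I"
      and iso: "\<And>L :: 'a \<Rightarrow> 'a. bounded_linear L \<Longrightarrow>
        expectation (\<lambda>\<omega>. (norm (L (I \<omega>)))\<^sup>2) = energy r t (\<lambda>r \<omega>. L (\<sigma> r \<omega>))"
      and orth: "\<And>G. G \<in> borel_measurable (\<F> r) \<Longrightarrow> sq_integrable M G \<Longrightarrow> expectation (\<lambda>\<omega>. I \<omega> \<bullet> G \<omega>) = 0"
      by (rule ito_process_increment[OF X rt]) (rule that)
    define D where "D = drift r t (\<lambda>r \<omega>. S (b r \<omega>))"
    have wSb: "sq_integrable \<P> (window r t (\<lambda>r \<omega>. S (b r \<omega>)))"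
      by (rule sq_integrable_window_linear[OF S wb[OF r(1)]])
    have wS\<sigma>: "sq_integrable \<P> (window r t (\<lambda>r \<omega>. S (\<sigma> r \<omega>)))"
      by (rule sq_integrable_window_linear[OF S w\<sigma>[OF r(1)]])
    have sD: "sq_integrable M D" unfolding D_def by (rule sq_integrable_drift[OF wSb r(2)])
    have Xr: "X r \<in> borel_measurable (\<F> r)" "sq_integrable M (X r)"
      using ito_process_sq_integrable[OF X, of r] rt by auto
    have sU: "sq_integrable M (U r)" unfolding U_def by (rule sq_integrable_linear[OF S Xr(2)])
    have sI: "sq_integrable M (\<lambda>\<omega>. S (I \<omega>))" by (rule sq_integrable_linear[OF S I(2)])
    have cross: "expectation (\<lambda>\<omega>. U r \<omega> \<bullet> S (I \<omega>)) = 0"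
    proof -
      \<comment> \<open>Moving \<open>S\<close> to the other side of the inner product exhibits the cross term as a pairing of the
         martingale part with an \<open>\<F>\<^sub>r\<close>-measurable vector.\<close>
      have A: "bounded_linear (\<lambda>v. adjoint S (S v))"
        using linear_compose[OF lin adjoint_linear[OF lin]] by (simp add: linear_conv_bounded_linear comp_def)
      have "expectation (\<lambda>\<omega>. I \<omega> \<bullet> adjoint S (S (X r \<omega>))) = 0"
        by (rule orth[OF borel_measurable_continuous_on[OF linear_continuous_on[OF A] Xr(1)] sq_integrable_linear[OF A Xr(2)]])
      then show ?thesis by (simp add: adjoint_works[OF lin] U_def inner_commute)
    qed
    have "AE \<omega> in M. U r \<omega> + S (I \<omega>) = - D \<omega>"
      using I(1) terminal drift_linear_AE[OF S wb[OF r(1)]]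
    proof eventually_elim
      case (elim \<omega>)
      have "S (X r \<omega>) + S (drift r t b \<omega>) + S (I \<omega>) = 0"
        using elim(2) unfolding elim(1) by (simp add: linear_add[OF lin])
      then show ?case using elim(3) by (simp add: U_def D_def eq_neg_iff_add_eq_0 algebra_simps)
    qed
    then have "expectation (\<lambda>\<omega>. (norm (U r \<omega> + S (I \<omega>)))\<^sup>2) = expectation (\<lambda>\<omega>. (norm (D \<omega>))\<^sup>2)"
      using sU sI sD by (intro integral_cong_AE) (auto dest: sq_integrable_measurable elim!: eventually_mono)
    then have eq: "expectation (\<lambda>\<omega>. (norm (U r \<omega>))\<^sup>2) + energy r t (\<lambda>r \<omega>. S (\<sigma> r \<omega>)) = expectation (\<lambda>\<omega>. (norm (D \<omega>))\<^sup>2)"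
      using integral_sq_add[OF sU sI] cross iso[OF S] by simp
    have h: "0 \<le> t - r" "t - r \<le> t - s" using r by auto
    have "expectation (\<lambda>\<omega>. (norm (D \<omega>))\<^sup>2) \<le> (t - r) * energy r t (\<lambda>r \<omega>. S (b r \<omega>))"
      unfolding D_def by (rule drift_energy[OF wSb r(2)])
    also have "\<dots> \<le> (t - r) * (2 * c\<^sup>2 * (energy r t U + energy r t (\<lambda>r \<omega>. S (\<sigma> r \<omega>))))"
    proof (rule mult_left_mono[OF _ h(1)])
      let ?w = "\<lambda>\<phi>. window r t \<phi>"
      have "(norm (?w (\<lambda>r \<omega>. S (b r \<omega>)) z))\<^sup>2
          \<le> 2 * c\<^sup>2 * ((norm (?w U z))\<^sup>2 + (norm (?w (\<lambda>r \<omega>. S (\<sigma> r \<omega>)) z))\<^sup>2)" for z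
      proof (cases "fst z \<in> {r<..t}")
        case True
        define p q where "p = norm (S (X (fst z) (snd z)))" and "q = norm (S (\<sigma> (fst z) (snd z)))"
        have "(norm (S (b (fst z) (snd z))))\<^sup>2 \<le> (c * (p + q))\<^sup>2"
          unfolding p_def q_def by (rule power_mono[OF bnd norm_ge_zero])
        also have "\<dots> \<le> c\<^sup>2 * (2 * (p\<^sup>2 + q\<^sup>2))"
          unfolding power_mult_distrib
          using sum_squares_bound[of p q] by (intro mult_left_mono) (simp_all add: power2_sum)
        also have "\<dots> = 2 * c\<^sup>2 * (p\<^sup>2 + q\<^sup>2)" by simp
        finally show ?thesis using True by (simp only: window_def p_def q_def U_def indicator_simps scaleR_one)
      qed (simp add: window_def)
      then have "energy r t (\<lambda>r \<omega>. S (b r \<omega>)) \<le>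
          (\<integral>z. 2 * c\<^sup>2 * ((norm (?w U z))\<^sup>2 + (norm (?w (\<lambda>r \<omega>. S (\<sigma> r \<omega>)) z))\<^sup>2) \<partial>\<P>)"
        unfolding energy_def using wSb wU[OF r(1)] wS\<sigma> by (intro integral_mono) (auto simp: sq_integrable_def)
      also have "\<dots> = 2 * c\<^sup>2 * (energy r t U + energy r t (\<lambda>r \<omega>. S (\<sigma> r \<omega>)))"
        using wU[OF r(1)] wS\<sigma> by (simp add: energy_def sq_integrable_def)
      finally show "energy r t (\<lambda>r \<omega>. S (b r \<omega>)) \<le> 2 * c\<^sup>2 * (energy r t U + energy r t (\<lambda>r \<omega>. S (\<sigma> r \<omega>)))" .
    qed
    also have "\<dots> = (4 * c\<^sup>2 * (t - r)) * (energy r t U + energy r t (\<lambda>r \<omega>. S (\<sigma> r \<omega>))) / 2"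
      by (simp add: algebra_simps)
    also have "\<dots> \<le> 1 * (energy r t U + energy r t (\<lambda>r \<omega>. S (\<sigma> r \<omega>))) / 2"
    proof (intro divide_right_mono mult_right_mono add_nonneg_nonneg energy_nonneg)
      show "4 * c\<^sup>2 * (t - r) \<le> 1"
        using mult_left_mono[OF h(2), of "4 * c\<^sup>2"] short(2) by simp
    qed simp
    finally have "expectation (\<lambda>\<omega>. (norm (U r \<omega>))\<^sup>2) \<le> energy r t U / 2"
      using eq energy_nonneg[of r t "\<lambda>r \<omega>. S (\<sigma> r \<omega>)"] by simp
    also have "\<dots> \<le> energy s t U / 2"
      using energy_mono[OF wU[OF order_refl] r(1,2) order_refl] by simp
    finally show ?thesis .
  qed
  have "energy s t U \<le> energy s t U / 2 * (t - s)"
    by (rule energy_le_of_bound[OF wU[OF order_refl] st(2)]) (use key energy_nonneg in auto)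
  also have "\<dots> \<le> energy s t U / 2 * 1"
    using short(1) energy_nonneg[of s t U] by (intro mult_left_mono) auto
  finally have "energy s t U = 0" using energy_nonneg[of s t U] by simp
  then have "expectation (\<lambda>\<omega>. (norm (U s \<omega>))\<^sup>2) = 0"
    using key[OF order_refl st(2)] by (intro antisym) simp_all
  moreover have "sq_integrable M (U s)"
    unfolding U_def using ito_process_sq_integrable(2)[OF X, of s] st by (intro sq_integrable_linear[OF S]) auto
  ultimately have "AE \<omega> in M. (norm (U s \<omega>))\<^sup>2 = 0"
    by (subst (asm) integral_nonneg_eq_0_iff_AE) (auto simp: sq_integrable_def)
  then show ?thesis by (auto simp: U_def elim!: eventually_mono)
qed

text \<open>
  The length of the windows in the preceding lemma depends on \<open>c\<close> alone, so finitely many of them lead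
  from \<open>T\<close> back to \<open>0\<close>.
\<close>

proposition backward_uniqueness:
  fixes X :: "real \<Rightarrow> 'w \<Rightarrow> 'a::euclidean_space" and S :: "'a \<Rightarrow> 'a"
  assumes X: "is_ito_process M W T x b \<sigma> X" and S: "bounded_linear S" and c: "0 \<le> c"
    and bnd: "\<And>r \<omega>. norm (S (b r \<omega>)) \<le> c * (norm (S (X r \<omega>)) + norm (S (\<sigma> r \<omega>)))"
    and T: "0 \<le> T" and terminal: "AE \<omega> in M. S (X T \<omega>) = 0"
  shows "S x = 0"
proof -
  \<comment> \<open>Chosen to meet both length conditions of the preceding lemma; \<open>c\<^sup>2 + 1\<close> in place of \<open>c\<^sup>2\<close>
     avoids division by zero.\<close>
  define h where "h = min 1 (1 / (4 * (c\<^sup>2 + 1)))"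
  have c1: "0 < c\<^sup>2 + 1" by (rule add_nonneg_pos) simp_all
  then have h: "0 < h" "h \<le> 1" by (auto simp: h_def)
  have "4 * c\<^sup>2 * h \<le> 4 * (c\<^sup>2 + 1) * h" using h by (intro mult_right_mono) auto
  also have "\<dots> \<le> 4 * (c\<^sup>2 + 1) * (1 / (4 * (c\<^sup>2 + 1)))" using c1 by (intro mult_left_mono) (auto simp: h_def)
  also have "\<dots> = 1" using c1 by simp
  finally have hc: "4 * c\<^sup>2 * h \<le> 1" .
  have "AE \<omega> in M. S (X (max 0 (T - real k * h)) \<omega>) = 0" for k
  proof (induction k)
    case 0
    then show ?case using terminal T by simp
  next
    case (Suc k)
    let ?s = "max 0 (T - real (Suc k) * h)" and ?t = "max 0 (T - real k * h)"
    have st: "0 \<le> ?s" "?s \<le> ?t" "?t \<le> T" "?t - ?s \<le> h" using h T by (auto simp: algebra_simps)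
    have "4 * c\<^sup>2 * (?t - ?s) \<le> 4 * c\<^sup>2 * h" by (intro mult_left_mono st(4)) simp
    then show ?case
      using h hc st by (intro backward_uniqueness_step[OF X S c bnd st(1-3) _ _ Suc]) linarith+
  qed
  moreover obtain k :: nat where "T / h \<le> real k" using real_arch_simple by blast
  then have "max 0 (T - real k * h) = 0" using h by (simp add: field_simps)
  ultimately have "AE \<omega> in M. S (X 0 \<omega>) = 0" by metis
  with ito_process_initial[OF X T] have "AE \<omega> in M. S x = 0" by eventually_elim simp
  then show ?thesis by simp
qed

section \<open>Decrease of a quadratic Lyapunov function\<close>

text \<open>
  Write \<open>X t\<close> as the sum of \<open>X s\<close>, a drift \<open>D\<close> and a martingale part \<open>I\<close>, and expand the quadratic form.
  The product of \<open>X s\<close> with \<open>I\<close> has mean zero. The product of \<open>X s\<close> with \<open>D\<close>, after replacing \<open>X s\<close> by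
  the running value \<open>X r\<close> under the time integral, combines with the square of \<open>I\<close> to the generator,
  which is controlled by the decay condition. All other terms are bounded by a multiple of \<open>\<epsilon>\<close> or of the
  window length times the energy of \<open>X\<close>; the replacement error is of this kind because \<open>X\<close> moves little on a short
  window. The estimate involves \<open>X\<close> only through its energy on the window, which makes it uniform in the
  position of the window.
\<close>

lemma lyapunov_increment:
  fixes X :: "real \<Rightarrow> 'w \<Rightarrow> 'a::euclidean_space" and A K P :: "'a \<Rightarrow> 'a"
  assumes X: "is_ito_process M W T x (\<lambda>r \<omega>. A (X r \<omega>)) (\<lambda>r \<omega>. K (X r \<omega>)) X"
    and A: "bounded_linear A" "\<And>x. norm (A x) \<le> a * norm x"
    and K: "bounded_linear K" "\<And>x. norm (K x) \<le> k * norm x"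
    and P: "bounded_linear P" "0 \<le> p" "\<And>x. norm (P x) \<le> p * norm x" "\<And>x y. P x \<bullet> y = x \<bullet> P y"
    and decay: "\<And>x. 2 * (P x \<bullet> A x) + K x \<bullet> P (K x) \<le> - \<delta> * (norm x)\<^sup>2"
    and st: "0 \<le> s" "s \<le> t" "t \<le> T" "t - s \<le> 1" and \<epsilon>: "0 < \<epsilon>"
  shows "expectation (\<lambda>\<omega>. X t \<omega> \<bullet> P (X t \<omega>)) \<le> expectation (\<lambda>\<omega>. X s \<omega> \<bullet> P (X s \<omega>))
    + (- \<delta> + \<epsilon> * (a\<^sup>2 + k\<^sup>2) + (t - s) * (p\<^sup>2 * (2 * a\<^sup>2 + 2 * k\<^sup>2) / \<epsilon> + p * a\<^sup>2 + p\<^sup>2 * a\<^sup>2 / \<epsilon>)) * energy s t X"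
proof -
  define e where "e = energy s t X"
  define h where "h = t - s"
  have h: "0 \<le> h" "h \<le> 1" and e: "0 \<le> e" using st by (auto simp: h_def e_def energy_nonneg)
  let ?b = "\<lambda>r \<omega>. A (X r \<omega>)" and ?\<sigma> = "\<lambda>r \<omega>. K (X r \<omega>)"
  note linA = bounded_linear.linear[OF A(1)] and linK = bounded_linear.linear[OF K(1)]
    and linP = bounded_linear.linear[OF P(1)]
  obtain I where I: "AE \<omega> in M. X t \<omega> = X s \<omega> + drift s t ?b \<omega> + I \<omega>" "sq_integrable M I"
    and iso: "\<And>L :: 'a \<Rightarrow> 'a. bounded_linear L \<Longrightarrow>
      expectation (\<lambda>\<omega>. (norm (L (I \<omega>)))\<^sup>2) = energy s t (\<lambda>r \<omega>. L (K (X r \<omega>)))"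
    and orth: "\<And>G. G \<in> borel_measurable (\<F> s) \<Longrightarrow> sq_integrable M G \<Longrightarrow> expectation (\<lambda>\<omega>. I \<omega> \<bullet> G \<omega>) = 0"
    by (rule ito_process_increment[OF X st(1-3)]) (rule that)
  define D where "D = drift s t ?b"
  have wX: "sq_integrable \<P> (window s t X)"
    using X st by (intro L2_prog_window[of T]) (auto simp: is_ito_process_def)
  have wb: "sq_integrable \<P> (window s t ?b)" by (rule sq_integrable_window_linear[OF A(1) wX])
  have w\<sigma>: "sq_integrable \<P> (window s t ?\<sigma>)" by (rule sq_integrable_window_linear[OF K(1) wX])
  have eb: "energy s t ?b \<le> a\<^sup>2 * e" unfolding e_def by (rule energy_linear_le[OF A wX])
  have e\<sigma>: "energy s t ?\<sigma> \<le> k\<^sup>2 * e" unfolding e_def by (rule energy_linear_le[OF K wX])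
  have Xs: "X s \<in> borel_measurable (\<F> s)" "sq_integrable M (X s)" and Xt: "sq_integrable M (X t)"
    using ito_process_sq_integrable[OF X] st by auto
  have sD: "sq_integrable M D" unfolding D_def by (rule sq_integrable_drift[OF wb st(2)])
  have ED: "expectation (\<lambda>\<omega>. (norm (D \<omega>))\<^sup>2) \<le> h * (a\<^sup>2 * e)"
    using drift_energy[OF wb st(2)] mult_left_mono[OF eb h(1)] by (simp add: D_def h_def)
  note PXs = sq_integrable_linear[OF P(1) Xs(2)] and PD = sq_integrable_linear[OF P(1) sD]
    and PI = sq_integrable_linear[OF P(1) I(2)]
  note PwX = sq_integrable_linear[OF P(1) wX]

  have "expectation (\<lambda>\<omega>. X t \<omega> \<bullet> P (X t \<omega>)) = expectation (\<lambda>\<omega>. X s \<omega> \<bullet> P (X s \<omega>) + 2 * (P (X s \<omega>) \<bullet> D \<omega>)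
      + 2 * (I \<omega> \<bullet> P (X s \<omega>)) + D \<omega> \<bullet> P (D \<omega>) + 2 * (P (D \<omega>) \<bullet> I \<omega>) + I \<omega> \<bullet> P (I \<omega>))"
  proof (rule integral_cong_AE)
    show "AE \<omega> in M. X t \<omega> \<bullet> P (X t \<omega>) = X s \<omega> \<bullet> P (X s \<omega>) + 2 * (P (X s \<omega>) \<bullet> D \<omega>)
      + 2 * (I \<omega> \<bullet> P (X s \<omega>)) + D \<omega> \<bullet> P (D \<omega>) + 2 * (P (D \<omega>) \<bullet> I \<omega>) + I \<omega> \<bullet> P (I \<omega>)"
      using I(1)
    proof eventually_elim
      case (elim \<omega>)
      have "(u + v + w) \<bullet> P (u + v + w) = u \<bullet> P u + 2 * (P u \<bullet> v) + 2 * (w \<bullet> P u) + v \<bullet> P v + 2 * (P v \<bullet> w) + w \<bullet> P w" for u v w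
        using P(4)[of u v] P(4)[of u w] P(4)[of v w]
        by (simp add: linear_add[OF linP] inner_simps inner_commute)
      then show ?case unfolding elim D_def by simp
    qed
    show "(\<lambda>\<omega>. X t \<omega> \<bullet> P (X t \<omega>)) \<in> borel_measurable M"
      using Xt sq_integrable_linear[OF P(1) Xt] by (intro borel_measurable_inner sq_integrable_measurable)
    show "(\<lambda>\<omega>. X s \<omega> \<bullet> P (X s \<omega>) + 2 * (P (X s \<omega>) \<bullet> D \<omega>)
      + 2 * (I \<omega> \<bullet> P (X s \<omega>)) + D \<omega> \<bullet> P (D \<omega>) + 2 * (P (D \<omega>) \<bullet> I \<omega>) + I \<omega> \<bullet> P (I \<omega>)) \<in> borel_measurable M"
      using sq_integrable_measurable[OF Xs(2)] sq_integrable_measurable[OF PXs] sq_integrable_measurable[OF sD]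
        sq_integrable_measurable[OF PD] sq_integrable_measurable[OF I(2)] sq_integrable_measurable[OF PI]
      by measurable
  qed
  also have "\<dots> = expectation (\<lambda>\<omega>. X s \<omega> \<bullet> P (X s \<omega>)) + 2 * expectation (\<lambda>\<omega>. P (X s \<omega>) \<bullet> D \<omega>)
      + 2 * expectation (\<lambda>\<omega>. I \<omega> \<bullet> P (X s \<omega>)) + expectation (\<lambda>\<omega>. D \<omega> \<bullet> P (D \<omega>))
      + 2 * expectation (\<lambda>\<omega>. P (D \<omega>) \<bullet> I \<omega>) + expectation (\<lambda>\<omega>. I \<omega> \<bullet> P (I \<omega>))"
    using integrable_inner[OF Xs(2) PXs] integrable_inner[OF PXs sD] integrable_inner[OF I(2) PXs]
      integrable_inner[OF sD PD] integrable_inner[OF PD I(2)] integrable_inner[OF I(2) PI]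
    by simp
  finally have expand: "expectation (\<lambda>\<omega>. X t \<omega> \<bullet> P (X t \<omega>)) = \<dots>" .

  have c1: "expectation (\<lambda>\<omega>. I \<omega> \<bullet> P (X s \<omega>)) = 0"
    by (rule orth[OF borel_measurable_continuous_on[OF linear_continuous_on[OF P(1)] Xs(1)] PXs])

  have c2: "expectation (\<lambda>\<omega>. I \<omega> \<bullet> P (I \<omega>)) = (\<integral>z. window s t ?\<sigma> z \<bullet> P (window s t ?\<sigma> z) \<partial>\<P>)"
  proof -
    have L: "bounded_linear (\<lambda>x. x + P x)" "bounded_linear (\<lambda>x. x - P x)"
      by (intro bounded_linear_add bounded_linear_sub bounded_linear_ident P(1))+
    have "4 * expectation (\<lambda>\<omega>. I \<omega> \<bullet> P (I \<omega>)) = energy s t (\<lambda>r \<omega>. K (X r \<omega>) + P (K (X r \<omega>))) - energy s t (\<lambda>r \<omega>. K (X r \<omega>) - P (K (X r \<omega>)))"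
      unfolding integral_quadratic_polarization[OF P(1) I(2)] iso[OF L(1)] iso[OF L(2)] ..
    also have "\<dots> = 4 * (\<integral>z. window s t ?\<sigma> z \<bullet> P (window s t ?\<sigma> z) \<partial>\<P>)"
      unfolding integral_quadratic_polarization[OF P(1) w\<sigma>] energy_def
      using window_linear[OF bounded_linear.linear[OF L(1)], of s t ?\<sigma>] window_linear[OF bounded_linear.linear[OF L(2)], of s t ?\<sigma>]
      by simp
    finally show ?thesis by simp
  qed

  \<comment> \<open>The error made when \<open>X s\<close> is replaced by the running value.\<close>
  define \<Delta> where "\<Delta> r \<omega> = X s \<omega> - X r \<omega>" for r \<omega>
  have w\<Delta>eq: "window s t \<Delta> z = window s t (\<lambda>_. X s) z - window s t X z" for z
    by (simp add: window_def \<Delta>_def scaleR_diff_right)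
  have w\<Delta>: "sq_integrable \<P> (window s t \<Delta>)"
    using sq_integrable_diff[OF sq_integrable_window_const[OF Xs(2), of s t] wX] by (simp add: w\<Delta>eq[abs_def])
  have e\<Delta>: "energy s t \<Delta> \<le> h * ((2 * a\<^sup>2 + 2 * k\<^sup>2) * e)"
  proof -
    have "energy s t \<Delta> \<le> ((2 * a\<^sup>2 + 2 * k\<^sup>2) * e) * (t - s)"
    proof (rule energy_le_of_bound[OF w\<Delta> st(2)])
      show "0 \<le> (2 * a\<^sup>2 + 2 * k\<^sup>2) * e" using e by simp
      fix r assume r: "s < r" "r \<le> t"
      have "expectation (\<lambda>\<omega>. (norm (\<Delta> r \<omega>))\<^sup>2) \<le> 2 * (r - s) * energy s r ?b + 2 * energy s r ?\<sigma>"
        unfolding \<Delta>_def using r st by (intro ito_process_modulus[OF X]) auto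
      also have "\<dots> \<le> 2 * 1 * (a\<^sup>2 * e) + 2 * (k\<^sup>2 * e)"
      proof (intro add_mono mult_mono)
        show "energy s r ?b \<le> a\<^sup>2 * e" using energy_mono[OF wb order_refl _ r(2)] eb r by simp
        show "energy s r ?\<sigma> \<le> k\<^sup>2 * e" using energy_mono[OF w\<sigma> order_refl _ r(2)] e\<sigma> r by simp
      qed (use r st energy_nonneg in auto)
      finally show "expectation (\<lambda>\<omega>. (norm (\<Delta> r \<omega>))\<^sup>2) \<le> (2 * a\<^sup>2 + 2 * k\<^sup>2) * e" by (simp add: algebra_simps)
    qed
    then show ?thesis by (simp add: h_def mult.commute)
  qed

  have c3: "2 * expectation (\<lambda>\<omega>. P (X s \<omega>) \<bullet> D \<omega>) \<le> 2 * (\<integral>z. P (window s t X z) \<bullet> A (window s t X z) \<partial>\<P>)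
      + p\<^sup>2 * (h * ((2 * a\<^sup>2 + 2 * k\<^sup>2) * e)) / \<epsilon> + \<epsilon> * (a\<^sup>2 * e)"
  proof -
    note Pw\<Delta> = sq_integrable_linear[OF P(1) w\<Delta>]
    have split: "window s t (\<lambda>_ \<omega>. P (X s \<omega>)) z = P (window s t X z) + P (window s t \<Delta> z)" for z
      using window_linear[OF linP, of s t "\<lambda>_. X s" z] by (simp add: w\<Delta>eq linear_diff[OF linP])
    have "expectation (\<lambda>\<omega>. P (X s \<omega>) \<bullet> D \<omega>) = (\<integral>z. window s t (\<lambda>_ \<omega>. P (X s \<omega>)) z \<bullet> window s t ?b z \<partial>\<P>)"
      unfolding D_def by (rule drift_inner[OF wb PXs])
    also have "\<dots> = (\<integral>z. P (window s t X z) \<bullet> window s t ?b z \<partial>\<P>) + (\<integral>z. P (window s t \<Delta> z) \<bullet> window s t ?b z \<partial>\<P>)"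
      unfolding split inner_add_left by (rule Bochner_Integration.integral_add[OF integrable_inner[OF PwX wb] integrable_inner[OF Pw\<Delta> wb]])
    finally have eq: "expectation (\<lambda>\<omega>. P (X s \<omega>) \<bullet> D \<omega>) = (\<integral>z. P (window s t X z) \<bullet> A (window s t X z) \<partial>\<P>)
        + (\<integral>z. P (window s t \<Delta> z) \<bullet> window s t ?b z \<partial>\<P>)" by (simp only: window_linear[OF linA])
    have "2 * (\<integral>z. P (window s t \<Delta> z) \<bullet> window s t ?b z \<partial>\<P>)
        \<le> (\<integral>z. (norm (P (window s t \<Delta> z)))\<^sup>2 \<partial>\<P>) / \<epsilon> + \<epsilon> * energy s t ?b"
      unfolding energy_def by (rule integral_young[OF Pw\<Delta> wb \<epsilon>])
    also have "\<dots> \<le> p\<^sup>2 * (h * ((2 * a\<^sup>2 + 2 * k\<^sup>2) * e)) / \<epsilon> + \<epsilon> * (a\<^sup>2 * e)"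
    proof (intro add_mono divide_right_mono mult_left_mono eb)
      have "(\<integral>z. (norm (P (window s t \<Delta> z)))\<^sup>2 \<partial>\<P>) \<le> p\<^sup>2 * energy s t \<Delta>"
        unfolding energy_def by (rule integral_sq_linear_le[OF P(1,3) w\<Delta>])
      also have "\<dots> \<le> p\<^sup>2 * (h * ((2 * a\<^sup>2 + 2 * k\<^sup>2) * e))" by (intro mult_left_mono e\<Delta>) simp
      finally show "(\<integral>z. (norm (P (window s t \<Delta> z)))\<^sup>2 \<partial>\<P>) \<le> p\<^sup>2 * (h * ((2 * a\<^sup>2 + 2 * k\<^sup>2) * e))" .
    qed (use \<epsilon> in auto)
    finally show ?thesis unfolding eq by simp
  qed

  \<comment> \<open>The generator of the quadratic form, integrated over the window.\<close>
  have c4: "2 * (\<integral>z. P (window s t X z) \<bullet> A (window s t X z) \<partial>\<P>) + expectation (\<lambda>\<omega>. I \<omega> \<bullet> P (I \<omega>)) \<le> - \<delta> * e"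
  proof -
    note AwX = sq_integrable_linear[OF A(1) wX] and KwX = sq_integrable_linear[OF K(1) wX]
    note i1 = integrable_inner[OF PwX AwX] and i2 = integrable_inner[OF KwX sq_integrable_linear[OF P(1) KwX]]
    have "2 * (\<integral>z. P (window s t X z) \<bullet> A (window s t X z) \<partial>\<P>) + expectation (\<lambda>\<omega>. I \<omega> \<bullet> P (I \<omega>))
      = (\<integral>z. 2 * (P (window s t X z) \<bullet> A (window s t X z)) + K (window s t X z) \<bullet> P (K (window s t X z)) \<partial>\<P>)"
      unfolding c2 window_linear[OF linK] using i1 i2 by simp
    also have "\<dots> \<le> (\<integral>z. - \<delta> * (norm (window s t X z))\<^sup>2 \<partial>\<P>)"
      using i1 i2 wX decay by (intro integral_mono) (auto simp: sq_integrable_def)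
    also have "\<dots> = - \<delta> * e" by (simp add: e_def energy_def)
    finally show ?thesis .
  qed

  have c5: "expectation (\<lambda>\<omega>. D \<omega> \<bullet> P (D \<omega>)) \<le> p * (h * (a\<^sup>2 * e))"
  proof -
    have "expectation (\<lambda>\<omega>. D \<omega> \<bullet> P (D \<omega>)) \<le> expectation (\<lambda>\<omega>. p * (norm (D \<omega>))\<^sup>2)"
    proof (rule integral_mono[OF integrable_inner[OF sD PD]])
      show "integrable M (\<lambda>\<omega>. p * (norm (D \<omega>))\<^sup>2)" using sD by (simp add: sq_integrable_def)
      fix \<omega>
      have "D \<omega> \<bullet> P (D \<omega>) \<le> norm (D \<omega>) * norm (P (D \<omega>))" by (rule norm_cauchy_schwarz)
      also have "\<dots> \<le> norm (D \<omega>) * (p * norm (D \<omega>))" by (intro mult_left_mono P(3)) simp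
      finally show "D \<omega> \<bullet> P (D \<omega>) \<le> p * (norm (D \<omega>))\<^sup>2" by (simp add: power2_eq_square mult_ac)
    qed
    also have "\<dots> \<le> p * (h * (a\<^sup>2 * e))" using mult_left_mono[OF ED P(2)] by simp
    finally show ?thesis .
  qed

  have c6: "2 * expectation (\<lambda>\<omega>. P (D \<omega>) \<bullet> I \<omega>) \<le> p\<^sup>2 * (h * (a\<^sup>2 * e)) / \<epsilon> + \<epsilon> * (k\<^sup>2 * e)"
  proof -
    have "2 * expectation (\<lambda>\<omega>. P (D \<omega>) \<bullet> I \<omega>) \<le> expectation (\<lambda>\<omega>. (norm (P (D \<omega>)))\<^sup>2) / \<epsilon> + \<epsilon> * expectation (\<lambda>\<omega>. (norm (I \<omega>))\<^sup>2)"
      by (rule integral_young[OF PD I(2) \<epsilon>])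
    also have "\<dots> \<le> p\<^sup>2 * (h * (a\<^sup>2 * e)) / \<epsilon> + \<epsilon> * (k\<^sup>2 * e)"
    proof (intro add_mono divide_right_mono mult_left_mono)
      have "expectation (\<lambda>\<omega>. (norm (P (D \<omega>)))\<^sup>2) \<le> p\<^sup>2 * expectation (\<lambda>\<omega>. (norm (D \<omega>))\<^sup>2)"
        by (rule integral_sq_linear_le[OF P(1,3) sD])
      also have "\<dots> \<le> p\<^sup>2 * (h * (a\<^sup>2 * e))" by (intro mult_left_mono ED) simp
      finally show "expectation (\<lambda>\<omega>. (norm (P (D \<omega>)))\<^sup>2) \<le> p\<^sup>2 * (h * (a\<^sup>2 * e))" .
      show "expectation (\<lambda>\<omega>. (norm (I \<omega>))\<^sup>2) \<le> k\<^sup>2 * e" using iso[OF bounded_linear_ident] e\<sigma> by simp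
    qed (use \<epsilon> in auto)
    finally show ?thesis .
  qed

  have "expectation (\<lambda>\<omega>. X t \<omega> \<bullet> P (X t \<omega>)) \<le> expectation (\<lambda>\<omega>. X s \<omega> \<bullet> P (X s \<omega>)) - \<delta> * e
      + p\<^sup>2 * (h * ((2 * a\<^sup>2 + 2 * k\<^sup>2) * e)) / \<epsilon> + \<epsilon> * (a\<^sup>2 * e)
      + p * (h * (a\<^sup>2 * e)) + (p\<^sup>2 * (h * (a\<^sup>2 * e)) / \<epsilon> + \<epsilon> * (k\<^sup>2 * e))"
    using expand c1 c3 c4 c5 c6 by linarith
  also have "\<dots> = expectation (\<lambda>\<omega>. X s \<omega> \<bullet> P (X s \<omega>))
    + (- \<delta> + \<epsilon> * (a\<^sup>2 + k\<^sup>2) + h * (p\<^sup>2 * (2 * a\<^sup>2 + 2 * k\<^sup>2) / \<epsilon> + p * a\<^sup>2 + p\<^sup>2 * a\<^sup>2 / \<epsilon>)) * e"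
    using \<epsilon> by (simp add: field_simps)
  finally show ?thesis by (simp only: h_def e_def)
qed

text \<open>
  First \<open>\<epsilon>\<close> and then the window length are chosen so that each correction takes up at most a quarter of
  the decay rate.
\<close>

lemma lyapunov_step:
  fixes A K P :: "'a::euclidean_space \<Rightarrow> 'a"
  assumes A: "bounded_linear A" and K: "bounded_linear K"
    and P: "bounded_linear P" "\<And>x y. P x \<bullet> y = x \<bullet> P y"
    and \<delta>: "0 < \<delta>" and decay: "\<And>x. 2 * (P x \<bullet> A x) + K x \<bullet> P (K x) \<le> - \<delta> * (norm x)\<^sup>2"
  obtains h where "0 < h"
    "\<And>T x X s t. \<lbrakk>is_ito_process M W T x (\<lambda>r \<omega>. A (X r \<omega>)) (\<lambda>r \<omega>. K (X r \<omega>)) X; 0 \<le> s; s \<le> t; t \<le> T; t - s \<le> h\<rbrakk>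
      \<Longrightarrow> expectation (\<lambda>\<omega>. X t \<omega> \<bullet> P (X t \<omega>)) \<le> expectation (\<lambda>\<omega>. X s \<omega> \<bullet> P (X s \<omega>)) - \<delta> / 2 * energy s t X"
proof -
  obtain a where a: "0 \<le> a" "\<And>x. norm (A x) \<le> a * norm x" using bounded_linear_bound_nonneg[OF A] by blast
  obtain k where k: "0 \<le> k" "\<And>x. norm (K x) \<le> k * norm x" using bounded_linear_bound_nonneg[OF K] by blast
  obtain p where p: "0 \<le> p" "\<And>x. norm (P x) \<le> p * norm x" using bounded_linear_bound_nonneg[OF P(1)] by blast
  define q where "q = a\<^sup>2 + k\<^sup>2"
  have q: "0 \<le> q" by (simp add: q_def)
  define \<epsilon> where "\<epsilon> = \<delta> / (4 * (1 + q))"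
  have \<epsilon>: "0 < \<epsilon>" using \<delta> q by (simp add: \<epsilon>_def)
  have "\<epsilon> * q \<le> \<epsilon> * (1 + q)" using \<epsilon> by (intro mult_left_mono) auto
  also have "\<dots> = \<delta> / 4" using q by (simp add: \<epsilon>_def field_simps)
  finally have \<epsilon>q: "\<epsilon> * q \<le> \<delta> / 4" .
  define c where "c = p\<^sup>2 * (2 * a\<^sup>2 + 2 * k\<^sup>2) / \<epsilon> + p * a\<^sup>2 + p\<^sup>2 * a\<^sup>2 / \<epsilon>"
  have c: "0 \<le> c" using \<epsilon> p by (simp add: c_def)
  define h where "h = min 1 (\<delta> / (4 * (1 + c)))"
  have h: "0 < h" "h \<le> 1" using \<delta> c by (auto simp: h_def)
  have "h * c \<le> h * (1 + c)" using h by (intro mult_left_mono) auto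
  also have "\<dots> \<le> \<delta> / (4 * (1 + c)) * (1 + c)" using c by (intro mult_right_mono) (auto simp: h_def)
  also have "\<dots> = \<delta> / 4" using c by (simp add: field_simps)
  finally have hc: "h * c \<le> \<delta> / 4" .
  show thesis
  proof
    show "0 < h" by fact
    fix T x X s t
    assume X: "is_ito_process M W T x (\<lambda>r \<omega>. A (X r \<omega>)) (\<lambda>r \<omega>. K (X r \<omega>)) X"
      and st: "0 \<le> s" "s \<le> t" "t \<le> T" "t - s \<le> h"
    have "expectation (\<lambda>\<omega>. X t \<omega> \<bullet> P (X t \<omega>)) \<le> expectation (\<lambda>\<omega>. X s \<omega> \<bullet> P (X s \<omega>))
      + (- \<delta> + \<epsilon> * q + (t - s) * c) * energy s t X"
      unfolding q_def c_def
      by (rule lyapunov_increment[OF X A a(2) K k(2) P(1) p P(2) decay st(1-3) _ \<epsilon>]) (use st h in simp)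
    moreover have "(- \<delta> + \<epsilon> * q + (t - s) * c) * energy s t X \<le> (- \<delta> / 2) * energy s t X"
    proof (intro mult_right_mono energy_nonneg)
      have "(t - s) * c \<le> h * c" using st c by (intro mult_right_mono) auto
      then show "- \<delta> + \<epsilon> * q + (t - s) * c \<le> - \<delta> / 2" using hc \<epsilon>q by linarith
    qed
    ultimately show "expectation (\<lambda>\<omega>. X t \<omega> \<bullet> P (X t \<omega>)) \<le> expectation (\<lambda>\<omega>. X s \<omega> \<bullet> P (X s \<omega>)) - \<delta> / 2 * energy s t X"
      by simp
  qed
qed

lemma lyapunov_imp_energy_bounded:
  fixes X :: "real \<Rightarrow> 'w \<Rightarrow> 'a::euclidean_space" and A K P :: "'a \<Rightarrow> 'a"
  assumes A: "bounded_linear A" and K: "bounded_linear K"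
    and P: "bounded_linear P" "\<And>x y. P x \<bullet> y = x \<bullet> P y" "\<And>x. 0 \<le> x \<bullet> P x"
    and \<delta>: "0 < \<delta>" and decay: "\<And>x. 2 * (P x \<bullet> A x) + K x \<bullet> P (K x) \<le> - \<delta> * (norm x)\<^sup>2"
    and X: "\<And>T. 0 \<le> T \<Longrightarrow> is_ito_process M W T x (\<lambda>r \<omega>. A (X r \<omega>)) (\<lambda>r \<omega>. K (X r \<omega>)) X"
    and T: "0 \<le> T"
  shows "energy 0 T X \<le> 2 * expectation (\<lambda>\<omega>. X 0 \<omega> \<bullet> P (X 0 \<omega>)) / \<delta>"
proof -
  let ?V = "\<lambda>t. expectation (\<lambda>\<omega>. X t \<omega> \<bullet> P (X t \<omega>))"
  obtain h where h: "0 < h"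
    and step: "\<And>T x X s t. \<lbrakk>is_ito_process M W T x (\<lambda>r \<omega>. A (X r \<omega>)) (\<lambda>r \<omega>. K (X r \<omega>)) X; 0 \<le> s; s \<le> t; t \<le> T; t - s \<le> h\<rbrakk>
      \<Longrightarrow> expectation (\<lambda>\<omega>. X t \<omega> \<bullet> P (X t \<omega>)) \<le> expectation (\<lambda>\<omega>. X s \<omega> \<bullet> P (X s \<omega>)) - \<delta> / 2 * energy s t X"
    by (rule lyapunov_step[OF A K P(1,2) \<delta> decay]) (rule that)
  have w: "sq_integrable \<P> (window s t X)" if "0 \<le> s" "0 \<le> t" for s t
    using X[OF that(2)] that by (intro L2_prog_window[of t]) (auto simp: is_ito_process_def)
  have ind: "?V (real j * h) + \<delta> / 2 * energy 0 (real j * h) X \<le> ?V 0" for j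
  proof (induction j)
    case 0
    then show ?case by (simp add: energy_def window_def)
  next
    case (Suc j)
    let ?s = "real j * h" and ?t = "real (Suc j) * h"
    have st: "0 \<le> ?s" "?s \<le> ?t" "?t - ?s \<le> h" using h by (auto simp: algebra_simps)
    have "energy 0 ?t X = energy 0 ?s X + energy ?s ?t X"
      using st by (intro energy_split w) auto
    moreover have "?V ?t \<le> ?V ?s - \<delta> / 2 * energy ?s ?t X"
      using st by (intro step[OF X[of ?t]]) auto
    ultimately show ?case using Suc by (simp only: distrib_left)
  qed
  obtain j :: nat where "T / h \<le> real j" using real_arch_simple by blast
  then have j: "T \<le> real j * h" using h by (simp add: field_simps)
  have "energy 0 T X \<le> energy 0 (real j * h) X"
    using j T h by (intro energy_mono w) auto
  moreover have "0 \<le> ?V (real j * h)" using P(3) by simp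
  ultimately have "\<delta> / 2 * energy 0 T X \<le> ?V 0"
    using ind[of j] mult_left_mono[of "energy 0 T X" "energy 0 (real j * h) X" "\<delta> / 2"] \<delta> by linarith
  then show ?thesis using \<delta> by (simp add: field_simps)
qed

text \<open>
  Monotone convergence along the windows \<open>(0, j]\<close>.
\<close>

lemma infinite_horizon_energy_finite:
  fixes X :: "real \<Rightarrow> 'w \<Rightarrow> 'a::euclidean_space"
  assumes w: "\<And>T. 0 \<le> T \<Longrightarrow> sq_integrable \<P> (window 0 T X)" and bnd: "\<And>T. 0 \<le> T \<Longrightarrow> energy 0 T X \<le> c"
  shows "(\<integral>\<^sup>+\<omega>. (\<integral>\<^sup>+t\<in>{0..}. ennreal ((norm (X t \<omega>))\<^sup>2) \<partial>lborel) \<partial>M) < \<infinity>"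
proof -
  define f where "f j z = ennreal ((norm (window 0 (real j) X z))\<^sup>2)" for j :: nat and z
  define g where "g z = (SUP j. f j z)" for z
  have fm: "f j \<in> borel_measurable \<P>" for j
    using sq_integrable_measurable[OF w[of "real j"]] unfolding f_def by measurable
  then have gm: "g \<in> borel_measurable \<P>" unfolding g_def[abs_def] by (intro borel_measurable_SUP) auto
  have inc: "incseq f" by (auto simp: incseq_def le_fun_def f_def window_def indicator_def)
  have g: "g (t, \<omega>) = ennreal ((norm (X t \<omega>))\<^sup>2) * indicator {0<..} t" for t \<omega>
  proof (cases "0 < t")
    case True
    obtain j :: nat where j: "t \<le> real j" using real_arch_simple by blast
    have "g (t, \<omega>) = ennreal ((norm (X t \<omega>))\<^sup>2)"
      unfolding g_def
    proof (rule antisym)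
      show "(SUP j. f j (t, \<omega>)) \<le> ennreal ((norm (X t \<omega>))\<^sup>2)"
        by (rule SUP_least) (auto simp: f_def window_def indicator_def)
      show "ennreal ((norm (X t \<omega>))\<^sup>2) \<le> (SUP j. f j (t, \<omega>))"
        by (rule SUP_upper2[of j]) (use True j in \<open>auto simp: f_def window_def indicator_def\<close>)
    qed
    then show ?thesis using True by simp
  next
    case False
    then have "f j (t, \<omega>) = 0" for j by (simp add: f_def window_def)
    then show ?thesis using False by (simp add: g_def)
  qed
  have "(\<integral>\<^sup>+t\<in>{0..}. ennreal ((norm (X t \<omega>))\<^sup>2) \<partial>lborel) = (\<integral>\<^sup>+t. g (t, \<omega>) \<partial>lborel)" for \<omega>
    using AE_lborel_singleton[of 0]
    by (intro nn_integral_cong_AE) (auto simp: g indicator_def elim!: eventually_mono)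
  then have "(\<integral>\<^sup>+\<omega>. (\<integral>\<^sup>+t\<in>{0..}. ennreal ((norm (X t \<omega>))\<^sup>2) \<partial>lborel) \<partial>M) = (\<integral>\<^sup>+z. g z \<partial>\<P>)"
    using time_space.nn_integral_snd[OF gm] by simp
  also have "\<dots> = (SUP j. \<integral>\<^sup>+z. f j z \<partial>\<P>)"
    unfolding g_def by (rule nn_integral_monotone_convergence_SUP[OF inc fm])
  also have "\<dots> \<le> ennreal c"
  proof (rule SUP_least)
    fix j :: nat
    have "(\<integral>\<^sup>+z. f j z \<partial>\<P>) = ennreal (energy 0 (real j) X)"
      unfolding f_def energy_def by (rule nn_integral_sq_eq[OF w]) simp
    then show "(\<integral>\<^sup>+z. f j z \<partial>\<P>) \<le> ennreal c" using bnd[of "real j"] by (simp add: ennreal_leI)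
  qed
  also have "\<dots> < \<infinity>" by simp
  finally show ?thesis .
qed

end

section \<open>Exact controllability implies stabilizability\<close>

theorem proposition4p1:
  fixes M :: "'w measure" and W :: "real \<Rightarrow> 'w \<Rightarrow> real"
    and A C :: "real^'n^'n" and B :: "real^'m^'n" and T :: real
  assumes "complete_measure M"
    and "standard_brownian_motion M W"
    and "T > 0"
    and "exactly_controllable_on M W T A B C"
  shows "stabilizable M W A B C"
proof -
  interpret standard_brownian_motion M W by fact
  \<comment> \<open>A matrix \<open>S\<close> as in the alternative is incompatible with steering every \<open>x\<close> to \<open>0\<close>.\<close>
  have "\<exists>Q \<rho>. transpose Q = Q \<and> posdef Q \<and> 0 \<le> \<rho> \<and> posdef (backward_lyapunov A C Q + \<rho> *\<^sub>R (B ** transpose B))"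
  proof (rule ccontr)
    assume "\<not> ?thesis"
    then obtain S :: "real^'n^'n" where S: "S \<noteq> 0" "\<And>u. S *v (B *v u) = 0"
      "\<And>v. S *v v = 0 \<Longrightarrow> S *v (A *v v) = 0" "\<And>v. S *v v = 0 \<Longrightarrow> S *v (C *v v) = 0"
      using stabilization_alternative[of A C B] by blast
    obtain a where a: "0 \<le> a" "\<And>v. norm ((S ** A) *v v) \<le> a * norm (S *v v)"
      using kernel_inclusion_norm_bound[of S "S ** A"] S(3) by (auto simp: matrix_vector_mul_assoc[symmetric])
    obtain c where c: "0 \<le> c" "\<And>v. norm ((S ** C) *v v) \<le> c * norm (S *v v)"
      using kernel_inclusion_norm_bound[of S "S ** C"] S(4) by (auto simp: matrix_vector_mul_assoc[symmetric])
    have "S *v x = 0" for x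
    proof -
      have "L2_rv M W T (\<lambda>_. 0 :: real^'n)" by (simp add: L2_rv_def)
      then obtain u z X where X: "controlled_solution M W T A B C x u z X" "AE \<omega> in M. X T \<omega> = 0"
        using assms(4) unfolding exactly_controllable_on_def by blast
      show ?thesis
      proof (rule backward_uniqueness[OF X(1)[unfolded controlled_solution_def] matrix_vector_mul_bounded_linear])
        show "0 \<le> max a c" using a(1) by simp
        show "0 \<le> T" using assms(3) by simp
        show "AE \<omega> in M. S *v X T \<omega> = 0" using X(2) by eventually_elim simp
        fix r \<omega>
        have "norm (S *v (A *v X r \<omega> + B *v u r \<omega> + C *v z r \<omega>)) = norm ((S ** A) *v X r \<omega> + (S ** C) *v z r \<omega>)"
          by (simp add: matrix_vector_right_distrib S(2)[unfolded matrix_vector_mul_assoc] matrix_vector_mul_assoc)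
        also have "\<dots> \<le> a * norm (S *v X r \<omega>) + c * norm (S *v z r \<omega>)"
          by (rule norm_triangle_le[OF add_mono[OF a(2) c(2)]])
        also have "\<dots> \<le> max a c * norm (S *v X r \<omega>) + max a c * norm (S *v z r \<omega>)"
          by (intro add_mono mult_right_mono) auto
        finally show "norm (S *v (A *v X r \<omega> + B *v u r \<omega> + C *v z r \<omega>)) \<le> max a c * (norm (S *v X r \<omega>) + norm (S *v z r \<omega>))"
          by (simp add: distrib_left)
      qed
    qed
    then have "S = 0" by (simp add: matrix_eq)
    with S(1) show False ..
  qed
  then obtain Q \<rho> where Q: "transpose Q = Q" "posdef Q" "posdef (backward_lyapunov A C Q + \<rho> *\<^sub>R (B ** transpose B))"
    by blast
  obtain F :: "real^'n^'m" and K P :: "real^'n^'n" and \<delta> :: real where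
    P: "transpose P = P" "\<And>x. 0 \<le> x \<bullet> (P *v x)" and \<delta>: "0 < \<delta>"
    and decay: "\<And>x. 2 * ((P *v x) \<bullet> ((A + B ** F + C ** K) *v x)) + (K *v x) \<bullet> (P *v (K *v x)) \<le> - \<delta> * (norm x)\<^sup>2"
    by (rule lyapunov_feedback[OF Q]) (rule that)
  have "L2_stable_closed_loop M W A B C F K"
    unfolding L2_stable_closed_loop_def
  proof (intro allI impI)
    fix x X assume "closed_loop_solution M W A B C F K x X"
    then have X: "is_ito_process M W T x (\<lambda>t \<omega>. (A + B ** F + C ** K) *v X t \<omega>) (\<lambda>t \<omega>. K *v X t \<omega>) X"
      if "0 \<le> T" for T
      using that unfolding closed_loop_solution_def by blast
    show "(\<integral>\<^sup>+\<omega>. (\<integral>\<^sup>+t\<in>{0..}. ennreal ((norm (X t \<omega>))\<^sup>2) \<partial>lborel) \<partial>M) < \<infinity>"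
    proof (rule infinite_horizon_energy_finite)
      show "sq_integrable \<P> (window 0 T X)" if "0 \<le> T" for T
        using X[OF that] that by (intro L2_prog_window[of T]) (auto simp: is_ito_process_def)
      show "energy 0 T X \<le> 2 * expectation (\<lambda>\<omega>. X 0 \<omega> \<bullet> (P *v X 0 \<omega>)) / \<delta>" if "0 \<le> T" for T
        by (rule lyapunov_imp_energy_bounded[OF matrix_vector_mul_bounded_linear matrix_vector_mul_bounded_linear
              matrix_vector_mul_bounded_linear symmetric_inner_swap[OF P(1)] P(2) \<delta> decay X that])
    qed
  qed
  then show ?thesis unfolding stabilizable_def by blast
qed

end
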